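(* Let $Q\in L^2([0,1];\mathbb{C}^{n\times n})$, let $B=B^*$, and suppose that $$\det(CP_++DP_-)\neq0\qquad\text{and}\qquad \det(CP_-+DP_+)\neq0.$$ Then the system of root functions of the boundary value problem $-iBy'+Q(x)y=\lambda y$, $Cy(0)+Dy(1)=0$ is complete and minimal in $L^2([0,1];\mathbb{C}^n)$.
   Context: Setting. $B=\operatorname{diag}(b_1^{-1}I_{n_1},\dots,b_r^{-1}I_{n_r})\in\mathbb{C}^{n\times n}$, $n=n_1+\dots+n_r$, is a nonsingular diagonal matrix, $b_j\neq b_k$ for $j\neq k$ (real entries when $B=B^*$). $C,D\in\mathbb{C}^{n\times n}$ satisfy $\operatorname{rank}(C\ D)=n$. $P_+$ and $P_-$ are the spectral projectors of $B=B^*$ onto the positive and negative parts of its spectrum, respectively. The boundary value problem is identified with the operator $L_{C,D}(Q)$ in $L^2([0,1];\mathbb{C}^n)$ acting by $Ly=-iBy'+Q(x)y$ on $\{y\in W^1_2([0,1];\mathbb{C}^n): Cy(0)+Dy(1)=0\}$. Root functions are eigenfunctions and associated functions; the system of root functions is the union, over all eigenvalues $\lambda$, of bases of the root subspaces $\operatorname{span}\{\ker(L_{C,D}(Q)-\lambda)^k: k\in\mathbb{N}\}$. A system is complete if its closed linear span is the whole space, and minimal if no element belongs to the closed linear span of the others. *)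

theory Defs
  imports "HOL-Analysis.Analysis" "HOL-Library.Function_Algebras"
begin

section \<open>Matrices\<close>

text \<open>
  The blocks of the diagonal matrix are given by a labelling \<open>p\<close> of the indices: \<open>p i\<close> is the block
  to which \<open>i\<close> belongs, the size \<open>n\<^sub>j\<close> of block \<open>j\<close> is the cardinality of the fibre of \<open>p\<close> over \<open>j\<close>,
  and the diagonal entry on block \<open>j\<close> is the inverse of \<open>b j\<close>. No order is imposed on the indices, so
  a block need not consist of consecutive indices.
\<close>

definition block_diag :: "('n::finite \<Rightarrow> 'r) \<Rightarrow> ('r \<Rightarrow> complex) \<Rightarrow> complex^'n^'n" where
  "block_diag p b = (\<chi> i j. if i = j then inverse (b (p i)) else 0)"

definition hermitian :: "complex^'n^'n \<Rightarrow> bool" where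
  "hermitian A \<longleftrightarrow> map_matrix cnj (transpose A) = A"

definition hconcat :: "complex^'n^'n \<Rightarrow> complex^'n^'n \<Rightarrow> complex^('n + 'n)^'n" where
  "hconcat C D = (\<chi> i j. case j of Inl k \<Rightarrow> C $ i $ k | Inr k \<Rightarrow> D $ i $ k)"

text \<open>
  The spectral projector of a diagonalizable matrix onto the part \<open>S\<close> of its spectrum: the identity
  on the eigenspaces for eigenvalues in \<open>S\<close>, zero on all other eigenspaces. For a Hermitian matrix
  it is the orthogonal projector onto the sum of the eigenspaces for eigenvalues in \<open>S\<close>. The
  description determines the matrix because the eigenvectors span the whole space.
\<close>

definition spectral_projector :: "complex^'n^'n \<Rightarrow> complex set \<Rightarrow> complex^'n^'n" where
  "spectral_projector A S =
    (THE P. \<forall>\<mu> v. A *v v = \<mu> *s v \<longrightarrow> P *v v = (if \<mu> \<in> S then v else 0))"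

definition pos_projector :: "complex^'n^'n \<Rightarrow> complex^'n^'n" where
  "pos_projector A = spectral_projector A {complex_of_real t | t. t > 0}"

definition neg_projector :: "complex^'n^'n \<Rightarrow> complex^'n^'n" where
  "neg_projector A = spectral_projector A {complex_of_real t | t. t < 0}"

lemma spectral_projector_diag:
  fixes d :: "'n::finite \<Rightarrow> complex"
  shows "spectral_projector (\<chi> i j. if i = j then d i else 0) S =
    (\<chi> i j. if i = j \<and> d i \<in> S then 1 else 0)" (is "spectral_projector ?A S = ?P")
proof -
  have A: "(?A *v v) $ i = d i * v $ i" for v i
    by (simp add: matrix_vector_mult_def mult_delta_left)
  have P: "(?P *v v) $ i = (if d i \<in> S then v $ i else 0)" for v i
    by (cases "d i \<in> S") (simp_all add: matrix_vector_mult_def mult_delta_left)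
  show ?thesis unfolding spectral_projector_def
  proof (rule the_equality)
    show "\<forall>\<mu> v. ?A *v v = \<mu> *s v \<longrightarrow> ?P *v v = (if \<mu> \<in> S then v else 0)"
    proof (intro allI impI)
      fix \<mu> and v :: "complex^'n"
      assume h: "?A *v v = \<mu> *s v"
      have e: "d i = \<mu> \<or> v $ i = 0" for i
        using arg_cong[OF h, of "\<lambda>w. w $ i"] unfolding A vector_smult_component
        by (simp only: mult_cancel_right disj_commute)
      show "?P *v v = (if \<mu> \<in> S then v else 0)"
      proof (rule vec_eq_iff[THEN iffD2], rule allI)
        fix i show "(?P *v v) $ i = (if \<mu> \<in> S then v else 0) $ i"
          unfolding P using e[of i] by (auto simp del: matrix_vector_mul_component)
      qed
    qed
  next
    fix R assume R: "\<forall>\<mu> v. ?A *v v = \<mu> *s v \<longrightarrow> R *v v = (if \<mu> \<in> S then v else 0)"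
    have "R $ i $ j = ?P $ i $ j" for i j
    proof -
      have "?A *v axis j 1 = d j *s axis j 1"
        unfolding vec_eq_iff by (auto simp: A axis_def)
      hence "R *v axis j 1 = (if d j \<in> S then axis j 1 else 0)"
        by (rule R[rule_format])
      hence "(R *v axis j 1) $ i = (if i = j \<and> d j \<in> S then 1 else 0)"
        by (auto simp: axis_def)
      moreover have "(R *v axis j 1) $ i = R $ i $ j"
        by (simp add: matrix_vector_mult_def axis_def mult_delta_right)
      ultimately show ?thesis by auto
    qed
    thus "R = ?P" by (simp add: vec_eq_iff)
  qed
qed

section \<open>Functions on the unit interval\<close>

text \<open>
  Elements of \<open>L\<^sup>2([0,1])\<close> are represented by functions on the real line whose values
  outside the unit interval are irrelevant.
\<close>

definition L2 :: "(real \<Rightarrow> 'a::euclidean_space) set" where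
  "L2 = {f. f \<in> borel_measurable (lebesgue_on {0..1}) \<and>
            integrable (lebesgue_on {0..1}) (\<lambda>x. (norm (f x))\<^sup>2)}"

definition L2_norm :: "(real \<Rightarrow> 'a::euclidean_space) \<Rightarrow> real" where
  "L2_norm f = sqrt (integral\<^sup>L (lebesgue_on {0..1}) (\<lambda>x. (norm (f x))\<^sup>2))"

text \<open>
  \<open>W12_deriv y g\<close>: \<open>y\<close> is in the Sobolev space \<open>W\<^sup>1\<^sub>2([0,1])\<close>, that is, absolutely continuous on the unit
  interval with derivative \<open>g\<close> in \<open>L\<^sup>2\<close>. The class of \<open>y\<close> is represented by its continuous
  representative, extended by zero, so that the representing function is unique and the span,
  independence and vanishing of such functions have the same meaning as in \<open>L\<^sup>2\<close>.
\<close>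

definition W12_deriv :: "(real \<Rightarrow> complex^'n) \<Rightarrow> (real \<Rightarrow> complex^'n) \<Rightarrow> bool" where
  "W12_deriv y g \<longleftrightarrow> g \<in> L2 \<and>
     (\<forall>x\<in>{0..1}. y x = y 0 + integral\<^sup>L (lebesgue_on {0..x}) g) \<and>
     (\<forall>x. x \<notin> {0..1} \<longrightarrow> y x = 0)"

global_interpretation cfun: vector_space "\<lambda>(c::complex) (f::real \<Rightarrow> complex^'n) x. c *s f x"
  by unfold_locales (simp_all add: fun_eq_iff vec.scale_right_distrib vec.scale_left_distrib)

definition closed_span :: "(real \<Rightarrow> complex^'n) set \<Rightarrow> (real \<Rightarrow> complex^'n) set" where
  "closed_span S = {f \<in> L2. \<forall>\<epsilon>>0. \<exists>h\<in>cfun.span S. L2_norm (f - h) < \<epsilon>}"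

definition complete_system :: "(real \<Rightarrow> complex^'n) set \<Rightarrow> bool" where
  "complete_system S \<longleftrightarrow> S \<subseteq> L2 \<and> closed_span S = L2"

definition minimal_system :: "(real \<Rightarrow> complex^'n) set \<Rightarrow> bool" where
  "minimal_system S \<longleftrightarrow> S \<subseteq> L2 \<and> (\<forall>f\<in>S. f \<notin> closed_span (S - {f}))"

section \<open>The boundary value problem and its root functions\<close>

type_synonym 'n operator_graph = "((real \<Rightarrow> complex^'n) \<times> (real \<Rightarrow> complex^'n)) set"

text \<open>
  Operators are given by their graphs. The second component of a pair runs over all representatives
  of the value in \<open>L\<^sup>2\<close>; the first one is the normalized representative above. Hence relational powers
  of a graph are the graphs of the powers of the operator, with their natural domains.
\<close>

definition bvp_operator ::
    "complex^'n^'n \<Rightarrow> (real \<Rightarrow> complex^'n^'n) \<Rightarrow> complex^'n^'n \<Rightarrow> complex^'n^'n \<Rightarrow> 'n operator_graph" where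
  "bvp_operator B Q C D = {(y, f). f \<in> L2 \<and> C *v y 0 + D *v y 1 = 0 \<and>
     (\<exists>g. W12_deriv y g \<and>
       (AE x in lebesgue_on {0..1}. (- \<i>) *s (B *v g x) + Q x *v y x = f x))}"

definition shifted :: "'n::finite operator_graph \<Rightarrow> complex \<Rightarrow> 'n operator_graph" where
  "shifted L \<mu> = {(y, \<lambda>x. f x - \<mu> *s y x) | y f. (y, f) \<in> L}"

definition op_kernel :: "'n::finite operator_graph \<Rightarrow> (real \<Rightarrow> complex^'n) set" where
  "op_kernel L = {y. (y, 0) \<in> L}"

definition eigenvalues :: "'n::finite operator_graph \<Rightarrow> complex set" where
  "eigenvalues L = {\<mu>. \<exists>y\<in>op_kernel (shifted L \<mu>). y \<noteq> 0}"

definition root_subspace :: "'n::finite operator_graph \<Rightarrow> complex \<Rightarrow> (real \<Rightarrow> complex^'n) set" where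
  "root_subspace L \<mu> = cfun.span (\<Union>k. op_kernel (shifted L \<mu> ^^ k))"

definition root_function_system :: "'n::finite operator_graph \<Rightarrow> (real \<Rightarrow> complex^'n) set \<Rightarrow> bool" where
  "root_function_system L \<Psi> \<longleftrightarrow>
    (\<exists>E. (\<forall>\<mu>\<in>eigenvalues L. cfun.independent (E \<mu>) \<and> cfun.span (E \<mu>) = root_subspace L \<mu>) \<and>
         \<Psi> = (\<Union>\<mu>\<in>eigenvalues L. E \<mu>))"

end

theory Submission
  imports Defs "HOL-Complex_Analysis.Complex_Analysis"
begin

text \<open>
  Let \<open>\<Delta> = det (C + D \<Phi>(1, \<cdot>))\<close> be the characteristic determinant, an entire function bounded on horizontal
  strips. In a half plane \<open>Im \<zeta> \<ge> N\<close> or \<open>Im \<zeta> \<le> - N\<close> every component of a solution decays from one of the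
  two end points. There the boundary conditions determine the values at these end points up to small
  errors, because \<open>det (C P\<^sub>+ + D P\<^sub>-)\<close> and \<open>det (C P\<^sub>- + D P\<^sub>+)\<close> do not vanish. So \<open>\<Delta>\<close> is bounded away from zero there
  and the resolvent is \<open>O(1 / sqrt \<bar>Im \<zeta>\<bar>)\<close> from \<open>L\<^sup>2\<close> to the continuous functions.

  If a functional \<open>l\<close> annihilates all root functions, then \<open>F(\<zeta>) = l (R(\<zeta>) h)\<close> has no poles, as the principal parts
  of the resolvent have values in the root subspaces. Now \<open>F\<close> is a quotient \<open>G / \<Delta>\<close> of entire functions bounded
  on strips; normal families and the maximum principle bound it on the remaining strip. By Liouville's
  theorem \<open>F = 0\<close>, so \<open>l\<close> vanishes on the domain of the operator, which is dense. This gives completeness.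
  For minimality, the Riesz projector at an eigenvalue \<open>\<mu>\<close> is continuous and of finite rank; up to sign it is the
  identity on the root subspace at \<open>\<mu>\<close> and it is zero on all others.
\<close>

section \<open>Square integrable functions on the unit interval\<close>

text \<open>Since \<open>Q\<close> is merely square integrable, no pointwise asymptotics of
  solutions are used. The term containing \<open>Q\<close> is treated as part of the forcing, and
  the decay 1 / sqrt \<bar>Im \<zeta>\<bar> comes from the L2 norm of an exponential kernel; this
  makes the term absorbable for large \<bar>Im \<zeta>\<bar>. Near the real axis there is no lower
  bound for the characteristic determinant between its zeros. What is known there is that the upper
  bounds depend on Im \<zeta> alone, hence are invariant under horizontal translation, and this
  supplies the compactness. Two devices keep the analysis scalar. Analytic dependence on \<zeta> is
  asserted only after applying a functional bounded in the sup norm, and the Laurent coefficients of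
  the resolvent are defined by formal power series in the Taylor coefficients of solutions, not by
  contour integrals. The resolvent inverts L - \<zeta>, so its residue is minus the spectral
  projector, which explains the signs in the minimality argument.\<close>

lemma integrable_lebesgue_on_iff:
  fixes f :: "real \<Rightarrow> 'a::euclidean_space"
  assumes "S \<in> sets lebesgue"
  shows "integrable (lebesgue_on S) f \<longleftrightarrow> f absolutely_integrable_on S"
  using assms by (simp add: set_integrable_def integrable_restrict_space)

lemma L2_measurable: "f \<in> L2 \<Longrightarrow> f \<in> borel_measurable (lebesgue_on {0..1})"
  by (simp add: L2_def)

lemma L2_sq_absolutely_integrable:
  fixes f :: "real \<Rightarrow> 'a::euclidean_space"
  assumes "f \<in> L2" shows "(\<lambda>x. (norm (f x))\<^sup>2) absolutely_integrable_on {0..1}"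
  using assms by (simp add: L2_def integrable_lebesgue_on_iff)

lemma L2_sq_integrable_on:
  fixes f :: "real \<Rightarrow> 'a::euclidean_space"
  assumes "f \<in> L2" "0 \<le> a" "b \<le> 1"
  shows "(\<lambda>x. (norm (f x))\<^sup>2) integrable_on {a..b}"
proof -
  have "(\<lambda>x. (norm (f x))\<^sup>2) integrable_on {0..1}"
    using L2_sq_absolutely_integrable[OF assms(1)] absolutely_integrable_on_def by blast
  then show ?thesis by (rule integrable_on_subinterval) (use assms in auto)
qed

lemma L2_norm_power2:
  fixes f :: "real \<Rightarrow> 'a::euclidean_space"
  assumes "f \<in> L2" shows "(L2_norm f)\<^sup>2 = integral {0..1} (\<lambda>x. (norm (f x))\<^sup>2)"
proof -
  have "integral\<^sup>L (lebesgue_on {0..1}) (\<lambda>x. (norm (f x))\<^sup>2) = integral {0..1} (\<lambda>x. (norm (f x))\<^sup>2)"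
    using assms by (intro lebesgue_integral_eq_integral) (auto simp: L2_def)
  moreover have "integral\<^sup>L (lebesgue_on {0..1}) (\<lambda>x. (norm (f x))\<^sup>2) \<ge> 0"
    by (rule integral_nonneg_AE) auto
  ultimately show ?thesis unfolding L2_norm_def by simp
qed

lemma L2_norm_nonneg: "L2_norm f \<ge> 0"
  unfolding L2_norm_def by (intro real_sqrt_ge_zero integral_nonneg_AE) auto

lemma L2_I_bound:
  fixes f :: "real \<Rightarrow> 'a::euclidean_space" and g :: "real \<Rightarrow> 'b::euclidean_space"
  assumes "f \<in> borel_measurable (lebesgue_on {0..1})" "g \<in> L2"
    and "\<And>x. x \<in> {0..1} \<Longrightarrow> norm (f x) \<le> K * norm (g x)"
  shows "f \<in> L2"
proof -
  have "(\<lambda>x. (norm (f x))\<^sup>2) absolutely_integrable_on {0..1}"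
  proof (rule measurable_bounded_by_integrable_imp_absolutely_integrable)
    show "(\<lambda>x. (norm (f x))\<^sup>2) \<in> borel_measurable (lebesgue_on {0..1})"
      using assms(1) by measurable
    show "(\<lambda>x. K\<^sup>2 * (norm (g x))\<^sup>2) integrable_on {0..1}"
      using L2_sq_integrable_on[OF assms(2), of 0 1] integrable_on_mult_right by fastforce
    fix x :: real assume "x \<in> {0..1}"
    then show "norm ((norm (f x))\<^sup>2) \<le> K\<^sup>2 * (norm (g x))\<^sup>2"
      using power_mono[OF assms(3), of x 2] by (simp add: power_mult_distrib)
  qed auto
  then show ?thesis using assms(1) by (simp add: L2_def integrable_lebesgue_on_iff)
qed

lemma L2_add:
  fixes f g :: "real \<Rightarrow> 'a::euclidean_space"
  assumes "f \<in> L2" "g \<in> L2" shows "(\<lambda>x. f x + g x) \<in> L2"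
proof -
  have m: "(\<lambda>x. f x + g x) \<in> borel_measurable (lebesgue_on {0..1})"
    using assms by (intro borel_measurable_add) (auto simp: L2_def)
  have "(\<lambda>x. (norm (f x + g x))\<^sup>2) absolutely_integrable_on {0..1}"
  proof (rule measurable_bounded_by_integrable_imp_absolutely_integrable)
    show "(\<lambda>x. (norm (f x + g x))\<^sup>2) \<in> borel_measurable (lebesgue_on {0..1})"
      using m by measurable
    show "(\<lambda>x. 2 * (norm (f x))\<^sup>2 + 2 * (norm (g x))\<^sup>2) integrable_on {0..1}"
      using L2_sq_integrable_on[OF assms(1), of 0 1] L2_sq_integrable_on[OF assms(2), of 0 1]
      by (intro integrable_add integrable_on_cmult_left) auto
    fix x :: real
    have "(norm (f x + g x))\<^sup>2 \<le> (norm (f x) + norm (g x))\<^sup>2"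
      by (intro power_mono norm_triangle_ineq) auto
    also have "\<dots> \<le> 2 * (norm (f x))\<^sup>2 + 2 * (norm (g x))\<^sup>2"
      using sum_squares_bound[of "norm (f x)" "norm (g x)"] by (simp add: power2_sum)
    finally show "norm ((norm (f x + g x))\<^sup>2) \<le> 2 * (norm (f x))\<^sup>2 + 2 * (norm (g x))\<^sup>2" by simp
  qed auto
  then show ?thesis using m by (simp add: L2_def integrable_lebesgue_on_iff)
qed

lemma L2_bounded_linear:
  fixes f :: "real \<Rightarrow> 'a::euclidean_space" and T :: "'a \<Rightarrow> 'b::euclidean_space"
  assumes "f \<in> L2" "bounded_linear T" shows "(\<lambda>x. T (f x)) \<in> L2"
proof -
  obtain K where K: "\<And>v. norm (T v) \<le> norm v * K"
    using bounded_linear.bounded[OF assms(2)] by blast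
  show ?thesis
  proof (rule L2_I_bound[OF _ assms(1), where K=K])
    have "T \<in> borel_measurable borel"
      using linear_continuous_on[OF assms(2)] by (rule borel_measurable_continuous_onI)
    then show "(\<lambda>x. T (f x)) \<in> borel_measurable (lebesgue_on {0..1})"
      using L2_measurable[OF assms(1)] by measurable
  qed (use K in \<open>auto simp: mult.commute\<close>)
qed

lemma bounded_linear_smult_cvec: "bounded_linear (\<lambda>v::complex^'n. c *s v)"
  by (intro linear_conv_bounded_linear[THEN iffD1] linearI)
     (simp_all add: vec_eq_iff algebra_simps)

lemma L2_smult: "f \<in> L2 \<Longrightarrow> (\<lambda>x. c *s f x) \<in> L2" for f :: "real \<Rightarrow> complex^'n"
  by (rule L2_bounded_linear[OF _ bounded_linear_smult_cvec])

lemma L2_diff: "f \<in> L2 \<Longrightarrow> g \<in> L2 \<Longrightarrow> (\<lambda>x. f x - g x) \<in> L2" for f :: "real \<Rightarrow> 'a::euclidean_space"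
  using L2_add[of f "\<lambda>x. - g x"] L2_bounded_linear[of g "\<lambda>v. - v", OF _ bounded_linear_minus[OF bounded_linear_ident]]
  by simp

lemma L2_const: "(\<lambda>x. c) \<in> L2" for c :: "'a::euclidean_space"
  by (simp add: L2_def integrable_lebesgue_on_iff)

lemma L2_zero: "0 \<in> L2"
  unfolding zero_fun_def by (rule L2_const)

lemma L2_I_bounded:
  fixes f :: "real \<Rightarrow> 'a::euclidean_space"
  assumes "f \<in> borel_measurable (lebesgue_on {0..1})" "\<And>x. x \<in> {0..1} \<Longrightarrow> norm (f x) \<le> K"
  shows "f \<in> L2"
  by (rule L2_I_bound[OF assms(1) L2_const[of "1::real"], where K=K]) (use assms in auto)

lemma continuous_on_imp_L2:
  fixes f :: "real \<Rightarrow> 'a::euclidean_space"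
  assumes "continuous_on {0..1} f" shows "f \<in> L2"
proof -
  have "bounded (f ` {0..1})" using assms compact_continuous_image compact_imp_bounded by blast
  then obtain K where "\<And>x. x \<in> {0..1} \<Longrightarrow> norm (f x) \<le> K" unfolding bounded_iff by blast
  then show ?thesis
    using assms by (intro L2_I_bounded continuous_imp_measurable_on_sets_lebesgue) auto
qed

lemma L2_absolutely_integrable:
  fixes f :: "real \<Rightarrow> 'a::euclidean_space"
  assumes "f \<in> L2" shows "f absolutely_integrable_on {0..1}"
proof (rule measurable_bounded_by_integrable_imp_absolutely_integrable)
  show "(\<lambda>x. 1 + (norm (f x))\<^sup>2) integrable_on {0..1}"
    using L2_sq_integrable_on[OF assms, of 0 1] by (intro integrable_add) auto
  fix x :: real
  have "2 * norm (f x) * 1 \<le> (norm (f x))\<^sup>2 + 1\<^sup>2" by (rule sum_squares_bound)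
  then show "norm (f x) \<le> 1 + (norm (f x))\<^sup>2" using norm_ge_zero[of "f x"] by (simp del: norm_ge_zero)
qed (use L2_measurable[OF assms] in auto)

lemma L2_mult_absolutely_integrable:
  fixes f g :: "real \<Rightarrow> real"
  assumes "f \<in> L2" "g \<in> L2"
  shows "(\<lambda>x. f x * g x) absolutely_integrable_on {0..1}"
proof (rule measurable_bounded_by_integrable_imp_absolutely_integrable)
  show "(\<lambda>x. (norm (f x))\<^sup>2 + (norm (g x))\<^sup>2) integrable_on {0..1}"
    using L2_sq_integrable_on[OF assms(1), of 0 1] L2_sq_integrable_on[OF assms(2), of 0 1] by (intro integrable_add) auto
  show "(\<lambda>x. f x * g x) \<in> borel_measurable (lebesgue_on {0..1})"
    using L2_measurable[OF assms(1)] L2_measurable[OF assms(2)] by measurable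
  fix x :: real
  have "2 * \<bar>f x\<bar> * \<bar>g x\<bar> \<le> \<bar>f x\<bar>\<^sup>2 + \<bar>g x\<bar>\<^sup>2" by (rule sum_squares_bound)
  moreover have "\<bar>f x\<bar> * \<bar>g x\<bar> \<ge> 0" by simp
  ultimately show "norm (f x * g x) \<le> (norm (f x))\<^sup>2 + (norm (g x))\<^sup>2"
    unfolding real_norm_def abs_mult by linarith
qed auto

lemma L2_norm_fun: "f \<in> L2 \<Longrightarrow> (\<lambda>x. norm (f x)) \<in> L2" for f :: "real \<Rightarrow> 'a::euclidean_space"
  by (rule L2_I_bound[of _ f 1]) (auto dest: L2_measurable)

text \<open>Evaluates the quadratic at its minimum t = B / C. Besides Cauchy-Schwarz it yields the
  almost orthogonality of minimizing sequences, with A the excess over the infimum.\<close>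

lemma quadratic_nonneg_discriminant:
  fixes A B C :: real
  assumes "\<And>t. A - 2 * t * B + t\<^sup>2 * C \<ge> 0" "C \<ge> 0"
  shows "B\<^sup>2 \<le> A * C"
proof (cases "C = 0")
  case True
  have "B = 0"
  proof (rule ccontr)
    assume "B \<noteq> 0"
    \<comment> \<open>With C = 0 this choice of t turns the quadratic into -1.\<close>
    then show False using assms(1)[of "(A + 1) / (2 * B)"] True by (simp add: field_simps)
  qed
  then show ?thesis using True by simp
next
  case False
  then have "C > 0" using assms(2) by simp
  then show ?thesis using assms(1)[of "B / C"] by (simp add: field_simps power2_eq_square)
qed

lemma integral_Cauchy_Schwarz:
  fixes f g :: "real \<Rightarrow> real"
  assumes "(\<lambda>x. (f x)\<^sup>2) integrable_on S" "(\<lambda>x. (g x)\<^sup>2) integrable_on S" "(\<lambda>x. f x * g x) integrable_on S"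
  shows "(integral S (\<lambda>x. f x * g x))\<^sup>2 \<le> integral S (\<lambda>x. (f x)\<^sup>2) * integral S (\<lambda>x. (g x)\<^sup>2)"
proof (rule quadratic_nonneg_discriminant)
  fix t :: real
  have eq: "(\<lambda>x. (f x - t * g x)\<^sup>2) = (\<lambda>x. (f x)\<^sup>2 - 2 * t * (f x * g x) + t\<^sup>2 * (g x)\<^sup>2)"
    by (simp add: fun_eq_iff power2_eq_square algebra_simps)
  have hi: "((\<lambda>x. (f x - t * g x)\<^sup>2) has_integral
      integral S (\<lambda>x. (f x)\<^sup>2) - 2 * t * integral S (\<lambda>x. f x * g x) + t\<^sup>2 * integral S (\<lambda>x. (g x)\<^sup>2)) S"
    unfolding eq using assms
    by (intro has_integral_add has_integral_diff has_integral_mult_right integrable_integral)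
  show "0 \<le> integral S (\<lambda>x. (f x)\<^sup>2) - 2 * t * integral S (\<lambda>x. f x * g x) + t\<^sup>2 * integral S (\<lambda>x. (g x)\<^sup>2)"
    by (rule has_integral_nonneg[OF hi]) simp
qed (use assms in \<open>auto intro: integral_nonneg\<close>)


section \<open>Scalar linear equations with square integrable forcing\<close>

lemma L2_mult_continuous:
  fixes f k :: "real \<Rightarrow> complex"
  assumes "k \<in> L2" "continuous_on {0..1} f"
  shows "(\<lambda>x. f x * k x) \<in> L2"
proof -
  have "bounded (f ` {0..1})" using assms compact_continuous_image compact_imp_bounded by blast
  then obtain K where "\<And>x. x \<in> {0..1} \<Longrightarrow> norm (f x) \<le> K" unfolding bounded_iff by blast
  moreover have "f \<in> borel_measurable (lebesgue_on {0..1})"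
    using assms by (intro continuous_imp_measurable_on_sets_lebesgue) auto
  ultimately show ?thesis
    using L2_measurable[OF assms(1)]
    by (intro L2_I_bound[OF _ assms(1), where K=K]) (auto simp: norm_mult intro!: mult_right_mono)
qed

lemma L2_integrable_on:
  fixes f :: "real \<Rightarrow> 'a::euclidean_space"
  assumes "f \<in> L2" "0 \<le> a" "b \<le> 1" shows "f integrable_on {a..b}"
proof -
  have "f integrable_on {0..1}"
    using L2_absolutely_integrable[OF assms(1)] absolutely_integrable_on_def by blast
  then show ?thesis by (rule integrable_on_subinterval) (use assms in auto)
qed

lemma L2_integral_split:
  fixes f :: "real \<Rightarrow> 'a::euclidean_space"
  assumes "f \<in> L2" "0 \<le> s" "s \<le> t" "t \<le> 1"
  shows "integral {0..t} f = integral {0..s} f + integral {s..t} f"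
  using assms L2_integrable_on[OF assms(1), of 0 t]
  by (metis Henstock_Kurzweil_Integration.integral_combine order_refl)

lemma L2_continuous_on_integral:
  fixes f :: "real \<Rightarrow> 'a::euclidean_space"
  assumes "f \<in> L2" shows "continuous_on {0..1} (\<lambda>x. integral {0..x} f)"
  by (rule indefinite_integral_continuous_1) (use L2_integrable_on[OF assms, of 0 1] in auto)

lemma exp_has_vector_derivative:
  "((\<lambda>y::real. exp (\<beta> * of_real y :: complex)) has_vector_derivative \<beta> * exp (\<beta> * of_real y)) (at y within S)"
proof -
  have "((\<lambda>z. exp (\<beta> * z)) has_field_derivative \<beta> * exp (\<beta> * of_real y)) (at (of_real y))"
    by (auto intro!: derivative_eq_intros)
  then show ?thesis by (rule has_vector_derivative_real_field)
qed

lemma integral_product_rule_exp: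
  fixes k :: "real \<Rightarrow> complex"
  assumes k: "k \<in> L2" and x: "x \<in> {0..1}"
  shows "((\<lambda>y. exp (\<beta> * of_real y) * integral {0..y} k - integral {0..y} (\<lambda>t. exp (\<beta> * of_real t) * k t))
    has_vector_derivative \<beta> * exp (\<beta> * of_real x) * integral {0..x} k) (at x within {0..1})"
proof -
  define E where "E = (\<lambda>y::real. exp (\<beta> * of_real y))"
  define \<kappa> where "\<kappa> = (\<lambda>y. integral {0..y} (\<lambda>t. norm (k t)))"
  have dE: "(E has_vector_derivative \<beta> * E y) (at y within S)" for y S
    unfolding E_def by (rule exp_has_vector_derivative)
  have cE: "continuous_on S E" for S
    using dE by (meson continuous_on_vector_derivative)
  have kE: "(\<lambda>t. E t * k t) \<in> L2" by (rule L2_mult_continuous[OF k cE])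
  have nk: "(\<lambda>t. norm (k t)) \<in> L2" by (rule L2_norm_fun[OF k])
  \<comment> \<open>A Lipschitz constant for the exponential on [0,1], from its derivative on the
    unit disc. The summand 1 added below keeps it positive even for \<beta> = 0, since it is divided
    by later.\<close>
  obtain L where L: "L > 0" "\<And>s t. s \<in> {0..1} \<Longrightarrow> t \<in> {0..1} \<Longrightarrow> norm (E s - E t) \<le> L * \<bar>s - t\<bar>"
  proof -
    have "norm (exp (\<beta> * of_real s) - exp (\<beta> * of_real t)) \<le> (norm \<beta> * exp (norm \<beta>)) * norm (of_real s - of_real t :: complex)"
      if "s \<in> {0..1}" "t \<in> {0..1}" for s t
    proof (rule field_differentiable_bound[of "cball 0 1" "\<lambda>z. exp (\<beta> * z)" "\<lambda>z. \<beta> * exp (\<beta> * z)"])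
      fix z :: complex assume "z \<in> cball 0 1"
      then have "norm (\<beta> * z) \<le> norm \<beta>" by (simp add: norm_mult mult_left_le)
      then have "norm (exp (\<beta> * z)) \<le> exp (norm \<beta>)" by (meson exp_le_cancel_iff norm_exp order_trans)
      then show "norm (\<beta> * exp (\<beta> * z)) \<le> norm \<beta> * exp (norm \<beta>)" by (simp add: norm_mult mult_left_mono)
    qed (use that in \<open>auto intro!: derivative_eq_intros simp: norm_of_real\<close>)
    then have "norm (E s - E t) \<le> (norm \<beta> * exp (norm \<beta>) + 1) * \<bar>s - t\<bar>" if "s \<in> {0..1}" "t \<in> {0..1}" for s t
      using that unfolding E_def by (fastforce simp: norm_of_real distrib_right simp flip: of_real_diff)
    moreover have "norm \<beta> * exp (norm \<beta>) + 1 > 0" by (simp add: add_nonneg_pos)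
    ultimately show ?thesis using that by auto
  qed
  have est: "norm (integral {s..t} (\<lambda>r. (E c - E r) * k r)) \<le> L * (t - s) * (\<kappa> t - \<kappa> s)"
    if "0 \<le> s" "s \<le> t" "t \<le> 1" "c \<in> {s..t}" for s t c
  proof -
    have "norm (integral {s..t} (\<lambda>r. (E c - E r) * k r)) \<le> integral {s..t} (\<lambda>r. L * (t - s) * norm (k r))"
    proof (rule integral_norm_bound_integral)
      show "(\<lambda>r. (E c - E r) * k r) integrable_on {s..t}"
        using that by (intro L2_integrable_on L2_mult_continuous[OF k] continuous_intros cE) auto
      show "(\<lambda>r. L * (t - s) * norm (k r)) integrable_on {s..t}"
        by (rule integrable_on_mult_right, rule L2_integrable_on[OF nk]) (use that in auto)
      fix r assume r: "r \<in> {s..t}"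
      have "norm (E c - E r) \<le> L * \<bar>c - r\<bar>" by (rule L(2)) (use r that in auto)
      also have "\<dots> \<le> L * (t - s)" using r that L(1) by (intro mult_left_mono) auto
      finally show "norm ((E c - E r) * k r) \<le> L * (t - s) * norm (k r)"
        unfolding norm_mult by (rule mult_right_mono) simp
    qed
    also have "\<dots> = L * (t - s) * integral {s..t} (\<lambda>r. norm (k r))" by simp
    also have "integral {s..t} (\<lambda>r. norm (k r)) = \<kappa> t - \<kappa> s"
      unfolding \<kappa>_def using L2_integral_split[OF nk, of s t] that by simp
    finally show ?thesis .
  qed
  define B where "B = (\<lambda>y. E y * integral {0..y} k - integral {0..y} (\<lambda>t. E t * k t) - E y * integral {0..x} k)"
  have Bdiff: "norm (B y - B x) \<le> L * \<bar>y - x\<bar> * \<bar>\<kappa> y - \<kappa> x\<bar>" if y: "y \<in> {0..1}" for y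
  proof (cases "x \<le> y")
    case True
    have "B y - B x = E y * integral {x..y} k - integral {x..y} (\<lambda>t. E t * k t)"
      unfolding B_def using L2_integral_split[OF k, of x y] L2_integral_split[OF kE, of x y] True x y
      by (simp add: algebra_simps)
    also have "\<dots> = integral {x..y} (\<lambda>r. E y * k r - E r * k r)"
      using L2_integrable_on[OF k, of x y] L2_integrable_on[OF kE, of x y] x y
      by (subst Henstock_Kurzweil_Integration.integral_diff) (auto intro: integrable_on_mult_right)
    also have "\<dots> = integral {x..y} (\<lambda>r. (E y - E r) * k r)" by (simp add: algebra_simps)
    finally have "norm (B y - B x) \<le> L * (y - x) * (\<kappa> y - \<kappa> x)" using est[of x y y] True x y by simp
    also have "\<dots> \<le> L * \<bar>y - x\<bar> * \<bar>\<kappa> y - \<kappa> x\<bar>" using True L(1)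
      by (simp add: mult_left_mono)
    finally show ?thesis .
  next
    case False
    have "B y - B x = - (E y * integral {y..x} k - integral {y..x} (\<lambda>t. E t * k t))"
      unfolding B_def using L2_integral_split[OF k, of y x] L2_integral_split[OF kE, of y x] False x y
      by (simp add: algebra_simps)
    also have "E y * integral {y..x} k - integral {y..x} (\<lambda>t. E t * k t) = integral {y..x} (\<lambda>r. E y * k r - E r * k r)"
      using L2_integrable_on[OF k, of y x] L2_integrable_on[OF kE, of y x] x y
      by (subst Henstock_Kurzweil_Integration.integral_diff) (auto intro: integrable_on_mult_right)
    also have "\<dots> = integral {y..x} (\<lambda>r. (E y - E r) * k r)" by (simp add: algebra_simps)
    finally have "norm (B y - B x) \<le> L * (x - y) * (\<kappa> x - \<kappa> y)" using est[of y x y] False x y by simp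
    also have "\<dots> \<le> L * \<bar>y - x\<bar> * \<bar>\<kappa> y - \<kappa> x\<bar>" using False L(1)
      by (simp add: abs_of_neg mult_left_mono)
    finally show ?thesis .
  qed
  have c\<kappa>: "continuous_on {0..1} \<kappa>" unfolding \<kappa>_def by (rule L2_continuous_on_integral[OF nk])
  have "(B has_vector_derivative 0) (at x within {0..1})"
    unfolding has_vector_derivative_def has_derivative_within_alt
  proof (intro conjI allI impI)
    fix e :: real assume "e > 0"
    then have "e / L > 0" using L by simp
    then obtain d where d: "d > 0" "\<And>y. y \<in> {0..1} \<Longrightarrow> dist y x < d \<Longrightarrow> dist (\<kappa> y) (\<kappa> x) < e / L"
      using c\<kappa> x unfolding continuous_on_iff by metis
    have "norm (B y - B x - (y - x) *\<^sub>R 0) \<le> e * norm (y - x)" if "y \<in> {0..1}" "norm (y - x) < d" for y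
    proof -
      have "\<bar>\<kappa> y - \<kappa> x\<bar> \<le> e / L" using d(2)[of y] that by (simp add: dist_norm)
      then have "L * \<bar>y - x\<bar> * \<bar>\<kappa> y - \<kappa> x\<bar> \<le> L * \<bar>y - x\<bar> * (e / L)" using L by (intro mult_left_mono) auto
      also have "\<dots> = e * norm (y - x)" using L by simp
      finally show ?thesis using Bdiff[OF that(1)] by simp
    qed
    then show "\<exists>d>0. \<forall>y\<in>{0..1}. norm (y - x) < d \<longrightarrow> norm (B y - B x - (y - x) *\<^sub>R 0) \<le> e * norm (y - x)"
      using d(1) by blast
  qed auto
  then have "((\<lambda>y. B y + E y * integral {0..x} k) has_vector_derivative 0 + \<beta> * E x * integral {0..x} k) (at x within {0..1})"
    by (intro has_vector_derivative_add has_vector_derivative_mult_left dE)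
  then show ?thesis unfolding B_def E_def by simp
qed

text \<open>Integrating factor for a solution that is only absolutely continuous. The integral
  equation writes \<open>u\<close> as a differentiable part plus the integral of \<open>k\<close>,
  so by the preceding product rule \<open>H\<close> is differentiable at every point, with
  derivative zero.\<close>

lemma variation_of_constants:
  fixes u k :: "real \<Rightarrow> complex"
  assumes k: "k \<in> L2" and u: "continuous_on {0..1} u"
    and eq: "\<And>x. x \<in> {0..1} \<Longrightarrow> u x = u 0 + integral {0..x} (\<lambda>t. \<alpha> * u t + k t)"
    and x: "x \<in> {0..1}"
  shows "exp (- \<alpha> * of_real x) * u x = u 0 + integral {0..x} (\<lambda>t. exp (- \<alpha> * of_real t) * k t)"
proof -
  define E where "E = (\<lambda>y::real. exp (- \<alpha> * of_real y))"
  define H where "H = (\<lambda>y. E y * u y - integral {0..y} (\<lambda>t. E t * k t))"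
  have uL: "u \<in> L2" by (rule continuous_on_imp_L2[OF u])
  have dE: "(E has_vector_derivative - \<alpha> * E y) (at y within S)" for y S
    unfolding E_def by (rule exp_has_vector_derivative)
  have ueq: "u y = u 0 + \<alpha> * integral {0..y} u + integral {0..y} k" if "y \<in> {0..1}" for y
  proof -
    have "u y = u 0 + integral {0..y} (\<lambda>t. \<alpha> * u t + k t)" by (rule eq[OF that])
    also have "integral {0..y} (\<lambda>t. \<alpha> * u t + k t) = integral {0..y} (\<lambda>t. \<alpha> * u t) + integral {0..y} k"
      using that L2_integrable_on[OF uL, of 0 y] L2_integrable_on[OF k, of 0 y]
      by (intro Henstock_Kurzweil_Integration.integral_add integrable_on_mult_right) auto
    finally show ?thesis by simp
  qed
  have "(H has_vector_derivative 0) (at y within {0..1})" if y: "y \<in> {0..1}" for y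
  proof -
    have dU: "((\<lambda>y. integral {0..y} u) has_vector_derivative u y) (at y within {0..1})"
      by (rule integral_has_vector_derivative[OF u y])
    have dZ: "((\<lambda>y. E y * integral {0..y} k - integral {0..y} (\<lambda>t. E t * k t))
        has_vector_derivative - \<alpha> * E y * integral {0..y} k) (at y within {0..1})"
      using integral_product_rule_exp[OF k y, of "- \<alpha>"] unfolding E_def by simp
    have "((\<lambda>y. E y * (u 0 + \<alpha> * integral {0..y} u) + (E y * integral {0..y} k - integral {0..y} (\<lambda>t. E t * k t)))
       has_vector_derivative (E y * (0 + \<alpha> * u y) + - \<alpha> * E y * (u 0 + \<alpha> * integral {0..y} u)) + - \<alpha> * E y * integral {0..y} k) (at y within {0..1})"
      by (intro has_vector_derivative_add has_vector_derivative_mult has_vector_derivative_const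
          has_vector_derivative_mult_right dE dU dZ)
    moreover have "(E y * (0 + \<alpha> * u y) + - \<alpha> * E y * (u 0 + \<alpha> * integral {0..y} u)) + - \<alpha> * E y * integral {0..y} k = 0"
    proof -
      have alg: "(e * (0 + \<alpha> * v) + - \<alpha> * e * w) + - \<alpha> * e * c = \<alpha> * e * (v - (w + c))" for e v w c :: complex
        by (simp add: algebra_simps)
      show ?thesis unfolding alg using ueq[OF y] by simp
    qed
    ultimately have "((\<lambda>y. E y * (u 0 + \<alpha> * integral {0..y} u) + (E y * integral {0..y} k - integral {0..y} (\<lambda>t. E t * k t)))
       has_vector_derivative 0) (at y within {0..1})" by simp
    then show ?thesis
    proof (rule has_vector_derivative_transform[OF y, rotated])
      fix z :: real assume "z \<in> {0..1}"
      then have "E z * u z = E z * (u 0 + \<alpha> * integral {0..z} u + integral {0..z} k)"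
        by (rule arg_cong[OF ueq])
      then show "H z = E z * (u 0 + \<alpha> * integral {0..z} u) + (E z * integral {0..z} k - integral {0..z} (\<lambda>t. E t * k t))"
        unfolding H_def by (simp add: distrib_left)
    qed
  qed
  then have "H x = H 0"
    using has_vector_derivative_zero_constant[of "{0..1}" H] x by (metis atLeastAtMost_iff convex_real_interval(5) order_refl zero_le_one)
  then show ?thesis unfolding H_def E_def by (simp add: algebra_simps)
qed

text \<open>Multiplying the right-hand side of the hypothesis by exp (- b y) gives a nonincreasing
  function, because the hypothesis itself makes the derivative nonpositive.\<close>

lemma Gronwall:
  fixes \<phi> :: "real \<Rightarrow> real"
  assumes \<phi>: "continuous_on {0..x} \<phi>" and "b \<ge> 0" and x: "0 \<le> x"
    and le: "\<And>y. y \<in> {0..x} \<Longrightarrow> \<phi> y \<le> a + b * integral {0..y} \<phi>"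
  shows "\<phi> x \<le> a * exp (b * x)"
proof -
  define h where "h = (\<lambda>y. exp (- b * y) * (a + b * integral {0..y} \<phi>))"
  have "h x \<le> h 0"
  proof (rule DERIV_nonpos_imp_decreasing_open[of 0 x h])
    show "0 \<le> x" using x by simp
    have "continuous_on {0..x} (\<lambda>y. integral {0..y} \<phi>)"
      by (rule continuous_on_subset[OF indefinite_integral_continuous_1[OF integrable_continuous_interval[OF \<phi>]]])
        (use x in auto)
    then show "continuous_on {0..x} h"
      unfolding h_def by (intro continuous_intros)
    fix y assume y: "0 < y" "y < x"
    have "((\<lambda>y. integral {0..y} \<phi>) has_real_derivative \<phi> y) (at y within {0..x})"
      using integral_has_real_derivative[OF \<phi>, of y] y x by auto
    then have "((\<lambda>y. integral {0..y} \<phi>) has_real_derivative \<phi> y) (at y)"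
      using y x by (simp add: at_within_Icc_at)
    note dI = this
    have "((\<lambda>y. exp (- b * y)) has_real_derivative exp (- b * y) * (- b)) (at y)"
      by (auto intro!: derivative_eq_intros)
    from DERIV_mult[OF this DERIV_add[OF DERIV_const[of a] DERIV_cmult[OF dI, of b]]]
    have "(h has_real_derivative exp (- b * y) * (b * \<phi> y) + exp (- b * y) * (- b) * (a + b * integral {0..y} \<phi>)) (at y)"
      unfolding h_def by (simp add: algebra_simps)
    moreover have "exp (- b * y) * (b * \<phi> y) + exp (- b * y) * (- b) * (a + b * integral {0..y} \<phi>) = exp (- b * y) * b * (\<phi> y - (a + b * integral {0..y} \<phi>))"
      by (simp add: algebra_simps)
    moreover have "\<dots> \<le> 0" using le[of y] y x \<open>b \<ge> 0\<close> by (intro mult_nonneg_nonpos) auto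
    ultimately show "\<exists>l. (h has_real_derivative l) (at y) \<and> l \<le> 0" by (intro exI conjI) auto
  qed
  then have "exp (- b * x) * (a + b * integral {0..x} \<phi>) \<le> a" by (simp add: h_def)
  then have "a + b * integral {0..x} \<phi> \<le> exp (b * x) * a" by (simp add: exp_minus field_simps)
  then show ?thesis using le[of x] x by (simp add: mult.commute)
qed

lemma exp_convolution_bound:
  fixes k :: "real \<Rightarrow> complex"
  assumes k: "k \<in> L2" and r: "Re \<alpha> = r" "r \<noteq> 0" and cd: "0 \<le> c" "c \<le> d" "d \<le> 1"
  shows "norm (integral {c..d} (\<lambda>t. exp (\<alpha> * of_real (x - t)) * k t))
    \<le> sqrt ((exp (2 * r * (x - c)) - exp (2 * r * (x - d))) / (2 * r)) * L2_norm k"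
proof -
  have nk: "(\<lambda>t. norm (k t)) \<in> L2" by (rule L2_norm_fun[OF k])
  let ?e = "\<lambda>t. exp (r * (x - t))"
  have ek: "(\<lambda>t. exp (\<alpha> * of_real (x - t)) * k t) \<in> L2"
    by (rule L2_mult_continuous[OF k]) (intro continuous_intros)
  have e2: "((\<lambda>t. (?e t)\<^sup>2) has_integral (exp (2 * r * (x - c)) - exp (2 * r * (x - d))) / (2 * r)) {c..d}"
  proof -
    have "((\<lambda>t. (?e t)\<^sup>2) has_integral - exp (2 * r * (x - d)) / (2 * r) - - exp (2 * r * (x - c)) / (2 * r)) {c..d}"
      using r cd by (intro fundamental_theorem_of_calculus)
        (auto intro!: derivative_eq_intros simp: power2_eq_square simp flip: exp_add has_real_derivative_iff_has_vector_derivative)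
    then show ?thesis by (simp add: diff_divide_distrib)
  qed
  have ep: "(\<lambda>t. ?e t * norm (k t)) integrable_on {c..d}"
    by (rule integrable_on_subinterval[of _ "{0..1}"], rule set_lebesgue_integral_eq_integral(1),
        rule L2_mult_absolutely_integrable[OF continuous_on_imp_L2 nk]) (use cd in \<open>auto intro!: continuous_intros\<close>)
  have "norm (integral {c..d} (\<lambda>t. exp (\<alpha> * of_real (x - t)) * k t)) \<le> integral {c..d} (\<lambda>t. ?e t * norm (k t))"
    using r cd ep by (intro integral_norm_bound_integral L2_integrable_on[OF ek]) (auto simp: norm_mult)
  also have "\<dots> \<le> sqrt (integral {c..d} (\<lambda>t. (?e t)\<^sup>2) * integral {c..d} (\<lambda>t. (norm (k t))\<^sup>2))"
    by (intro real_le_rsqrt integral_Cauchy_Schwarz) (use e2 ep L2_sq_integrable_on[OF k] cd in auto)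
  also have "\<dots> = sqrt ((exp (2 * r * (x - c)) - exp (2 * r * (x - d))) / (2 * r)) * sqrt (integral {c..d} (\<lambda>t. (norm (k t))\<^sup>2))"
    by (simp only: integral_unique[OF e2] real_sqrt_mult)
  also have "\<dots> \<le> sqrt ((exp (2 * r * (x - c)) - exp (2 * r * (x - d))) / (2 * r)) * L2_norm k"
  proof (rule mult_left_mono)
    have "integral {c..d} (\<lambda>t. (norm (k t))\<^sup>2) \<le> integral {0..1} (\<lambda>t. (norm (k t))\<^sup>2)"
      using cd L2_sq_integrable_on[OF k] by (intro integral_subset_le) auto
    then show "sqrt (integral {c..d} (\<lambda>t. (norm (k t))\<^sup>2)) \<le> L2_norm k"
      using L2_norm_power2[OF k] L2_norm_nonneg[of k] by (simp add: real_le_lsqrt)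
    show "0 \<le> sqrt ((exp (2 * r * (x - c)) - exp (2 * r * (x - d))) / (2 * r))"
      using has_integral_nonneg[OF e2] by simp
  qed
  finally show ?thesis .
qed

text \<open>Solved forward from 0, so that the exponential kernel has nonpositive exponent
  throughout.\<close>

lemma decaying_solution_bound:
  fixes u k :: "real \<Rightarrow> complex"
  assumes k: "k \<in> L2" and u: "continuous_on {0..1} u"
    and eq: "\<And>x. x \<in> {0..1} \<Longrightarrow> u x = u 0 + integral {0..x} (\<lambda>t. \<alpha> * u t + k t)"
    and x: "x \<in> {0..1}" and r: "Re \<alpha> = - \<sigma>" "\<sigma> > 0"
  shows "norm (u x) \<le> exp (- \<sigma> * x) * norm (u 0) + L2_norm k / sqrt (2 * \<sigma>)"
proof -
  have ee: "exp (\<alpha> * of_real x) * exp (- \<alpha> * of_real t) = exp (\<alpha> * of_real (x - t))" for t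
    by (simp add: algebra_simps flip: exp_add)
  have "exp (\<alpha> * of_real x) * (exp (- \<alpha> * of_real x) * u x) = exp (\<alpha> * of_real x) * (u 0 + integral {0..x} (\<lambda>t. exp (- \<alpha> * of_real t) * k t))"
    using variation_of_constants[OF k u eq x] by simp
  then have "u x = exp (\<alpha> * of_real x) * u 0 + exp (\<alpha> * of_real x) * integral {0..x} (\<lambda>t. exp (- \<alpha> * of_real t) * k t)"
    unfolding mult.assoc[symmetric] ee by (simp add: algebra_simps)
  also have "exp (\<alpha> * of_real x) * integral {0..x} (\<lambda>t. exp (- \<alpha> * of_real t) * k t) = integral {0..x} (\<lambda>t. exp (\<alpha> * of_real (x - t)) * k t)"
    by (simp only: integral_mult_right[symmetric] mult.assoc[symmetric] ee)
  finally have "norm (u x) \<le> norm (exp (\<alpha> * of_real x) * u 0) + norm (integral {0..x} (\<lambda>t. exp (\<alpha> * of_real (x - t)) * k t))"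
    by (metis norm_triangle_ineq)
  also have "\<dots> \<le> exp (- \<sigma> * x) * norm (u 0) + sqrt ((exp (2 * (- \<sigma>) * (x - 0)) - exp (2 * (- \<sigma>) * (x - x))) / (2 * (- \<sigma>))) * L2_norm k"
    using r x by (intro add_mono exp_convolution_bound k) (auto simp: norm_mult)
  also have "\<dots> \<le> exp (- \<sigma> * x) * norm (u 0) + sqrt (1 / (2 * \<sigma>)) * L2_norm k"
    using r L2_norm_nonneg[of k] by (intro add_mono mult_right_mono real_sqrt_le_mono) (auto simp: field_simps)
  finally show ?thesis by (simp add: real_sqrt_divide)
qed

text \<open>Mirror image of the decaying case: solved backward from 1, which again makes the
  exponent nonpositive.\<close>

lemma growing_solution_bound:
  fixes u k :: "real \<Rightarrow> complex"
  assumes k: "k \<in> L2" and u: "continuous_on {0..1} u"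
    and eq: "\<And>x. x \<in> {0..1} \<Longrightarrow> u x = u 0 + integral {0..x} (\<lambda>t. \<alpha> * u t + k t)"
    and x: "x \<in> {0..1}" and r: "Re \<alpha> = \<sigma>" "\<sigma> > 0"
  shows "norm (u x) \<le> exp (- \<sigma> * (1 - x)) * norm (u 1) + L2_norm k / sqrt (2 * \<sigma>)"
proof -
  have ee: "exp (\<alpha> * of_real x) * exp (- \<alpha> * of_real t) = exp (\<alpha> * of_real (x - t))" for t
    by (simp add: algebra_simps flip: exp_add)
  have ek: "(\<lambda>t. exp (- \<alpha> * of_real t) * k t) \<in> L2"
    by (rule L2_mult_continuous[OF k]) (intro continuous_intros)
  have "exp (- \<alpha> * of_real x) * u x = exp (- \<alpha> * of_real 1) * u 1 - integral {x..1} (\<lambda>t. exp (- \<alpha> * of_real t) * k t)"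
    using variation_of_constants[OF k u eq x] variation_of_constants[OF k u eq, of 1] L2_integral_split[OF ek, of x 1] x by simp
  then have "exp (\<alpha> * of_real x) * (exp (- \<alpha> * of_real x) * u x) = exp (\<alpha> * of_real x) * (exp (- \<alpha> * of_real 1) * u 1 - integral {x..1} (\<lambda>t. exp (- \<alpha> * of_real t) * k t))"
    by simp
  then have "u x = exp (\<alpha> * of_real (x - 1)) * u 1 - exp (\<alpha> * of_real x) * integral {x..1} (\<lambda>t. exp (- \<alpha> * of_real t) * k t)"
    unfolding right_diff_distrib mult.assoc[symmetric] ee by simp
  also have "exp (\<alpha> * of_real x) * integral {x..1} (\<lambda>t. exp (- \<alpha> * of_real t) * k t) = integral {x..1} (\<lambda>t. exp (\<alpha> * of_real (x - t)) * k t)"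
    by (simp only: integral_mult_right[symmetric] mult.assoc[symmetric] ee)
  finally have "norm (u x) \<le> norm (exp (\<alpha> * of_real (x - 1)) * u 1) + norm (integral {x..1} (\<lambda>t. exp (\<alpha> * of_real (x - t)) * k t))"
    by (metis norm_triangle_ineq4)
  also have "\<dots> \<le> exp (- \<sigma> * (1 - x)) * norm (u 1) + sqrt ((exp (2 * \<sigma> * (x - x)) - exp (2 * \<sigma> * (x - 1))) / (2 * \<sigma>)) * L2_norm k"
    using r x by (intro add_mono exp_convolution_bound k) (auto simp: norm_mult algebra_simps)
  also have "\<dots> \<le> exp (- \<sigma> * (1 - x)) * norm (u 1) + sqrt (1 / (2 * \<sigma>)) * L2_norm k"
    using r L2_norm_nonneg[of k] by (intro add_mono mult_right_mono real_sqrt_le_mono) (auto simp: field_simps)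
  finally show ?thesis by (simp add: real_sqrt_divide)
qed


section \<open>Norm estimates in L2 and for matrices\<close>

lemma L2_norm_mono:
  fixes f :: "real \<Rightarrow> 'a::euclidean_space" and g :: "real \<Rightarrow> 'b::euclidean_space"
  assumes "f \<in> L2" "g \<in> L2" "\<And>x. x \<in> {0..1} \<Longrightarrow> norm (f x) \<le> norm (g x)"
  shows "L2_norm f \<le> L2_norm g"
proof (rule power2_le_imp_le)
  show "(L2_norm f)\<^sup>2 \<le> (L2_norm g)\<^sup>2"
    unfolding L2_norm_power2[OF assms(1)] L2_norm_power2[OF assms(2)]
    by (intro integral_le L2_sq_integrable_on assms) (auto intro!: power_mono assms(3))
qed (rule L2_norm_nonneg)

lemma L2_norm_cmult:
  fixes f :: "real \<Rightarrow> real"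
  assumes "f \<in> L2" shows "L2_norm (\<lambda>x. c * f x) = \<bar>c\<bar> * L2_norm f"
proof (rule power2_eq_imp_eq)
  have "(\<lambda>x. c * f x) \<in> L2" using L2_bounded_linear[OF assms bounded_linear_mult_right] .
  then show "(L2_norm (\<lambda>x. c * f x))\<^sup>2 = (\<bar>c\<bar> * L2_norm f)\<^sup>2"
    using assms by (simp add: L2_norm_power2 power_mult_distrib)
qed (simp_all add: L2_norm_nonneg)

lemma L2_norm_norm: "L2_norm (\<lambda>x. norm (f x)) = L2_norm f"
  by (simp add: L2_norm_def)

lemma L2_norm_triangle:
  fixes f g :: "real \<Rightarrow> 'a::euclidean_space"
  assumes "f \<in> L2" "g \<in> L2"
  shows "L2_norm (\<lambda>x. f x + g x) \<le> L2_norm f + L2_norm g"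
proof (rule power2_le_imp_le)
  have nf: "(\<lambda>x. norm (f x)) \<in> L2" and ng: "(\<lambda>x. norm (g x)) \<in> L2"
    using assms by (auto intro: L2_norm_fun)
  have fg: "(\<lambda>x. norm (f x) * norm (g x)) integrable_on {0..1}"
    using L2_mult_absolutely_integrable[OF nf ng] absolutely_integrable_on_def by blast
  have i2: "(\<lambda>x. (norm (f x))\<^sup>2) integrable_on {0..1}" "(\<lambda>x. (norm (g x))\<^sup>2) integrable_on {0..1}"
    using assms by (auto intro: L2_sq_integrable_on)
  have "integral {0..1} (\<lambda>x. norm (f x) * norm (g x)) \<le> L2_norm f * L2_norm g"
  proof (rule power2_le_imp_le)
    show "(integral {0..1} (\<lambda>x. norm (f x) * norm (g x)))\<^sup>2 \<le> (L2_norm f * L2_norm g)\<^sup>2"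
      unfolding power_mult_distrib L2_norm_power2[OF assms(1)] L2_norm_power2[OF assms(2)]
      by (rule integral_Cauchy_Schwarz[OF i2 fg])
  qed (simp add: L2_norm_nonneg)
  note CS = this
  have hi: "((\<lambda>x. (norm (f x))\<^sup>2 + 2 * (norm (f x) * norm (g x)) + (norm (g x))\<^sup>2) has_integral
      (L2_norm f)\<^sup>2 + 2 * integral {0..1} (\<lambda>x. norm (f x) * norm (g x)) + (L2_norm g)\<^sup>2) {0..1}"
    unfolding L2_norm_power2[OF assms(1)] L2_norm_power2[OF assms(2)]
    by (intro has_integral_add has_integral_mult_right integrable_integral i2 fg)
  have "(L2_norm (\<lambda>x. f x + g x))\<^sup>2 \<le> (L2_norm f)\<^sup>2 + 2 * integral {0..1} (\<lambda>x. norm (f x) * norm (g x)) + (L2_norm g)\<^sup>2"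
    unfolding L2_norm_power2[OF L2_add[OF assms]]
  proof (rule has_integral_le[OF integrable_integral hi])
    show "(\<lambda>x. (norm (f x + g x))\<^sup>2) integrable_on {0..1}" by (intro L2_sq_integrable_on L2_add assms) auto
    fix x :: real
    have "(norm (f x + g x))\<^sup>2 \<le> (norm (f x) + norm (g x))\<^sup>2"
      by (intro power_mono norm_triangle_ineq) auto
    then show "(norm (f x + g x))\<^sup>2 \<le> (norm (f x))\<^sup>2 + 2 * (norm (f x) * norm (g x)) + (norm (g x))\<^sup>2"
      by (simp add: power2_sum algebra_simps)
  qed
  also have "\<dots> \<le> (L2_norm f + L2_norm g)\<^sup>2"
    using CS by (simp add: power2_sum)
  finally show "(L2_norm (\<lambda>x. f x + g x))\<^sup>2 \<le> (L2_norm f + L2_norm g)\<^sup>2" .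
qed (simp add: L2_norm_nonneg)

lemma norm_matrix_vector_mult_component:
  fixes A :: "complex^'n^'m"
  shows "norm ((A *v v) $ i) \<le> norm A * norm v"
proof -
  have "norm ((A *v v) $ i) \<le> (\<Sum>j\<in>UNIV. \<bar>norm (A $ i $ j)\<bar> * \<bar>norm (v $ j)\<bar>)"
    unfolding matrix_vector_mult_def by (simp add: order_trans[OF norm_sum] norm_mult)
  also have "\<dots> \<le> L2_set (\<lambda>j. norm (A $ i $ j)) UNIV * L2_set (\<lambda>j. norm (v $ j)) UNIV"
    by (rule L2_set_mult_ineq)
  also have "\<dots> = norm (A $ i) * norm v" by (simp add: norm_vec_def)
  also have "\<dots> \<le> norm A * norm v" by (intro mult_right_mono Finite_Cartesian_Product.norm_nth_le) auto
  finally show ?thesis .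
qed

lemma norm_vec_le_sum: "norm (v :: complex^'n) \<le> (\<Sum>i\<in>UNIV. norm (v $ i))"
  unfolding norm_vec_def by (rule L2_set_le_sum) simp

lemma norm_matrix_vector_mult_le:
  fixes A :: "complex^'n^'m"
  shows "norm (A *v v) \<le> real CARD('m) * (norm A * norm v)"
proof -
  have "norm (A *v v) \<le> (\<Sum>i\<in>UNIV. norm ((A *v v) $ i))" by (rule norm_vec_le_sum)
  also have "\<dots> \<le> (\<Sum>i\<in>(UNIV::'m set). norm A * norm v)"
    by (intro sum_mono norm_matrix_vector_mult_component)
  finally show ?thesis by simp
qed

section \<open>Volterra operators\<close>

text \<open>Vanishing off the unit interval makes equality of functions coincide with equality on
  [0,1], in agreement with the normalized representatives in \<open>W12_deriv\<close>.\<close>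

definition C01 :: "(real \<Rightarrow> complex^'n) set" where
  "C01 = {u. continuous_on {0..1} u \<and> (\<forall>x. x \<notin> {0..1} \<longrightarrow> u x = 0)}"

lemma C01_zero: "(\<lambda>x. 0) \<in> C01" by (simp add: C01_def)
lemma C01_add: "u \<in> C01 \<Longrightarrow> v \<in> C01 \<Longrightarrow> (\<lambda>x. u x + v x) \<in> C01"
  by (auto simp: C01_def intro!: continuous_intros)
lemma continuous_on_smult_cvec: "continuous_on S u \<Longrightarrow> continuous_on S (\<lambda>x. c *s u x)" for u :: "real \<Rightarrow> complex^'n"
  by (rule bounded_linear.continuous_on[OF bounded_linear_smult_cvec])
lemma C01_smult: "u \<in> C01 \<Longrightarrow> (\<lambda>x. c *s u x) \<in> C01"
  by (auto simp: C01_def intro!: continuous_on_smult_cvec)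
lemma C01_diff: "u \<in> C01 \<Longrightarrow> v \<in> C01 \<Longrightarrow> (\<lambda>x. u x - v x) \<in> C01"
  by (auto simp: C01_def intro!: continuous_intros)
lemma C01_sum: "finite A \<Longrightarrow> (\<And>i. i \<in> A \<Longrightarrow> u i \<in> C01) \<Longrightarrow> (\<lambda>x. \<Sum>i\<in>A. u i x) \<in> C01"
  by (induction A rule: finite_induct) (auto intro: C01_add C01_zero)
lemma C01_continuous: "u \<in> C01 \<Longrightarrow> continuous_on {0..1} u" by (simp add: C01_def)
lemma C01_L2: "u \<in> C01 \<Longrightarrow> u \<in> L2" by (intro continuous_on_imp_L2 C01_continuous)
lemma C01_bounded:
  assumes "u \<in> C01" obtains m where "m \<ge> 0" "\<And>x. x \<in> {0..1} \<Longrightarrow> norm (u x) \<le> m"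
proof -
  have "bounded (u ` {0..1})" using C01_continuous[OF assms] compact_continuous_image compact_imp_bounded by blast
  then obtain m where "m > 0" "\<forall>x\<in>{0..1}. norm (u x) \<le> m" unfolding bounded_pos by auto
  then show ?thesis using that[of m] by auto
qed

text \<open>Linear and bounded in the sup norm, on \<open>C01\<close> only; values elsewhere are
  arbitrary. Point evaluations of components, components of the boundary form and restrictions of L2
  functionals are all of this kind, so one expansion theorem serves them all.\<close>

definition bounded_functional :: "((real \<Rightarrow> complex^'n) \<Rightarrow> complex) \<Rightarrow> bool" where
  "bounded_functional l \<longleftrightarrow>
     (\<forall>u\<in>C01. \<forall>v\<in>C01. l (\<lambda>x. u x + v x) = l u + l v) \<and>
     (\<forall>c. \<forall>u\<in>C01. l (\<lambda>x. c *s u x) = c * l u) \<and>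
     (\<exists>K. \<forall>u\<in>C01. \<forall>m. (\<forall>x\<in>{0..1}. norm (u x) \<le> m) \<longrightarrow> norm (l u) \<le> K * m)"

lemma bounded_functional_add: "bounded_functional l \<Longrightarrow> u \<in> C01 \<Longrightarrow> v \<in> C01 \<Longrightarrow> l (\<lambda>x. u x + v x) = l u + l v"
  by (simp add: bounded_functional_def)
lemma bounded_functional_smult: "bounded_functional l \<Longrightarrow> u \<in> C01 \<Longrightarrow> l (\<lambda>x. c *s u x) = c * l u"
  by (simp add: bounded_functional_def)
lemma bounded_functional_zero: "bounded_functional l \<Longrightarrow> l (\<lambda>x. 0) = 0"
  using bounded_functional_smult[of l "\<lambda>x. 0" 0] C01_zero by simp
lemma bounded_functional_diff: "bounded_functional l \<Longrightarrow> u \<in> C01 \<Longrightarrow> v \<in> C01 \<Longrightarrow> l (\<lambda>x. u x - v x) = l u - l v"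
  using bounded_functional_add[of l u "\<lambda>x. (-1) *s v x"] bounded_functional_smult[of l v "-1"] C01_smult[of v "-1"] by simp
lemma bounded_functional_sum:
  assumes "bounded_functional l" "finite A" "\<And>i. i \<in> A \<Longrightarrow> u i \<in> C01"
  shows "l (\<lambda>x. \<Sum>i\<in>A. u i x) = (\<Sum>i\<in>A. l (u i))"
  using assms(2,3)
  by (induction A rule: finite_induct) (simp_all add: bounded_functional_zero[OF assms(1)] bounded_functional_add[OF assms(1)] C01_sum)
lemma bounded_functional_bound:
  assumes "bounded_functional l"
  obtains K where "K \<ge> 0" "\<And>u m. u \<in> C01 \<Longrightarrow> (\<And>x. x \<in> {0..1} \<Longrightarrow> norm (u x) \<le> m) \<Longrightarrow> norm (l u) \<le> K * m"
proof -
  obtain K where K: "\<And>u m. u \<in> C01 \<Longrightarrow> \<forall>x\<in>{0..1}. norm (u x) \<le> m \<Longrightarrow> norm (l u) \<le> K * m"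
    using assms unfolding bounded_functional_def by blast
  have "norm (l u) \<le> \<bar>K\<bar> * m" if "u \<in> C01" "\<And>x. x \<in> {0..1} \<Longrightarrow> norm (u x) \<le> m" for u m
  proof -
    have "m \<ge> 0" using that(2)[of 0] norm_ge_zero[of "u 0"] by (simp del: norm_ge_zero)
    then have "K * m \<le> \<bar>K\<bar> * m" by (intro mult_right_mono) auto
    then show ?thesis using K[of u m] that by fastforce
  qed
  then show ?thesis using that[of "\<bar>K\<bar>"] by auto
qed

lemma bounded_functional_eval: "x \<in> {0..1} \<Longrightarrow> bounded_functional (\<lambda>u. u x $ i)"
  unfolding bounded_functional_def
  by (intro conjI ballI allI exI[of _ 1]) (auto intro: order_trans[OF Finite_Cartesian_Product.norm_nth_le])

lemma bounded_functional_compose: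
  assumes l: "bounded_functional l" and T: "\<And>u. u \<in> C01 \<Longrightarrow> T u \<in> C01"
    and add: "\<And>u v. u \<in> C01 \<Longrightarrow> v \<in> C01 \<Longrightarrow> T (\<lambda>x. u x + v x) = (\<lambda>x. T u x + T v x)"
    and smult: "\<And>c u. u \<in> C01 \<Longrightarrow> T (\<lambda>x. c *s u x) = (\<lambda>x. c *s T u x)"
    and bd: "\<And>u m x. u \<in> C01 \<Longrightarrow> (\<And>x. x \<in> {0..1} \<Longrightarrow> norm (u x) \<le> m) \<Longrightarrow> x \<in> {0..1} \<Longrightarrow> norm (T u x) \<le> B * m"
  shows "bounded_functional (\<lambda>u. l (T u))"
proof -
  obtain K where K: "K \<ge> 0" "\<And>u m. u \<in> C01 \<Longrightarrow> (\<And>x. x \<in> {0..1} \<Longrightarrow> norm (u x) \<le> m) \<Longrightarrow> norm (l u) \<le> K * m"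
    using bounded_functional_bound[OF l] by blast
  have "norm (l (T u)) \<le> (K * B) * m" if "u \<in> C01" "\<forall>x\<in>{0..1}. norm (u x) \<le> m" for u m
    using K(2)[OF T[OF that(1)], of "B * m"] bd[OF that(1), of m] that(2) by (simp add: mult.assoc)
  then show ?thesis
    unfolding bounded_functional_def
    using bounded_functional_add[OF l] bounded_functional_smult[OF l] T add smult by auto
qed

lemma sup_sq_integral_bound:
  assumes "u \<in> C01" "\<And>x. x \<in> {0..1} \<Longrightarrow> norm (u x) \<le> m" "x \<in> {0..1}"
  shows "integral {0..x} (\<lambda>t. (norm (u t))\<^sup>2) \<le> m\<^sup>2"
proof -
  have "integral {0..x} (\<lambda>t. (norm (u t))\<^sup>2) \<le> integral {0..x} (\<lambda>t. m\<^sup>2)"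
    using assms by (intro integral_le L2_sq_integrable_on C01_L2) (auto intro!: power_mono)
  also have "\<dots> = x * m\<^sup>2" using assms(3) by simp
  also have "\<dots> \<le> m\<^sup>2" using assms(3) by (simp add: mult_left_le_one_le)
  finally show ?thesis .
qed

text \<open>Iterating the Volterra estimate bounds the square of the j-th iterate by a constant
  times K^j x^j / j!, so the series converges uniformly whatever K is. The sum is stated through all
  bounded functionals at once, the form in which Taylor expansions in the spectral parameter are
  read off.\<close>

proposition Volterra_Neumann_series:
  fixes T :: "(real \<Rightarrow> complex^'n) \<Rightarrow> (real \<Rightarrow> complex^'n)"
  assumes T: "\<And>u. u \<in> C01 \<Longrightarrow> T u \<in> C01"
    and add: "\<And>u v. u \<in> C01 \<Longrightarrow> v \<in> C01 \<Longrightarrow> T (\<lambda>x. u x + v x) = (\<lambda>x. T u x + T v x)"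
    and smult: "\<And>c u. u \<in> C01 \<Longrightarrow> T (\<lambda>x. c *s u x) = (\<lambda>x. c *s T u x)"
    and K: "K \<ge> 0" and bound: "\<And>u x. u \<in> C01 \<Longrightarrow> x \<in> {0..1} \<Longrightarrow> (norm (T u x))\<^sup>2 \<le> K * integral {0..x} (\<lambda>t. (norm (u t))\<^sup>2)"
    and u: "u \<in> C01"
  obtains z where "z \<in> C01" "z = (\<lambda>x. u x + T z x)" "\<And>l. bounded_functional l \<Longrightarrow> (\<lambda>j. l ((T ^^ j) u)) sums l z"
proof -
  obtain U where U: "U \<ge> 0" "\<And>x. x \<in> {0..1} \<Longrightarrow> norm (u x) \<le> U" using C01_bounded[OF u] by blast
  have iter: "(T ^^ j) u \<in> C01" for j by (induction j) (auto intro: u T)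
  have it: "(norm ((T ^^ j) u x))\<^sup>2 \<le> (K ^ j * x ^ j / fact j) * U\<^sup>2" if "x \<in> {0..1}" for j x
    using that
  proof (induction j arbitrary: x)
    case 0 then show ?case using U by (auto intro!: power_mono)
  next
    case (Suc j)
    have hi: "((\<lambda>t. (K ^ j * t ^ j / fact j) * U\<^sup>2) has_integral (K ^ j * (x ^ Suc j / Suc j) / fact j) * U\<^sup>2) {0..x}"
    proof -
      have "((\<lambda>t::real. t ^ j) has_integral x ^ Suc j / Suc j - 0 ^ Suc j / Suc j) {0..x}"
      proof (rule fundamental_theorem_of_calculus)
        fix t :: real
        show "((\<lambda>t. t ^ Suc j / Suc j) has_vector_derivative t ^ j) (at t within {0..x})"
          unfolding has_real_derivative_iff_has_vector_derivative[symmetric]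
          using DERIV_cdivide[OF DERIV_pow[of "Suc j" t "{0..x}"], of "real (Suc j)"] by simp
      qed (use Suc.prems in auto)
      from has_integral_mult_right[OF this, of "K ^ j / fact j * U\<^sup>2"] show ?thesis
        by (simp add: algebra_simps)
    qed
    have "(norm ((T ^^ Suc j) u x))\<^sup>2 \<le> K * integral {0..x} (\<lambda>t. (norm ((T ^^ j) u t))\<^sup>2)"
      using bound[OF iter Suc.prems] by simp
    also have "\<dots> \<le> K * ((K ^ j * (x ^ Suc j / Suc j) / fact j) * U\<^sup>2)"
    proof (rule mult_left_mono[OF _ K], rule has_integral_le[OF integrable_integral hi])
      show "(\<lambda>t. (norm ((T ^^ j) u t))\<^sup>2) integrable_on {0..x}"
        using Suc.prems by (intro L2_sq_integrable_on C01_L2 iter) auto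
    qed (use Suc in auto)
    also have "\<dots> = (K ^ Suc j * x ^ Suc j / fact (Suc j)) * U\<^sup>2" by (simp add: field_simps)
    finally show ?case .
  qed
  \<comment> \<open>The iterates are bounded by U times the square root of K^j / j!. This root is
    the geometric mean of (2 K)^j / j! and (1/2)^j, and their arithmetic mean is a summable bound
    without roots.\<close>
  define M where "M = (\<lambda>j. U * ((2 * K) ^ j / fact j + (1/2) ^ j) / 2)"
  have M: "norm ((T ^^ j) u x) \<le> M j" if x: "x \<in> {0..1}" for j x
  proof (rule power2_le_imp_le)
    let ?c = "K ^ j / fact j" let ?s = "2 ^ j :: real"
    have "(norm ((T ^^ j) u x))\<^sup>2 \<le> (K ^ j * x ^ j / fact j) * U\<^sup>2" by (rule it[OF x])
    also have "\<dots> \<le> ?c * U\<^sup>2"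
      using x K by (intro mult_right_mono divide_right_mono mult_left_le) (auto simp: power_le_one)
    also have "\<dots> = U\<^sup>2 * (?s * ?c * (1/2) ^ j)" by (simp add: power_divide)
    also have "\<dots> \<le> U\<^sup>2 * ((?s * ?c + (1/2) ^ j) / 2)\<^sup>2"
    proof (intro mult_left_mono)
      have "p * q \<le> ((p + q) / 2)\<^sup>2" for p q :: real
        using zero_le_power2[of "p - q"] by (simp add: power2_eq_square field_simps)
      from this[of "?s * ?c" "(1/2) ^ j"] show "?s * ?c * (1/2) ^ j \<le> ((?s * ?c + (1/2) ^ j) / 2)\<^sup>2" .
    qed simp
    also have "\<dots> = (M j)\<^sup>2" by (simp add: M_def power_mult_distrib power_divide)
    finally show "(norm ((T ^^ j) u x))\<^sup>2 \<le> (M j)\<^sup>2" .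
    show "0 \<le> M j" using U K by (simp add: M_def)
  qed
  have "summable (\<lambda>j. (U / 2) * ((2 * K) ^ j / fact j + (1/2) ^ j))"
  proof (intro summable_mult summable_add)
    show "summable (\<lambda>j. (2 * K) ^ j / fact j)" using summable_exp[of "2 * K"] by (simp add: field_simps)
    show "summable (\<lambda>j. (1/2 :: real) ^ j)" by (rule summable_geometric) simp
  qed
  then have sM: "summable M" by (simp add: M_def field_simps)
  define z where "z = (\<lambda>x. suminf (\<lambda>j. (T ^^ j) u x))"
  have ul: "uniform_limit {0..1} (\<lambda>n x. \<Sum>j<n. (T ^^ j) u x) z sequentially"
    unfolding z_def by (rule Weierstrass_m_test[OF M sM])
  have "continuous_on {0..1} z"
    by (rule uniform_limit_theorem[OF _ ul]) (simp_all add: C01_continuous[OF C01_sum[OF _ iter]])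
  moreover have "z x = 0" if "x \<notin> {0..1}" for x
    using iter that by (simp add: z_def C01_def)
  ultimately have z: "z \<in> C01" by (simp add: C01_def)
  have sums: "(\<lambda>j. l ((T ^^ j) u)) sums l z" if l: "bounded_functional l" for l
  proof -
    obtain B where B: "B \<ge> 0" "\<And>u m. u \<in> C01 \<Longrightarrow> (\<And>x. x \<in> {0..1} \<Longrightarrow> norm (u x) \<le> m) \<Longrightarrow> norm (l u) \<le> B * m"
      using bounded_functional_bound[OF l] by blast
    have "(\<lambda>n. \<Sum>j<n. l ((T ^^ j) u)) \<longlonglongrightarrow> l z"
    proof (rule LIMSEQ_I)
      fix e :: real assume e: "e > 0"
      then have "e / (B + 1) > 0" using B(1) by simp
      then obtain N where N: "\<And>n x. n \<ge> N \<Longrightarrow> x \<in> {0..1} \<Longrightarrow> dist (\<Sum>j<n. (T ^^ j) u x) (z x) < e / (B + 1)"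
        using ul unfolding uniform_limit_iff eventually_sequentially by meson
      have "norm ((\<Sum>j<n. l ((T ^^ j) u)) - l z) < e" if "n \<ge> N" for n
      proof -
        have s: "(\<lambda>x. \<Sum>j<n. (T ^^ j) u x) \<in> C01" by (rule C01_sum) (auto intro: iter)
        have "(\<Sum>j<n. l ((T ^^ j) u)) - l z = l (\<lambda>x. (\<Sum>j<n. (T ^^ j) u x) - z x)"
          by (simp add: bounded_functional_diff[OF l s z] bounded_functional_sum[OF l] iter)
        also have "norm \<dots> \<le> B * (e / (B + 1))"
          by (rule B(2)[OF C01_diff[OF s z]]) (use N[OF that] in \<open>auto simp: dist_norm less_imp_le\<close>)
        also have "\<dots> < e" using B(1) e by (simp add: field_simps)
        finally show ?thesis .
      qed
      then show "\<exists>N. \<forall>n\<ge>N. norm ((\<Sum>j<n. l ((T ^^ j) u)) - l z) < e" by blast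
    qed
    then show ?thesis by (simp add: sums_def)
  qed
  have bT: "norm (T v x) \<le> sqrt K * m" if "v \<in> C01" "\<And>x. x \<in> {0..1} \<Longrightarrow> norm (v x) \<le> m" "x \<in> {0..1}" for v m x
  proof (rule power2_le_imp_le)
    have m: "m \<ge> 0" using that(2)[of 0] norm_ge_zero[of "v 0"] by (simp del: norm_ge_zero)
    show "(norm (T v x))\<^sup>2 \<le> (sqrt K * m)\<^sup>2"
      using bound[OF that(1,3)] mult_left_mono[OF sup_sq_integral_bound[OF that] K] K by (simp add: power_mult_distrib)
    show "0 \<le> sqrt K * m" using m K by simp
  qed
  \<comment> \<open>Evaluating a component of \<open>T v\<close> at a point is itself a bounded
    functional of \<open>v\<close>, so its series is that of \<open>z\<close> without the first
    term.\<close>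
  have "z = (\<lambda>x. u x + T z x)"
  proof (rule ext)
    fix x show "z x = u x + T z x"
    proof (cases "x \<in> {0..1}")
      case True
      have "z x $ i = (u x + T z x) $ i" for i
      proof -
        have "bounded_functional (\<lambda>v. (T v) x $ i)"
          by (rule bounded_functional_compose[OF bounded_functional_eval[OF True] T add smult bT])
        from sums[OF this] have "(\<lambda>j. (T ^^ Suc j) u x $ i) sums (T z x $ i)" by simp
        then have "(\<lambda>j. (T ^^ j) u x $ i) sums (T z x $ i + (T ^^ 0) u x $ i)"
          by (subst (asm) sums_Suc_iff) simp
        moreover have "(\<lambda>j. (T ^^ j) u x $ i) sums (z x $ i)"
          by (rule sums[OF bounded_functional_eval[OF True]])
        ultimately show ?thesis using sums_unique2 by fastforce
      qed
      then show ?thesis by (simp add: vec_eq_iff)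
    next
      case False
      then show ?thesis using z T[OF z] u by (auto simp: C01_def)
    qed
  qed
  then show ?thesis using that z sums by blast
qed


section \<open>Solutions of the first order system\<close>

locale dirac_system =
  fixes a :: "'n::finite \<Rightarrow> real" and Q :: "real \<Rightarrow> complex^'n^'n"
  assumes a_nonzero: "\<And>i. a i \<noteq> 0" and Q_L2: "Q \<in> L2"
begin

text \<open>The equation -\<i> B y' + Q y - \<zeta> y = g solved for y', where B has the diagonal
  entries 1 / a i.\<close>

definition vfield :: "complex \<Rightarrow> (real \<Rightarrow> complex^'n) \<Rightarrow> (real \<Rightarrow> complex^'n) \<Rightarrow> real \<Rightarrow> complex^'n" where
  "vfield \<zeta> g y t = (\<chi> i. \<i> * of_real (a i) * (g t $ i + \<zeta> * y t $ i - (Q t *v y t) $ i))"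

text \<open>The differential equation (L - \<zeta>) y = g in integrated form, without boundary
  conditions.\<close>

definition sol :: "complex \<Rightarrow> (real \<Rightarrow> complex^'n) \<Rightarrow> (real \<Rightarrow> complex^'n) \<Rightarrow> bool" where
  "sol \<zeta> g y \<longleftrightarrow> g \<in> L2 \<and> y \<in> C01 \<and> (\<forall>x\<in>{0..1}. y x = y 0 + integral {0..x} (vfield \<zeta> g y))"

lemma potential_L2: 
  assumes "y \<in> C01" shows "(\<lambda>t. Q t *v y t) \<in> L2"
proof -
  obtain m where m: "m \<ge> 0" "\<And>x. x \<in> {0..1} \<Longrightarrow> norm (y x) \<le> m" using C01_bounded[OF assms] by blast
  have bil: "bilinear ((*v) :: complex^'n^'n \<Rightarrow> complex^'n \<Rightarrow> complex^'n)"
    unfolding bilinear_def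
    by (auto intro!: linearI simp: vec_eq_iff matrix_vector_mult_def sum.distrib algebra_simps scaleR_sum_right)
  have my: "y \<in> borel_measurable (lebesgue_on {0..1})" using C01_L2[OF assms] by (rule L2_measurable)
  show ?thesis
  proof (rule L2_I_bound[OF _ Q_L2])
    show "(\<lambda>t. Q t *v y t) \<in> borel_measurable (lebesgue_on {0..1})"
      using borel_measurable_bilinear[OF bil L2_measurable[OF Q_L2] my] by simp
    fix x :: real assume "x \<in> {0..1}"
    then have "real CARD('n) * (norm (Q x) * norm (y x)) \<le> real CARD('n) * (norm (Q x) * m)"
      using m by (intro mult_left_mono) auto
    then show "norm (Q x *v y x) \<le> (real CARD('n) * m) * norm (Q x)"
      using norm_matrix_vector_mult_le[of "Q x" "y x"] by (simp only: mult_ac)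
  qed
qed

definition adiag :: "complex^'n \<Rightarrow> complex^'n" where
  "adiag v = (\<chi> i. \<i> * of_real (a i) * v $ i)"

lemma bounded_linear_adiag: "bounded_linear adiag"
  unfolding adiag_def by (intro linear_conv_bounded_linear[THEN iffD1] linearI)
     (simp_all add: vec_eq_iff algebra_simps)

lemma vfield_adiag: "vfield \<zeta> g y t = adiag (g t + \<zeta> *s y t - Q t *v y t)"
  by (simp add: vfield_def adiag_def vec_eq_iff)

lemma vfield_L2: "g \<in> L2 \<Longrightarrow> y \<in> C01 \<Longrightarrow> vfield \<zeta> g y \<in> L2"
  unfolding vfield_adiag[abs_def]
  by (intro L2_bounded_linear[OF _ bounded_linear_adiag] L2_diff[OF L2_add] L2_smult[OF C01_L2] potential_L2)

lemma sol_L2: "sol \<zeta> g y \<Longrightarrow> g \<in> L2" and sol_C01: "sol \<zeta> g y \<Longrightarrow> y \<in> C01"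
  unfolding sol_def by blast+

lemma sol_eq: "sol \<zeta> g y \<Longrightarrow> x \<in> {0..1} \<Longrightarrow> y x = y 0 + integral {0..x} (vfield \<zeta> g y)"
  unfolding sol_def by blast

lemma integral_vfield_component:
  assumes "g \<in> L2" "y \<in> C01" "x \<in> {0..1}"
  shows "integral {0..x} (vfield \<zeta> g y) $ i = integral {0..x} (\<lambda>t. vfield \<zeta> g y t $ i)"
proof -
  have "vfield \<zeta> g y integrable_on {0..x}" using assms by (intro L2_integrable_on vfield_L2) auto
  from integral_linear[OF this bounded_linear_vec_nth, of i] show ?thesis by (simp add: o_def)
qed

text \<open>Everything except the free term \<i> a \<zeta> y of the scalar equation. It still
  contains the unknown \<open>y\<close> through \<open>Q\<close>; that contribution is fed to
  Gronwall on strips and absorbed in the half planes.\<close>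

definition forcing :: "(real \<Rightarrow> complex^'n) \<Rightarrow> (real \<Rightarrow> complex^'n) \<Rightarrow> 'n \<Rightarrow> real \<Rightarrow> complex" where
  "forcing g y i t = \<i> * of_real (a i) * (g t $ i - (Q t *v y t) $ i)"

lemma forcing_L2:
  assumes "g \<in> L2" "y \<in> C01" shows "forcing g y i \<in> L2"
proof -
  have "forcing g y i = (\<lambda>t. adiag (g t - Q t *v y t) $ i)"
    by (simp add: fun_eq_iff forcing_def adiag_def)
  also have "\<dots> \<in> L2"
    by (intro L2_bounded_linear[OF _ bounded_linear_vec_nth] L2_bounded_linear[OF _ bounded_linear_adiag] L2_diff potential_L2 assms)
  finally show ?thesis .
qed

lemma sol_component:
  assumes "sol \<zeta> g y" "x \<in> {0..1}"
  shows "y x $ i = y 0 $ i + integral {0..x} (\<lambda>t. (\<i> * of_real (a i) * \<zeta>) * y t $ i + forcing g y i t)"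
proof -
  have "y x $ i = (y 0 + integral {0..x} (vfield \<zeta> g y)) $ i" using sol_eq[OF assms] by simp
  also have "\<dots> = y 0 $ i + integral {0..x} (\<lambda>t. vfield \<zeta> g y t $ i)"
    using assms by (simp add: integral_vfield_component sol_L2 sol_C01)
  also have "(\<lambda>t. vfield \<zeta> g y t $ i) = (\<lambda>t. (\<i> * of_real (a i) * \<zeta>) * y t $ i + forcing g y i t)"
    by (simp add: fun_eq_iff vfield_def forcing_def algebra_simps)
  finally show ?thesis .
qed

lemma C01_component_continuous: "y \<in> C01 \<Longrightarrow> continuous_on {0..1} (\<lambda>t. y t $ i)"
  by (intro continuous_intros C01_continuous)

definition asum :: real where "asum = (\<Sum>i\<in>UNIV. \<bar>a i\<bar>)"

lemma asum_ge: "\<bar>a i\<bar> \<le> asum"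
  unfolding asum_def by (rule member_le_sum) auto

lemma asum_nonneg: "asum \<ge> 0" unfolding asum_def by (simp add: sum_nonneg)

lemma forcing_bound: "norm (forcing g y i t) \<le> asum * (norm (g t) + norm (Q t) * norm (y t))"
proof -
  have "norm (forcing g y i t) = \<bar>a i\<bar> * norm (g t $ i - (Q t *v y t) $ i)"
    by (simp add: forcing_def norm_mult)
  also have "\<dots> \<le> asum * (norm (g t) + norm (Q t) * norm (y t))"
    using norm_triangle_ineq4[of "g t $ i" "(Q t *v y t) $ i"] Finite_Cartesian_Product.norm_nth_le[of "g t" i]
      norm_matrix_vector_mult_component[of "Q t" "y t" i]
    by (intro mult_mono asum_ge asum_nonneg) auto
  finally show ?thesis .
qed

text \<open>Variation of constants keeps the oscillating factor \<open>exp (\<i> a Re \<zeta> x)\<close> out of the estimate, so the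
  constant depends on the imaginary part of the spectral parameter only.\<close>

lemma solution_bound:
  obtains K where "K \<ge> 0" "\<And>\<zeta> g y x. \<bar>Im \<zeta>\<bar> \<le> R \<Longrightarrow> sol \<zeta> g y \<Longrightarrow> x \<in> {0..1} \<Longrightarrow>
    (norm (y x))\<^sup>2 \<le> K * ((norm (y 0))\<^sup>2 + integral {0..x} (\<lambda>t. (norm (g t))\<^sup>2))"
proof -
  \<comment> \<open>One exponential bounds the integrating factor, the other its inverse.\<close>
  define E where "E = exp (asum * R) ^ 2"
  define q where "q = integral {0..1} (\<lambda>t. (norm (Q t))\<^sup>2)"
  define n where "n = real CARD('n)"
  define b where "b = n * (3 * E\<^sup>2 * asum\<^sup>2 * q)"
  define K where "K = n * (3 * E\<^sup>2 * (1 + asum\<^sup>2)) * exp b"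
  have q: "q \<ge> 0" unfolding q_def using L2_sq_integrable_on[OF Q_L2, of 0 1] by (intro integral_nonneg) auto
  have b: "b \<ge> 0" unfolding b_def n_def using q by simp
  have "K \<ge> 0" unfolding K_def n_def by simp
  moreover have "(norm (y x))\<^sup>2 \<le> K * ((norm (y 0))\<^sup>2 + integral {0..x} (\<lambda>t. (norm (g t))\<^sup>2))"
    if R: "\<bar>Im \<zeta>\<bar> \<le> R" and s: "sol \<zeta> g y" and x: "x \<in> {0..1}" for \<zeta> g y x
  proof -
    note g = sol_L2[OF s] and y = sol_C01[OF s]
    note y2 = C01_L2[OF y]
    define G where "G = (norm (y 0))\<^sup>2 + integral {0..x} (\<lambda>t. (norm (g t))\<^sup>2)"
    have G0: "G \<ge> 0" unfolding G_def using L2_sq_integrable_on[OF g, of 0 x] x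
      by (intro add_nonneg_nonneg integral_nonneg) auto
    \<comment> \<open>Squares are estimated because Cauchy-Schwarz then separates \<open>Q\<close>
      from \<open>y\<close> and leaves the integral of \<bar>y\<bar>^2, so Gronwall applies with a
      constant coefficient although \<open>Q\<close> may be unbounded.\<close>
    have main: "(norm (y r))\<^sup>2 \<le> n * (3 * E\<^sup>2 * (1 + asum\<^sup>2)) * G + b * integral {0..r} (\<lambda>t. (norm (y t))\<^sup>2)"
      if r: "r \<in> {0..x}" for r
    proof -
      have r1: "r \<in> {0..1}" using r x by auto
      have expb: "norm (exp (\<i> * of_real (a i) * \<zeta> * of_real t)) \<le> exp (asum * R)"
        "norm (exp (- (\<i> * of_real (a i) * \<zeta>) * of_real t)) \<le> exp (asum * R)" if "t \<in> {0..1}" for t i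
      proof -
        have "\<bar>a i * Im \<zeta> * t\<bar> \<le> asum * R"
        proof -
          have "\<bar>a i * Im \<zeta> * t\<bar> \<le> \<bar>a i\<bar> * \<bar>Im \<zeta>\<bar>" using that by (simp add: abs_mult mult_left_le)
          also have "\<dots> \<le> asum * R" using R by (intro mult_mono asum_ge asum_nonneg) auto
          finally show ?thesis .
        qed
        then show "norm (exp (\<i> * of_real (a i) * \<zeta> * of_real t)) \<le> exp (asum * R)"
          "norm (exp (- (\<i> * of_real (a i) * \<zeta>) * of_real t)) \<le> exp (asum * R)" by auto
      qed
      define F where "F = norm (y 0) + asum * (integral {0..r} (\<lambda>t. norm (g t)) + integral {0..r} (\<lambda>t. norm (Q t) * norm (y t)))"
      have ng: "(\<lambda>t. norm (g t)) integrable_on {0..r}" using r1 by (intro L2_integrable_on L2_norm_fun g) auto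
      have nQy: "(\<lambda>t. norm (Q t) * norm (y t)) integrable_on {0..r}"
        by (rule integrable_on_subinterval[of _ "{0..1}"], rule set_lebesgue_integral_eq_integral(1),
            rule L2_mult_absolutely_integrable[OF L2_norm_fun[OF Q_L2] L2_norm_fun[OF y2]]) (use r1 in auto)
      have comp: "norm (y r $ i) \<le> E * F" for i
      proof -
        let ?\<alpha> = "\<i> * of_real (a i) * \<zeta>"
        have v: "exp (- ?\<alpha> * of_real r) * y r $ i = y 0 $ i + integral {0..r} (\<lambda>t. exp (- ?\<alpha> * of_real t) * forcing g y i t)"
          by (rule variation_of_constants[OF forcing_L2[OF g y] C01_component_continuous[OF y] sol_component[OF s] r1])
        have "norm (integral {0..r} (\<lambda>t. exp (- ?\<alpha> * of_real t) * forcing g y i t))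
            \<le> integral {0..r} (\<lambda>t. exp (asum * R) * (asum * (norm (g t) + norm (Q t) * norm (y t))))"
        proof (rule integral_norm_bound_integral)
          show "(\<lambda>t. exp (- ?\<alpha> * of_real t) * forcing g y i t) integrable_on {0..r}"
            using r1 by (intro L2_integrable_on L2_mult_continuous forcing_L2 g y continuous_intros) auto
          show "(\<lambda>t. exp (asum * R) * (asum * (norm (g t) + norm (Q t) * norm (y t)))) integrable_on {0..r}"
            by (intro integrable_on_mult_right integrable_add ng nQy)
          fix t assume "t \<in> {0..r}"
          then have "t \<in> {0..1}" using r1 by auto
          then show "norm (exp (- ?\<alpha> * of_real t) * forcing g y i t) \<le> exp (asum * R) * (asum * (norm (g t) + norm (Q t) * norm (y t)))"
            unfolding norm_mult using expb(2)[of t i] by (intro mult_mono forcing_bound) auto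
        qed
        also have "\<dots> = exp (asum * R) * (asum * (integral {0..r} (\<lambda>t. norm (g t)) + integral {0..r} (\<lambda>t. norm (Q t) * norm (y t))))"
          by (simp add: Henstock_Kurzweil_Integration.integral_add[OF ng nQy])
        finally have "norm (exp (- ?\<alpha> * of_real r) * y r $ i) \<le> norm (y 0 $ i) + \<dots>"
          unfolding v by (rule order_trans[OF norm_triangle_ineq add_left_mono])
        also have "\<dots> \<le> exp (asum * R) * norm (y 0) + exp (asum * R) * (asum * (integral {0..r} (\<lambda>t. norm (g t)) + integral {0..r} (\<lambda>t. norm (Q t) * norm (y t))))"
        proof (rule add_right_mono)
          have "norm (y 0 $ i) \<le> 1 * norm (y 0)" by (simp add: Finite_Cartesian_Product.norm_nth_le)
          also have "\<dots> \<le> exp (asum * R) * norm (y 0)"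
            using asum_nonneg R by (intro mult_right_mono) auto
          finally show "norm (y 0 $ i) \<le> exp (asum * R) * norm (y 0)" .
        qed
        also have "\<dots> = exp (asum * R) * F" by (simp add: F_def algebra_simps)
        finally have 1: "norm (exp (- ?\<alpha> * of_real r) * y r $ i) \<le> exp (asum * R) * F" .
        have "norm (y r $ i) = norm (exp (?\<alpha> * of_real r)) * norm (exp (- ?\<alpha> * of_real r) * y r $ i)"
        proof -
          have "y r $ i = exp (?\<alpha> * of_real r) * (exp (- ?\<alpha> * of_real r) * y r $ i)"
            by (simp add: mult.assoc[symmetric] flip: exp_add)
          then show ?thesis by (metis norm_mult)
        qed
        also have "\<dots> \<le> exp (asum * R) * (exp (asum * R) * F)"
          using expb(1)[OF r1, of i] 1 by (intro mult_mono) auto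
        finally show ?thesis by (simp add: E_def power2_eq_square mult.assoc)
      qed
      have F0: "F \<ge> 0" unfolding F_def using asum_nonneg ng nQy
        by (intro add_nonneg_nonneg mult_nonneg_nonneg integral_nonneg) auto
      have "(norm (y r))\<^sup>2 = (\<Sum>i\<in>UNIV. (norm (y r $ i))\<^sup>2)"
        unfolding norm_vec_def L2_set_def by (simp add: sum_nonneg)
      also have "\<dots> \<le> (\<Sum>i\<in>(UNIV::'n set). (E * F)\<^sup>2)"
        by (intro sum_mono power_mono comp) auto
      finally have nyr: "(norm (y r))\<^sup>2 \<le> n * (E\<^sup>2 * F\<^sup>2)" by (simp add: n_def power_mult_distrib)
      have three: "(p + s * (u + v))\<^sup>2 \<le> 3 * (p\<^sup>2 + s\<^sup>2 * u\<^sup>2 + s\<^sup>2 * v\<^sup>2)" for p s u v :: real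
        using zero_le_power2[of "p - s * u"] zero_le_power2[of "p - s * v"] zero_le_power2[of "s * u - s * v"]
        by (simp add: power2_eq_square algebra_simps)
      have I1: "(integral {0..r} (\<lambda>t. norm (g t)))\<^sup>2 \<le> integral {0..x} (\<lambda>t. (norm (g t))\<^sup>2)"
      proof -
        have "(integral {0..r} (\<lambda>t. 1 * norm (g t)))\<^sup>2 \<le> integral {0..r} (\<lambda>t. 1\<^sup>2) * integral {0..r} (\<lambda>t. (norm (g t))\<^sup>2)"
          using r1 ng L2_sq_integrable_on[OF g, of 0 r] by (intro integral_Cauchy_Schwarz) auto
        also have "\<dots> \<le> 1 * integral {0..x} (\<lambda>t. (norm (g t))\<^sup>2)"
          using r x L2_sq_integrable_on[OF g] by (intro mult_mono integral_subset_le integral_nonneg) auto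
        finally show ?thesis by simp
      qed
      have I2: "(integral {0..r} (\<lambda>t. norm (Q t) * norm (y t)))\<^sup>2 \<le> q * integral {0..r} (\<lambda>t. (norm (y t))\<^sup>2)"
      proof -
        have "(integral {0..r} (\<lambda>t. norm (Q t) * norm (y t)))\<^sup>2 \<le> integral {0..r} (\<lambda>t. (norm (Q t))\<^sup>2) * integral {0..r} (\<lambda>t. (norm (y t))\<^sup>2)"
          using r1 nQy L2_sq_integrable_on[OF Q_L2, of 0 r] L2_sq_integrable_on[OF y2, of 0 r] by (intro integral_Cauchy_Schwarz) auto
        also have "\<dots> \<le> q * integral {0..r} (\<lambda>t. (norm (y t))\<^sup>2)"
          unfolding q_def using r1 L2_sq_integrable_on[OF Q_L2] L2_sq_integrable_on[OF y2] by (intro mult_right_mono integral_subset_le integral_nonneg) auto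
        finally show ?thesis .
      qed
      let ?Y = "integral {0..r} (\<lambda>t. (norm (y t))\<^sup>2)"
      have "F\<^sup>2 \<le> 3 * ((norm (y 0))\<^sup>2 + asum\<^sup>2 * (integral {0..r} (\<lambda>t. norm (g t)))\<^sup>2 + asum\<^sup>2 * (integral {0..r} (\<lambda>t. norm (Q t) * norm (y t)))\<^sup>2)"
        unfolding F_def by (rule three)
      also have "\<dots> \<le> 3 * ((norm (y 0))\<^sup>2 + asum\<^sup>2 * integral {0..x} (\<lambda>t. (norm (g t))\<^sup>2) + asum\<^sup>2 * (q * ?Y))"
        by (intro mult_left_mono add_mono order_refl I1 I2) auto
      also have "\<dots> \<le> 3 * ((1 + asum\<^sup>2) * G + asum\<^sup>2 * (q * ?Y))"
      proof -
        have "integral {0..x} (\<lambda>t. (norm (g t))\<^sup>2) \<ge> 0" using L2_sq_integrable_on[OF g, of 0 x] x by (intro integral_nonneg) auto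
        then have "(norm (y 0))\<^sup>2 + asum\<^sup>2 * integral {0..x} (\<lambda>t. (norm (g t))\<^sup>2) \<le> (1 + asum\<^sup>2) * G"
          unfolding G_def by (simp add: algebra_simps)
        then show ?thesis by simp
      qed
      finally have "n * (E\<^sup>2 * F\<^sup>2) \<le> n * (E\<^sup>2 * (3 * ((1 + asum\<^sup>2) * G + asum\<^sup>2 * (q * ?Y))))"
        unfolding n_def by (intro mult_left_mono) auto
      also have "\<dots> = n * (3 * E\<^sup>2 * (1 + asum\<^sup>2)) * G + b * ?Y" unfolding b_def by (simp add: algebra_simps)
      finally show ?thesis using nyr by simp
    qed
    have "(norm (y x))\<^sup>2 \<le> n * (3 * E\<^sup>2 * (1 + asum\<^sup>2)) * G * exp (b * x)"
    proof (rule Gronwall[OF _ b])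
      show "continuous_on {0..x} (\<lambda>t. (norm (y t))\<^sup>2)"
        by (intro continuous_intros continuous_on_subset[OF C01_continuous[OF y]]) (use x in auto)
    qed (use x main in auto)
    also have "\<dots> \<le> n * (3 * E\<^sup>2 * (1 + asum\<^sup>2)) * G * exp b"
      using x b G0 unfolding n_def by (intro mult_left_mono) (auto simp: mult_left_le)
    finally show ?thesis unfolding K_def G_def by (simp add: mult_ac)
  qed
  ultimately show ?thesis using that by blast
qed

lemma sol_add: assumes "sol \<zeta> g y" "sol \<zeta> h z" shows "sol \<zeta> (\<lambda>x. g x + h x) (\<lambda>x. y x + z x)"
proof -
  have "y x + z x = y 0 + z 0 + integral {0..x} (vfield \<zeta> (\<lambda>x. g x + h x) (\<lambda>x. y x + z x))" if x: "x \<in> {0..1}" for x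
  proof -
    have "integral {0..x} (vfield \<zeta> g y) + integral {0..x} (vfield \<zeta> h z) = integral {0..x} (\<lambda>t. vfield \<zeta> g y t + vfield \<zeta> h z t)"
      using x assms by (intro Henstock_Kurzweil_Integration.integral_add[symmetric] L2_integrable_on vfield_L2) (auto intro: sol_L2 sol_C01)
    also have "(\<lambda>t. vfield \<zeta> g y t + vfield \<zeta> h z t) = vfield \<zeta> (\<lambda>x. g x + h x) (\<lambda>x. y x + z x)"
      by (simp add: fun_eq_iff vec_eq_iff vfield_def matrix_vector_right_distrib algebra_simps)
    finally show ?thesis using sol_eq[OF assms(1) x] sol_eq[OF assms(2) x] by simp
  qed
  then show ?thesis unfolding sol_def using L2_add[OF sol_L2 sol_L2, OF assms] C01_add[OF sol_C01 sol_C01, OF assms] by blast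
qed

lemma sol_smult: assumes "sol \<zeta> g y" shows "sol \<zeta> (\<lambda>x. c *s g x) (\<lambda>x. c *s y x)"
proof -
  have "c *s y x = c *s y 0 + integral {0..x} (vfield \<zeta> (\<lambda>x. c *s g x) (\<lambda>x. c *s y x))" if x: "x \<in> {0..1}" for x
  proof -
    have "c *s integral {0..x} (vfield \<zeta> g y) = integral {0..x} ((\<lambda>v. c *s v) \<circ> vfield \<zeta> g y)"
      using x assms by (intro integral_linear[symmetric] bounded_linear_smult_cvec L2_integrable_on vfield_L2) (auto intro: sol_L2 sol_C01)
    also have "((\<lambda>v. c *s v) \<circ> vfield \<zeta> g y) = vfield \<zeta> (\<lambda>x. c *s g x) (\<lambda>x. c *s y x)"
      by (simp add: fun_eq_iff vec_eq_iff vfield_def vector_scalar_commute algebra_simps)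
    finally show ?thesis using sol_eq[OF assms(1) x] by (simp add: vec.scale_right_distrib)
  qed
  then show ?thesis unfolding sol_def using L2_smult[OF sol_L2, OF assms] C01_smult[OF sol_C01, OF assms] by blast
qed

lemma sol_diff: "sol \<zeta> g y \<Longrightarrow> sol \<zeta> h z \<Longrightarrow> sol \<zeta> (\<lambda>x. g x - h x) (\<lambda>x. y x - z x)"
  using sol_add[of \<zeta> g y "\<lambda>x. (-1) *s h x" "\<lambda>x. (-1) *s z x"] sol_smult[of \<zeta> h z "-1"] by simp

text \<open>A change of the spectral parameter is moved to the right-hand side. This turns the
  dependence on \<zeta> into a fixed-point equation at a fixed \<mu>.\<close>

lemma sol_shift: "sol \<zeta> g y \<longleftrightarrow> sol \<mu> (\<lambda>x. g x + (\<zeta> - \<mu>) *s y x) y" if "y \<in> C01"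
proof -
  have "vfield \<mu> (\<lambda>x. g x + (\<zeta> - \<mu>) *s y x) y = vfield \<zeta> g y"
    by (simp add: fun_eq_iff vec_eq_iff vfield_def algebra_simps)
  moreover have "g \<in> L2 \<longleftrightarrow> (\<lambda>x. g x + (\<zeta> - \<mu>) *s y x) \<in> L2"
  proof
    assume "(\<lambda>x. g x + (\<zeta> - \<mu>) *s y x) \<in> L2"
    from L2_diff[OF this L2_smult[OF C01_L2[OF that], of "\<zeta> - \<mu>"]] show "g \<in> L2" by simp
  qed (intro L2_add L2_smult[OF C01_L2] that)
  ultimately show ?thesis by (simp add: sol_def)
qed

lemma sol_zero_unique: assumes "sol \<zeta> (\<lambda>x. 0) y" "y 0 = 0" shows "y = (\<lambda>x. 0)"
proof
  fix x
  obtain K where K: "\<And>g y x. sol \<zeta> g y \<Longrightarrow> x \<in> {0..1} \<Longrightarrow>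
    (norm (y x))\<^sup>2 \<le> K * ((norm (y 0))\<^sup>2 + integral {0..x} (\<lambda>t. (norm (g t))\<^sup>2))"
    by (rule solution_bound[of "\<bar>Im \<zeta>\<bar>"]) blast
  show "y x = 0"
  proof (cases "x \<in> {0..1}")
    case True then show ?thesis using K[OF assms(1) True] assms(2) by simp
  next
    case False then show ?thesis using sol_C01[OF assms(1)] unfolding C01_def by simp
  qed
qed

lemma sol_unique: assumes "sol \<zeta> g y" "sol \<zeta> g z" "y 0 = z 0" shows "y = z"
proof -
  have "(\<lambda>x. y x - z x) = (\<lambda>x. 0)"
    using sol_diff[OF assms(1,2)] assms(3) by (intro sol_zero_unique) auto
  then show ?thesis by (simp add: fun_eq_iff)
qed

text \<open>The integral equation reads z = u0 + W z, with initial value and forcing collected in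
  \<open>u0\<close> and the linear Volterra part in \<open>W\<close>, and is solved by the Neumann
  series. Cauchy-Schwarz with the square integrable coefficient bound \<open>q\<close> supplies the
  estimate that the series needs.\<close>

lemma sol_exists:
  assumes g: "g \<in> L2" obtains y where "sol \<zeta> g y" "y 0 = c"
proof -
  define W where "W = (\<lambda>u x. if x \<in> {0..1} then integral {0..x} (vfield \<zeta> (\<lambda>x. 0) u) else 0)"
  define u0 where "u0 = (\<lambda>x. if x \<in> {0..1} then c + integral {0..x} (vfield \<zeta> g (\<lambda>x. 0)) else 0)"
  have z2: "(\<lambda>x. 0) \<in> L2" using L2_zero by (simp add: zero_fun_def)
  have cont: "(\<lambda>x. if x \<in> {0..1} then d + integral {0..x} (vfield \<zeta> g u) else 0) \<in> C01" if "g \<in> L2" "u \<in> C01" for g u d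
  proof -
    have "continuous_on {0..1} (\<lambda>x. d + integral {0..x} (vfield \<zeta> g u))"
      by (intro continuous_intros L2_continuous_on_integral vfield_L2 that)
    moreover have "continuous_on {0..1} (\<lambda>x. if x \<in> {0..1} then d + integral {0..x} (vfield \<zeta> g u) else 0) \<longleftrightarrow> continuous_on {0..1} (\<lambda>x. d + integral {0..x} (vfield \<zeta> g u))"
      by (rule continuous_on_cong) auto
    ultimately show ?thesis by (simp add: C01_def)
  qed
  have W: "W u \<in> C01" if "u \<in> C01" for u using cont[OF z2 that, of 0] unfolding W_def add_0 .
  have u0: "u0 \<in> C01" unfolding u0_def by (rule cont[OF g C01_zero])
  define q where "q = (\<lambda>t. (cmod \<zeta> + norm (Q t)))"
  have q2: "q \<in> L2" unfolding q_def by (intro L2_add L2_const L2_norm_fun Q_L2)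
  define n where "n = real CARD('n) * asum"
  have n0: "n \<ge> 0" unfolding n_def using asum_nonneg by simp
  define K where "K = n\<^sup>2 * integral {0..1} (\<lambda>t. (q t)\<^sup>2)"
  have q2i: "(\<lambda>t. (q t)\<^sup>2) integrable_on {0..x}" if "x \<le> 1" for x
    using L2_sq_integrable_on[OF q2, of 0 x] that by simp
  have K: "K \<ge> 0" unfolding K_def using q2i[of 1] by (intro mult_nonneg_nonneg integral_nonneg) auto
  have bound: "(norm (W u x))\<^sup>2 \<le> K * integral {0..x} (\<lambda>t. (norm (u t))\<^sup>2)" if u: "u \<in> C01" and x: "x \<in> {0..1}" for u x
  proof -
    have nu: "(\<lambda>t. norm (u t)) \<in> L2" by (intro L2_norm_fun C01_L2 u)
    have qu: "(\<lambda>t. q t * norm (u t)) integrable_on {0..x}"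
      by (rule integrable_on_subinterval[of _ "{0..1}"], rule set_lebesgue_integral_eq_integral(1),
          rule L2_mult_absolutely_integrable[OF q2 nu]) (use x in auto)
    have pt: "norm (vfield \<zeta> (\<lambda>x. 0) u t) \<le> n * (q t * norm (u t))" for t
    proof -
      have "norm (vfield \<zeta> (\<lambda>x. 0) u t) \<le> (\<Sum>i\<in>UNIV. norm (vfield \<zeta> (\<lambda>x. 0) u t $ i))" by (rule norm_vec_le_sum)
      also have "\<dots> \<le> (\<Sum>i\<in>(UNIV::'n set). asum * (q t * norm (u t)))"
      proof (rule sum_mono)
        fix i :: 'n
        have "norm (vfield \<zeta> (\<lambda>x. 0) u t $ i) = \<bar>a i\<bar> * norm (\<zeta> * u t $ i - (Q t *v u t) $ i)"
          by (simp add: vfield_def norm_mult)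
        also have "\<dots> \<le> asum * (q t * norm (u t))"
        proof (intro mult_mono asum_ge asum_nonneg)
          have "norm (\<zeta> * u t $ i - (Q t *v u t) $ i) \<le> norm (\<zeta> * u t $ i) + norm ((Q t *v u t) $ i)" by (rule norm_triangle_ineq4)
          also have "\<dots> \<le> cmod \<zeta> * norm (u t) + norm (Q t) * norm (u t)"
            unfolding norm_mult by (intro add_mono mult_left_mono Finite_Cartesian_Product.norm_nth_le norm_matrix_vector_mult_component) auto
          finally show "norm (\<zeta> * u t $ i - (Q t *v u t) $ i) \<le> q t * norm (u t)" by (simp add: q_def algebra_simps)
        qed auto
        finally show "norm (vfield \<zeta> (\<lambda>x. 0) u t $ i) \<le> asum * (q t * norm (u t))" .
      qed
      finally show ?thesis by (simp add: n_def)
    qed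
    have "norm (W u x) \<le> integral {0..x} (\<lambda>t. n * (q t * norm (u t)))"
    proof -
      have "norm (integral {0..x} (vfield \<zeta> (\<lambda>x. 0) u)) \<le> integral {0..x} (\<lambda>t. n * (q t * norm (u t)))"
        using x by (intro integral_norm_bound_integral L2_integrable_on vfield_L2 z2 u integrable_on_mult_right qu pt) auto
      then show ?thesis unfolding W_def using x by simp
    qed
    then have "norm (W u x) \<le> n * integral {0..x} (\<lambda>t. q t * norm (u t))" by simp
    then have "(norm (W u x))\<^sup>2 \<le> (n * integral {0..x} (\<lambda>t. q t * norm (u t)))\<^sup>2"
      by (intro power_mono) auto
    also have "\<dots> \<le> n\<^sup>2 * (integral {0..x} (\<lambda>t. (q t)\<^sup>2) * integral {0..x} (\<lambda>t. (norm (u t))\<^sup>2))"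
      unfolding power_mult_distrib using x L2_sq_integrable_on[OF C01_L2[OF u], of 0 x]
      by (intro mult_left_mono integral_Cauchy_Schwarz q2i qu) auto
    also have "\<dots> \<le> n\<^sup>2 * (integral {0..1} (\<lambda>t. (q t)\<^sup>2) * integral {0..x} (\<lambda>t. (norm (u t))\<^sup>2))"
      using x L2_sq_integrable_on[OF C01_L2[OF u], of 0 x]
      by (intro mult_left_mono mult_right_mono integral_subset_le integral_nonneg q2i) auto
    finally show ?thesis by (simp add: K_def mult.assoc)
  qed
  have add: "W (\<lambda>x. u x + v x) = (\<lambda>x. W u x + W v x)" if "u \<in> C01" "v \<in> C01" for u v
  proof
    fix x show "W (\<lambda>x. u x + v x) x = W u x + W v x"
    proof (cases "x \<in> {0..1}")
      case True
      have "integral {0..x} (vfield \<zeta> (\<lambda>x. 0) u) + integral {0..x} (vfield \<zeta> (\<lambda>x. 0) v) = integral {0..x} (\<lambda>t. vfield \<zeta> (\<lambda>x. 0) u t + vfield \<zeta> (\<lambda>x. 0) v t)"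
        using True that by (intro Henstock_Kurzweil_Integration.integral_add[symmetric] L2_integrable_on vfield_L2 z2) auto
      also have "(\<lambda>t. vfield \<zeta> (\<lambda>x. 0) u t + vfield \<zeta> (\<lambda>x. 0) v t) = vfield \<zeta> (\<lambda>x. 0) (\<lambda>x. u x + v x)"
        by (simp add: fun_eq_iff vec_eq_iff vfield_def matrix_vector_right_distrib algebra_simps)
      finally show ?thesis using True by (simp add: W_def)
    qed (auto simp: W_def)
  qed
  have smult: "W (\<lambda>x. d *s u x) = (\<lambda>x. d *s W u x)" if "u \<in> C01" for d u
  proof
    fix x show "W (\<lambda>x. d *s u x) x = d *s W u x"
    proof (cases "x \<in> {0..1}")
      case True
      have "d *s integral {0..x} (vfield \<zeta> (\<lambda>x. 0) u) = integral {0..x} ((\<lambda>v. d *s v) \<circ> vfield \<zeta> (\<lambda>x. 0) u)"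
        using True that by (intro integral_linear[symmetric] bounded_linear_smult_cvec L2_integrable_on vfield_L2 z2) auto
      also have "((\<lambda>v. d *s v) \<circ> vfield \<zeta> (\<lambda>x. 0) u) = vfield \<zeta> (\<lambda>x. 0) (\<lambda>x. d *s u x)"
        by (simp add: fun_eq_iff vec_eq_iff vfield_def vector_scalar_commute algebra_simps)
      finally show ?thesis using True by (simp add: W_def)
    qed (auto simp: W_def)
  qed
  obtain z where z: "z \<in> C01" "z = (\<lambda>x. u0 x + W z x)"
    using Volterra_Neumann_series[OF W add smult K bound u0] by blast
  have zx: "z x = c + integral {0..x} (vfield \<zeta> g z)" if x: "x \<in> {0..1}" for x
  proof -
    have "integral {0..x} (vfield \<zeta> g (\<lambda>x. 0)) + integral {0..x} (vfield \<zeta> (\<lambda>x. 0) z) = integral {0..x} (\<lambda>t. vfield \<zeta> g (\<lambda>x. 0) t + vfield \<zeta> (\<lambda>x. 0) z t)"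
      using x by (intro Henstock_Kurzweil_Integration.integral_add[symmetric] L2_integrable_on vfield_L2 z2 g z C01_zero) auto
    also have "(\<lambda>t. vfield \<zeta> g (\<lambda>x. 0) t + vfield \<zeta> (\<lambda>x. 0) z t) = vfield \<zeta> g z"
      by (simp add: fun_eq_iff vec_eq_iff vfield_def algebra_simps)
    finally have I: "integral {0..x} (vfield \<zeta> g (\<lambda>x. 0)) + integral {0..x} (vfield \<zeta> (\<lambda>x. 0) z) = integral {0..x} (vfield \<zeta> g z)" .
    have "z x = u0 x + W z x" using z(2) by (rule fun_cong)
    then show ?thesis using x I by (simp add: u0_def W_def add.assoc)
  qed
  have z0: "z 0 = c" using zx[of 0] by simp
  have "sol \<zeta> g z" unfolding sol_def z0 using z(1) g zx by blast
  then show ?thesis using z0 that by blast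
qed

definition S :: "complex \<Rightarrow> complex^'n \<Rightarrow> (real \<Rightarrow> complex^'n) \<Rightarrow> real \<Rightarrow> complex^'n" where
  "S \<zeta> c g = (THE y. sol \<zeta> g y \<and> y 0 = c)"

lemma assumes "g \<in> L2" shows S_sol: "sol \<zeta> g (S \<zeta> c g)" and S_init: "S \<zeta> c g 0 = c"
proof -
  have "\<exists>!y. sol \<zeta> g y \<and> y 0 = c" using sol_exists[OF assms] sol_unique by metis
  from theI'[OF this] show "sol \<zeta> g (S \<zeta> c g)" "S \<zeta> c g 0 = c" unfolding S_def by auto
qed

lemma S_unique: "sol \<zeta> g y \<Longrightarrow> S \<zeta> (y 0) g = y"
  using sol_unique S_sol S_init sol_L2 by metis

lemma S_C01: "g \<in> L2 \<Longrightarrow> S \<zeta> c g \<in> C01" using S_sol sol_C01 by blast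

end


lemma bounded_functional_sum_smult:
  assumes "finite A" "\<And>i. i \<in> A \<Longrightarrow> bounded_functional (l i)"
  shows "bounded_functional (\<lambda>u. \<Sum>i\<in>A. c i * l i u)"
  using assms
proof (induction A rule: finite_induct)
  case empty
  show ?case unfolding bounded_functional_def by (auto intro!: exI[of _ 0])
next
  case (insert i A)
  let ?s = "\<lambda>u. \<Sum>i\<in>A. c i * l i u"
  have li: "bounded_functional (l i)" and ls: "bounded_functional ?s" using insert by auto
  obtain K where K: "\<And>u m. u \<in> C01 \<Longrightarrow> (\<And>x. x \<in> {0..1} \<Longrightarrow> norm (u x) \<le> m) \<Longrightarrow> norm (l i u) \<le> K * m"
    using bounded_functional_bound[OF li] by blast
  obtain K' where K': "\<And>u m. u \<in> C01 \<Longrightarrow> (\<And>x. x \<in> {0..1} \<Longrightarrow> norm (u x) \<le> m) \<Longrightarrow> norm (?s u) \<le> K' * m"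
    using bounded_functional_bound[OF ls] by blast
  have "norm (c i * l i u + ?s u) \<le> (norm (c i) * K + K') * m" if "u \<in> C01" "\<forall>x\<in>{0..1}. norm (u x) \<le> m" for u m
  proof -
    have "norm (c i * l i u + ?s u) \<le> norm (c i * l i u) + norm (?s u)" by (rule norm_triangle_ineq)
    also have "\<dots> \<le> norm (c i) * (K * m) + K' * m"
      unfolding norm_mult by (intro add_mono mult_left_mono K K') (use that in auto)
    finally show ?thesis by (simp add: algebra_simps)
  qed
  moreover have "c i * l i (\<lambda>x. u x + v x) + ?s (\<lambda>x. u x + v x) = (c i * l i u + ?s u) + (c i * l i v + ?s v)" if "u \<in> C01" "v \<in> C01" for u v
    using bounded_functional_add[OF li that] bounded_functional_add[OF ls that] by (simp add: algebra_simps)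
  moreover have "c i * l i (\<lambda>x. d *s u x) + ?s (\<lambda>x. d *s u x) = d * (c i * l i u + ?s u)" if "u \<in> C01" for u d
    using bounded_functional_smult[OF li that] bounded_functional_smult[OF ls that] by (simp add: algebra_simps)
  ultimately show ?case unfolding bounded_functional_def using insert.hyps by (simp; blast)
qed

lemma bounded_functional_lincomb:
  assumes l: "bounded_functional l" and "finite A" "\<And>i. i \<in> A \<Longrightarrow> u i \<in> C01"
  shows "l (\<lambda>x. \<Sum>i\<in>A. c i *s u i x) = (\<Sum>i\<in>A. c i * l (u i))"
  using bounded_functional_sum[OF l assms(2), of "\<lambda>i x. c i *s u i x"] assms(3)
  by (simp add: C01_smult bounded_functional_smult[OF l])

lemma matrix_vector_mult_sum:
  fixes A :: "complex^'n^'m"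
  assumes "finite I" shows "A *v (\<Sum>i\<in>I. v i) = (\<Sum>i\<in>I. A *v v i)"
  using assms by (induction I rule: finite_induct) (simp_all add: matrix_vector_right_distrib)

section \<open>Expansion of solutions in the spectral parameter\<close>

context dirac_system
begin

lemma L2_zero_fun: "(\<lambda>x. 0 :: complex^'n) \<in> L2" by (rule L2_const)

lemma S_add: "g \<in> L2 \<Longrightarrow> h \<in> L2 \<Longrightarrow> S \<zeta> (c + d) (\<lambda>x. g x + h x) = (\<lambda>x. S \<zeta> c g x + S \<zeta> d h x)"
  using S_unique[OF sol_add[OF S_sol[of g \<zeta> c] S_sol[of h \<zeta> d]]] S_init[of g \<zeta> c] S_init[of h \<zeta> d] by simp

lemma S_smult: "g \<in> L2 \<Longrightarrow> S \<zeta> (e *s c) (\<lambda>x. e *s g x) = (\<lambda>x. e *s S \<zeta> c g x)"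
  using S_unique[OF sol_smult[OF S_sol[of g \<zeta> c]]] S_init[of g \<zeta> c] by simp

text \<open>The inverse of L - \<mu> under the initial condition y 0 = 0. Its powers produce the
  Taylor coefficients of solutions in the spectral parameter.\<close>

definition T :: "complex \<Rightarrow> (real \<Rightarrow> complex^'n) \<Rightarrow> real \<Rightarrow> complex^'n" where
  "T \<mu> g = S \<mu> 0 g"

lemma T_sol: "g \<in> L2 \<Longrightarrow> sol \<mu> g (T \<mu> g)" and T_init: "g \<in> L2 \<Longrightarrow> T \<mu> g 0 = 0"
  and T_C01: "g \<in> L2 \<Longrightarrow> T \<mu> g \<in> C01"
  by (simp_all add: T_def S_sol S_init S_C01)

lemma T_add: "g \<in> L2 \<Longrightarrow> h \<in> L2 \<Longrightarrow> T \<mu> (\<lambda>x. g x + h x) = (\<lambda>x. T \<mu> g x + T \<mu> h x)"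
  unfolding T_def using S_add[of g h \<mu> 0 0] by simp

lemma T_smult: "g \<in> L2 \<Longrightarrow> T \<mu> (\<lambda>x. e *s g x) = (\<lambda>x. e *s T \<mu> g x)"
  unfolding T_def using S_smult[of g \<mu> e 0] by simp

lemma T_iter_C01: "u \<in> C01 \<Longrightarrow> (T \<mu> ^^ j) u \<in> C01"
  by (induction j) (auto intro: T_C01 C01_L2)

lemma T_bound:
  obtains K where "K \<ge> 0" "\<And>u x. u \<in> L2 \<Longrightarrow> x \<in> {0..1} \<Longrightarrow> (norm (T \<mu> u x))\<^sup>2 \<le> K * integral {0..x} (\<lambda>t. (norm (u t))\<^sup>2)"
proof -
  obtain K where K: "K \<ge> 0" "\<And>g y x. sol \<mu> g y \<Longrightarrow> x \<in> {0..1} \<Longrightarrow>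
    (norm (y x))\<^sup>2 \<le> K * ((norm (y 0))\<^sup>2 + integral {0..x} (\<lambda>t. (norm (g t))\<^sup>2))"
    by (rule solution_bound[of "\<bar>Im \<mu>\<bar>"]) blast
  have "(norm (T \<mu> u x))\<^sup>2 \<le> K * integral {0..x} (\<lambda>t. (norm (u t))\<^sup>2)" if "u \<in> L2" "x \<in> {0..1}" for u x
    using K(2)[OF T_sol[OF that(1)] that(2)] T_init[OF that(1), of \<mu>] by simp
  then show ?thesis using that K(1) by blast
qed

text \<open>By the shift of the parameter the solution at \<mu> + z satisfies y = S \<mu> c g + z T
  \<mu> y. Its Neumann series is a power series in z with explicit coefficients, convergent for
  every z.\<close>

lemma S_expansion:
  assumes g: "g \<in> L2" and l: "bounded_functional l"
  shows "(\<lambda>j. l ((T \<mu> ^^ j) (S \<mu> c g)) * z ^ j) sums l (S (\<mu> + z) c g)"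
proof -
  define W where "W = (\<lambda>u x. z *s T \<mu> u x)"
  let ?u = "S \<mu> c g"
  have u: "?u \<in> C01" by (rule S_C01[OF g])
  obtain K where K: "K \<ge> 0" "\<And>u x. u \<in> L2 \<Longrightarrow> x \<in> {0..1} \<Longrightarrow> (norm (T \<mu> u x))\<^sup>2 \<le> K * integral {0..x} (\<lambda>t. (norm (u t))\<^sup>2)"
    using T_bound by blast
  have W: "W v \<in> C01" if "v \<in> C01" for v unfolding W_def by (intro C01_smult T_C01 C01_L2 that)
  have add: "W (\<lambda>x. v x + w x) = (\<lambda>x. W v x + W w x)" if "v \<in> C01" "w \<in> C01" for v w
    using that by (simp add: W_def T_add C01_L2 vec.scale_right_distrib)
  have smult: "W (\<lambda>x. d *s v x) = (\<lambda>x. d *s W v x)" if "v \<in> C01" for d v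
    using that by (simp add: W_def T_smult C01_L2 vector_smult_assoc mult.commute)
  have bound: "(norm (W v x))\<^sup>2 \<le> ((norm z)\<^sup>2 * K) * integral {0..x} (\<lambda>t. (norm (v t))\<^sup>2)" if "v \<in> C01" "x \<in> {0..1}" for v x
  proof -
    have "norm (z *s w) = norm z * norm w" for w :: "complex^'n"
      by (simp add: norm_vec_def L2_set_right_distrib norm_mult)
    then show ?thesis
      using mult_left_mono[OF K(2)[OF C01_L2[OF that(1)] that(2)], of "(norm z)\<^sup>2"]
      by (simp add: W_def power_mult_distrib mult.assoc)
  qed
  have "(norm z)\<^sup>2 * K \<ge> 0" using K by simp
  from Volterra_Neumann_series[OF W add smult this bound u]
  obtain y where y: "y \<in> C01" "y = (\<lambda>x. ?u x + W y x)" "\<And>l. bounded_functional l \<Longrightarrow> (\<lambda>j. l ((W ^^ j) ?u)) sums l y"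
    by blast
  have it: "(W ^^ j) ?u = (\<lambda>x. z ^ j *s (T \<mu> ^^ j) ?u x)" for j
  proof (induction j)
    case (Suc j)
    have "W (\<lambda>x. z ^ j *s (T \<mu> ^^ j) ?u x) = (\<lambda>x. z ^ j *s W ((T \<mu> ^^ j) ?u) x)"
      by (rule smult[OF T_iter_C01[OF u]])
    then show ?case using Suc by (simp add: W_def vector_smult_assoc mult.commute)
  qed simp
  have "sol \<mu> (\<lambda>x. g x + z *s y x) (\<lambda>x. ?u x + z *s T \<mu> y x)"
    by (intro sol_add sol_smult S_sol T_sol g C01_L2 y)
  then have "sol \<mu> (\<lambda>x. g x + ((\<mu> + z) - \<mu>) *s y x) y" using y(2) by (simp add: W_def)
  then have "sol (\<mu> + z) g y" using sol_shift[OF y(1), of "\<mu> + z" g \<mu>] by simp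
  moreover have "y 0 = c" using fun_cong[OF y(2), of 0] T_init[OF C01_L2[OF y(1)]] S_init[OF g] by (simp add: W_def)
  ultimately have "S (\<mu> + z) c g = y" using S_unique by blast
  then show ?thesis using y(3)[OF l] unfolding it
    by (simp add: bounded_functional_smult[OF l T_iter_C01[OF u]] mult.commute)
qed

lemma S_fps_expansion:
  assumes "g \<in> L2" "bounded_functional l"
  shows "(\<lambda>z. l (S (\<mu> + z) c g)) has_fps_expansion Abs_fps (\<lambda>j. l ((T \<mu> ^^ j) (S \<mu> c g)))"
  by (rule has_fps_expansionI) (auto intro!: always_eventually S_expansion assms)

lemma S_entire:
  assumes "g \<in> L2" "bounded_functional l"
  shows "(\<lambda>\<zeta>. l (S \<zeta> c g)) holomorphic_on A"
proof -
  have "(\<lambda>\<zeta>. l (S \<zeta> c g)) analytic_on {\<mu>}" for \<mu>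
    by (rule has_fps_expansion_imp_analytic[OF S_fps_expansion[OF assms]])
  then have "(\<lambda>\<zeta>. l (S \<zeta> c g)) analytic_on A" using analytic_on_analytic_at by blast
  then show ?thesis by (rule analytic_imp_holomorphic)
qed

text \<open>The columns of the fundamental matrix that equals the identity at 0.\<close>

definition Phi :: "complex \<Rightarrow> 'n \<Rightarrow> real \<Rightarrow> complex^'n" where
  "Phi \<zeta> k = S \<zeta> (axis k 1) (\<lambda>x. 0)"

lemma Phi_sol: "sol \<zeta> (\<lambda>x. 0) (Phi \<zeta> k)" and Phi_init: "Phi \<zeta> k 0 = axis k 1" and Phi_C01: "Phi \<zeta> k \<in> C01"
  unfolding Phi_def by (simp_all add: S_sol S_init S_C01 L2_zero_fun)

lemma sol_sum:
  assumes "finite A" "\<And>i. i \<in> A \<Longrightarrow> sol \<zeta> (g i) (y i)"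
  shows "sol \<zeta> (\<lambda>x. \<Sum>i\<in>A. g i x) (\<lambda>x. \<Sum>i\<in>A. y i x)"
  using assms
proof (induction A rule: finite_induct)
  case empty
  have "vfield \<zeta> (\<lambda>x. 0) (\<lambda>x. 0) = (\<lambda>x. 0)" by (simp add: vfield_def fun_eq_iff vec_eq_iff)
  then show ?case by (simp add: sol_def L2_zero_fun C01_zero)
qed (simp add: sol_add)

lemma S_decompose:
  assumes "g \<in> L2" shows "S \<zeta> c g = (\<lambda>x. T \<zeta> g x + (\<Sum>k\<in>UNIV. c $ k *s Phi \<zeta> k x))"
proof -
  have s: "sol \<zeta> (\<lambda>x. g x + (\<Sum>k\<in>UNIV. c $ k *s 0)) (\<lambda>x. T \<zeta> g x + (\<Sum>k\<in>UNIV. c $ k *s Phi \<zeta> k x))"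
    by (intro sol_add T_sol assms sol_sum sol_smult Phi_sol) simp
  have "T \<zeta> g 0 + (\<Sum>k\<in>UNIV. c $ k *s Phi \<zeta> k 0) = c"
    using basis_expansion[of c] by (simp add: T_init[OF assms] Phi_init)
  with S_unique[OF s] show ?thesis by simp
qed

lemma functional_S:
  assumes g: "g \<in> L2" and l: "bounded_functional l"
  shows "l (S \<zeta> c g) = l (T \<zeta> g) + (\<Sum>k\<in>UNIV. c $ k * l (Phi \<zeta> k))"
proof -
  have "(\<lambda>x. \<Sum>k\<in>UNIV. c $ k *s Phi \<zeta> k x) \<in> C01" by (intro C01_sum C01_smult Phi_C01) simp
  then show ?thesis
    unfolding S_decompose[OF g] bounded_functional_add[OF l T_C01[OF g]]
    by (simp add: bounded_functional_add[OF l T_C01[OF g]] bounded_functional_lincomb[OF l _ Phi_C01])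
qed

end

section \<open>Boundary form, characteristic determinant and resolvent\<close>

locale boundary_problem = dirac_system a Q for a :: "'n::finite \<Rightarrow> real" and Q +
  fixes C D :: "complex^'n^'n"
begin

definition bd :: "(real \<Rightarrow> complex^'n) \<Rightarrow> complex^'n" where
  "bd y = C *v y 0 + D *v y 1"

lemma bounded_functional_bd: "bounded_functional (\<lambda>y. bd y $ i)"
proof -
  have "bounded_functional (\<lambda>u. \<Sum>p\<in>(UNIV::'n set)\<times>{0,1::real}. (if snd p = 0 then C $ i $ fst p else D $ i $ fst p) * (u (snd p) $ fst p))"
    by (rule bounded_functional_sum_smult) (auto intro!: bounded_functional_eval)
  moreover have "(\<Sum>p\<in>(UNIV::'n set)\<times>{0,1::real}. (if snd p = 0 then C $ i $ fst p else D $ i $ fst p) * (u (snd p) $ fst p)) = bd u $ i" for u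
    by (simp add: sum.cartesian_product' bd_def matrix_vector_mult_def sum.distrib)
  ultimately show ?thesis by simp
qed

text \<open>This is C + D \<Phi>(1, \<zeta>): it sends an initial value to the boundary form of the
  homogeneous solution.\<close>

definition M :: "complex \<Rightarrow> complex^'n^'n" where "M \<zeta> = (\<chi> i k. bd (Phi \<zeta> k) $ i)"

definition \<Delta> :: "complex \<Rightarrow> complex" where "\<Delta> \<zeta> = det (M \<zeta>)"

text \<open>Entry (k, j) of the adjugate of \<open>M \<zeta>\<close>, written by Cramer's rule. As a
  polynomial in the entries of \<open>M\<close> it is entire and bounded on strips, which the
  inverse matrix need not be.\<close>

definition Adj :: "complex \<Rightarrow> 'n \<Rightarrow> 'n \<Rightarrow> complex" where
  "Adj \<zeta> k j = det (\<chi> r s. if s = k then axis j 1 $ r else M \<zeta> $ r $ s)"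

lemma bd_S: assumes "g \<in> L2" shows "bd (S \<zeta> c g) = bd (T \<zeta> g) + M \<zeta> *v c"
proof -
  have "bd (S \<zeta> c g) $ i = (bd (T \<zeta> g) + M \<zeta> *v c) $ i" for i
    unfolding functional_S[OF assms bounded_functional_bd]
    by (simp add: M_def matrix_vector_mult_def mult.commute)
  then show ?thesis by (simp add: vec_eq_iff)
qed

lemma M_inverse:
  assumes "\<Delta> \<zeta> \<noteq> 0"
  shows "M \<zeta> *v c = d \<longleftrightarrow> c = (\<chi> k. (\<Sum>j\<in>UNIV. Adj \<zeta> k j * d $ j) / \<Delta> \<zeta>)"
proof -
  define X where "X = (\<lambda>j. \<chi> k. Adj \<zeta> k j / \<Delta> \<zeta>)"
  have X: "M \<zeta> *v X j = axis j 1" for j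
    using cramer[of "M \<zeta>" "X j" "axis j 1"] assms by (simp add: X_def Adj_def \<Delta>_def)
  have "M \<zeta> *v (\<chi> k. (\<Sum>j\<in>UNIV. Adj \<zeta> k j * d $ j) / \<Delta> \<zeta>) = M \<zeta> *v (\<Sum>j\<in>UNIV. d $ j *s X j)"
    by (rule arg_cong[of _ _ "(*v) (M \<zeta>)"]) (simp add: X_def vec_eq_iff sum_divide_distrib mult.commute)
  also have "\<dots> = (\<Sum>j\<in>UNIV. d $ j *s (M \<zeta> *v X j))"
    by (simp add: matrix_vector_mult_sum vector_scalar_commute)
  also have "\<dots> = d" unfolding X by (rule basis_expansion)
  finally have 1: "M \<zeta> *v (\<chi> k. (\<Sum>j\<in>UNIV. Adj \<zeta> k j * d $ j) / \<Delta> \<zeta>) = d" .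
  have "invertible (M \<zeta>)" using assms by (simp add: \<Delta>_def invertible_det_nz)
  then have inj: "inj ((*v) (M \<zeta>))" by (rule inj_matrix_vector_mult)
  show ?thesis
  proof
    assume "M \<zeta> *v c = d"
    then have "M \<zeta> *v c = M \<zeta> *v (\<chi> k. (\<Sum>j\<in>UNIV. Adj \<zeta> k j * d $ j) / \<Delta> \<zeta>)" unfolding 1 .
    then show "c = (\<chi> k. (\<Sum>j\<in>UNIV. Adj \<zeta> k j * d $ j) / \<Delta> \<zeta>)" by (rule injD[OF inj])
  next
    assume "c = (\<chi> k. (\<Sum>j\<in>UNIV. Adj \<zeta> k j * d $ j) / \<Delta> \<zeta>)"
    then show "M \<zeta> *v c = d" using 1 by (simp only:)
  qed
qed

text \<open>The resolvent of the boundary value problem. The initial value is the one whose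
  homogeneous solution cancels the boundary form of the particular solution
  \<open>T \<zeta> h\<close>; it has this meaning only when
  \<open>\<Delta> \<zeta> \<noteq> 0\<close>.\<close>

definition R :: "complex \<Rightarrow> (real \<Rightarrow> complex^'n) \<Rightarrow> real \<Rightarrow> complex^'n" where
  "R \<zeta> h = S \<zeta> (\<chi> k. (\<Sum>j\<in>UNIV. Adj \<zeta> k j * (- bd (T \<zeta> h)) $ j) / \<Delta> \<zeta>) h"

lemma R_sol: "h \<in> L2 \<Longrightarrow> sol \<zeta> h (R \<zeta> h)"
  unfolding R_def by (rule S_sol)

lemma R_C01: "h \<in> L2 \<Longrightarrow> R \<zeta> h \<in> C01" using R_sol sol_C01 by blast

lemma R_bd: assumes "\<Delta> \<zeta> \<noteq> 0" "h \<in> L2" shows "bd (R \<zeta> h) = 0"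
  unfolding R_def bd_S[OF assms(2)] M_inverse[THEN iffD2, OF assms(1) refl] by simp

lemma R_unique:
  assumes "\<Delta> \<zeta> \<noteq> 0" "sol \<zeta> h y" "bd y = 0" shows "y = R \<zeta> h"
proof -
  have h: "h \<in> L2" by (rule sol_L2[OF assms(2)])
  have y: "y = S \<zeta> (y 0) h" using S_unique[OF assms(2)] by simp
  then have "bd (T \<zeta> h) + M \<zeta> *v y 0 = 0" using assms(3) bd_S[OF h] by metis
  then have "M \<zeta> *v y 0 = - bd (T \<zeta> h)" by (metis add_eq_0_iff)
  then show ?thesis using y unfolding M_inverse[OF assms(1)] R_def by metis
qed

text \<open>The functional applied to the resolvent, with the denominator \<open>\<Delta>\<close>
  cleared.\<close>

definition G :: "((real \<Rightarrow> complex^'n) \<Rightarrow> complex) \<Rightarrow> (real \<Rightarrow> complex^'n) \<Rightarrow> complex \<Rightarrow> complex" where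
  "G l h \<zeta> = \<Delta> \<zeta> * l (T \<zeta> h) - (\<Sum>k\<in>UNIV. (\<Sum>j\<in>UNIV. Adj \<zeta> k j * bd (T \<zeta> h) $ j) * l (Phi \<zeta> k))"

lemma l_R:
  assumes "h \<in> L2" "bounded_functional l" "\<Delta> \<zeta> \<noteq> 0"
  shows "l (R \<zeta> h) = G l h \<zeta> / \<Delta> \<zeta>"
proof -
  have "l (R \<zeta> h) = l (T \<zeta> h) + (\<Sum>k\<in>UNIV. (\<Sum>j\<in>UNIV. Adj \<zeta> k j * (- bd (T \<zeta> h)) $ j) / \<Delta> \<zeta> * l (Phi \<zeta> k))"
    unfolding R_def functional_S[OF assms(1,2)] by simp
  then show ?thesis using assms(3)
    by (simp add: G_def diff_divide_distrib sum_negf sum_divide_distrib[symmetric])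
qed

lemma holomorphic_M: "(\<lambda>\<zeta>. M \<zeta> $ i $ k) holomorphic_on A"
  unfolding M_def Phi_def by (simp add: S_entire[OF L2_zero_fun bounded_functional_bd])

lemma holomorphic_det:
  fixes A :: "complex \<Rightarrow> complex^'n^'n"
  assumes "\<And>i j. (\<lambda>\<zeta>. A \<zeta> $ i $ j) holomorphic_on X"
  shows "(\<lambda>\<zeta>. det (A \<zeta>)) holomorphic_on X"
  unfolding det_def by (intro holomorphic_intros assms)

lemma holomorphic_\<Delta>: "\<Delta> holomorphic_on A"
  unfolding \<Delta>_def[abs_def] by (intro holomorphic_det holomorphic_M)

lemma holomorphic_Adj: "(\<lambda>\<zeta>. Adj \<zeta> k j) holomorphic_on A"
  unfolding Adj_def
proof (rule holomorphic_det)
  fix r s show "(\<lambda>\<zeta>. (\<chi> r s. if s = k then axis j 1 $ r else M \<zeta> $ r $ s) $ r $ s) holomorphic_on A"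
    by (cases "s = k") (simp_all add: holomorphic_M)
qed

lemma holomorphic_G: "h \<in> L2 \<Longrightarrow> bounded_functional l \<Longrightarrow> G l h holomorphic_on A"
  unfolding G_def[abs_def] T_def Phi_def
  by (intro holomorphic_intros holomorphic_\<Delta> holomorphic_Adj S_entire bounded_functional_bd L2_zero_fun)

end


section \<open>Principal parts of the resolvent\<close>

lemma has_fps_expansion_eventually_zero:
  fixes f :: "complex \<Rightarrow> complex"
  assumes "f has_fps_expansion F" "eventually (\<lambda>z. f z = 0) (at 0)"
  shows "F = 0"
proof -
  \<comment> \<open>The second hypothesis says nothing about the value at 0; the factor z makes the
    product vanish there too.\<close>
  have "(\<lambda>z. z * f z) has_fps_expansion fps_X * F"
    by (intro fps_expansion_intros assms)
  moreover have "eventually (\<lambda>z. z * f z = 0) (nhds 0)"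
    using assms(2) by (auto simp: eventually_at_filter elim: eventually_mono)
  then have "(\<lambda>z. z * f z) has_fps_expansion 0" by (simp add: has_fps_expansion_0_iff)
  ultimately have "fps_X * F = 0" by (rule fps_expansion_unique_complex)
  then show ?thesis by simp
qed

context boundary_problem
begin

lemma eventually_\<Delta>_nonzero:
  assumes "\<Delta> \<zeta>\<^sub>0 \<noteq> 0"
  shows "eventually (\<lambda>z. \<Delta> (\<mu> + z) \<noteq> 0) (at 0)"
proof -
  have "\<Delta> holomorphic_on UNIV" by (rule holomorphic_\<Delta>)
  from non_zero_neighbour_alt[OF this _ _ _ _ assms, of \<mu>]
  have "eventually (\<lambda>w. \<Delta> w \<noteq> 0) (at \<mu>)" by (auto elim: eventually_mono)
  then show ?thesis by (subst (asm) at_to_0) (simp add: eventually_filtermap add.commute)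
qed

text \<open>The order of the zero of \<open>\<Delta>\<close> at \<mu>. It bounds the order of the
  pole of the resolvent, and an upper bound suffices; the true order may be smaller.\<close>

definition pole_order :: "complex \<Rightarrow> nat" where
  "pole_order \<mu> = subdegree (fps_expansion \<Delta> \<mu>)"

text \<open>Taylor coefficients at \<mu> of z^m times an entry of the inverse of \<open>M\<close>,
  with m the pole order. The factor z^m makes the division by the series of \<open>\<Delta>\<close>
  exact.\<close>

definition adj_coeff :: "complex \<Rightarrow> 'n \<Rightarrow> 'n \<Rightarrow> complex fps" where
  "adj_coeff \<mu> k j = (fps_X ^ pole_order \<mu> * fps_expansion (\<lambda>\<zeta>. Adj \<zeta> k j) \<mu>) / fps_expansion \<Delta> \<mu>"

text \<open>The value \<open>e\<close> stands in at z = 0, where the quotient may read 0 / 0. A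
  vanishing numerator is treated apart because the subdegree of the zero series is 0 by
  convention.\<close>

lemma adj_fps_expansion:
  assumes "\<Delta> \<zeta>\<^sub>0 \<noteq> 0"
  shows "\<exists>e. (\<lambda>z. if z = 0 then e else z ^ pole_order \<mu> * Adj (\<mu> + z) k j / \<Delta> (\<mu> + z)) has_fps_expansion adj_coeff \<mu> k j"
proof -
  have D: "(\<lambda>z. \<Delta> (\<mu> + z)) has_fps_expansion fps_expansion \<Delta> \<mu>"
    by (rule analytic_at_imp_has_fps_expansion) (metis UNIV_I analytic_at holomorphic_\<Delta> open_UNIV)
  have A: "(\<lambda>z. Adj (\<mu> + z) k j) has_fps_expansion fps_expansion (\<lambda>\<zeta>. Adj \<zeta> k j) \<mu>"
    by (rule analytic_at_imp_has_fps_expansion) (metis UNIV_I analytic_at holomorphic_Adj open_UNIV)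
  have nz: "fps_expansion \<Delta> \<mu> \<noteq> 0"
  proof
    assume "fps_expansion \<Delta> \<mu> = 0"
    then have "eventually (\<lambda>z. \<Delta> (\<mu> + z) = 0) (nhds 0)" using D by (simp add: has_fps_expansion_0_iff)
    then have "eventually (\<lambda>z. \<Delta> (\<mu> + z) = 0) (at 0)" by (auto simp: eventually_at_filter elim: eventually_mono)
    with eventually_\<Delta>_nonzero[OF assms, of \<mu>] have "eventually (\<lambda>z::complex. False) (at 0)"
      by eventually_elim simp
    then show False by simp
  qed
  have N: "(\<lambda>z. z ^ pole_order \<mu> * Adj (\<mu> + z) k j) has_fps_expansion fps_X ^ pole_order \<mu> * fps_expansion (\<lambda>\<zeta>. Adj \<zeta> k j) \<mu>"
    by (intro fps_expansion_intros A)
  have "subdegree (fps_expansion \<Delta> \<mu>) \<le> subdegree (fps_X ^ pole_order \<mu> * fps_expansion (\<lambda>\<zeta>. Adj \<zeta> k j) \<mu>)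
    \<or> fps_X ^ pole_order \<mu> * fps_expansion (\<lambda>\<zeta>. Adj \<zeta> k j) \<mu> = 0"
    by (cases "fps_expansion (\<lambda>\<zeta>. Adj \<zeta> k j) \<mu> = 0") (auto simp: pole_order_def)
  then show ?thesis
  proof
    assume "subdegree (fps_expansion \<Delta> \<mu>) \<le> subdegree (fps_X ^ pole_order \<mu> * fps_expansion (\<lambda>\<zeta>. Adj \<zeta> k j) \<mu>)"
    from has_fps_expansion_divide[OF N D this nz refl] show ?thesis unfolding adj_coeff_def by blast
  next
    assume 0: "fps_X ^ pole_order \<mu> * fps_expansion (\<lambda>\<zeta>. Adj \<zeta> k j) \<mu> = 0"
    then have "eventually (\<lambda>z. z ^ pole_order \<mu> * Adj (\<mu> + z) k j = 0) (nhds 0)" using N by (simp add: has_fps_expansion_0_iff)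
    then have "eventually (\<lambda>z. (if z = 0 then 0 else z ^ pole_order \<mu> * Adj (\<mu> + z) k j / \<Delta> (\<mu> + z)) = 0) (nhds 0)"
      by (auto elim: eventually_mono)
    then show ?thesis using 0 by (intro exI[of _ 0]) (simp add: has_fps_expansion_0_iff adj_coeff_def)
  qed
qed

text \<open>For \<open>p < pole_order \<mu>\<close> the function \<open>residual \<mu> h p\<close> is the coefficient of order \<open>p - pole_order \<mu>\<close> in
  the Laurent expansion of the resolvent applied to \<open>h\<close>. Writing it out in terms of the Taylor coefficients
  \<open>(T \<mu> ^^ s) (Phi \<mu> k)\<close> of the fundamental system shows at once that it has finite rank and is continuous in \<open>h\<close>.\<close>

definition weight :: "complex \<Rightarrow> (real \<Rightarrow> complex^'n) \<Rightarrow> 'n \<Rightarrow> complex fps" where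
  "weight \<mu> h k = (\<Sum>j\<in>UNIV. adj_coeff \<mu> k j * Abs_fps (\<lambda>s. bd ((T \<mu> ^^ s) (T \<mu> h)) $ j))"

definition residual :: "complex \<Rightarrow> (real \<Rightarrow> complex^'n) \<Rightarrow> nat \<Rightarrow> real \<Rightarrow> complex^'n" where
  "residual \<mu> h p = (\<lambda>x. \<Sum>k\<in>UNIV. \<Sum>s\<le>p. (- fps_nth (weight \<mu> h k) (p - s)) *s (T \<mu> ^^ s) (Phi \<mu> k) x)"

lemma residual_C01: "residual \<mu> h p \<in> C01"
  unfolding residual_def by (intro C01_sum C01_smult T_iter_C01 Phi_C01) auto

lemma functional_residual:
  assumes l: "bounded_functional l"
  shows "l (residual \<mu> h p) = - (\<Sum>k\<in>UNIV. \<Sum>s\<le>p. fps_nth (weight \<mu> h k) (p - s) * l ((T \<mu> ^^ s) (Phi \<mu> k)))"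
proof -
  have "(\<lambda>x. \<Sum>s\<le>p. (- fps_nth (weight \<mu> h k) (p - s)) *s (T \<mu> ^^ s) (Phi \<mu> k) x) \<in> C01" for k
    by (intro C01_sum C01_smult T_iter_C01 Phi_C01) auto
  then have "l (residual \<mu> h p) = (\<Sum>k\<in>UNIV. l (\<lambda>x. \<Sum>s\<le>p. (- fps_nth (weight \<mu> h k) (p - s)) *s (T \<mu> ^^ s) (Phi \<mu> k) x))"
    unfolding residual_def by (intro bounded_functional_sum[OF l]) auto
  also have "\<dots> = (\<Sum>k\<in>UNIV. \<Sum>s\<le>p. (- fps_nth (weight \<mu> h k) (p - s)) * l ((T \<mu> ^^ s) (Phi \<mu> k)))"
    by (intro sum.cong refl bounded_functional_lincomb[OF l] T_iter_C01 Phi_C01) auto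
  finally show ?thesis by (simp add: sum_negf)
qed

text \<open>Below order m = \<open>pole_order \<mu>\<close> the particular solution, multiplied by
  z^m, contributes nothing, so only the fundamental system with its weights remains. Dividing by
  z^m, these coefficients make up the principal part of the resolvent.\<close>

lemma resolvent_fps_expansion:
  assumes nz: "\<Delta> \<zeta>\<^sub>0 \<noteq> 0" and h: "h \<in> L2" and l: "bounded_functional l"
  obtains H F where "H has_fps_expansion F"
    "eventually (\<lambda>z. H z = z ^ pole_order \<mu> * l (R (\<mu> + z) h)) (at 0)"
    "\<And>p. p < pole_order \<mu> \<Longrightarrow> fps_nth F p = l (residual \<mu> h p)"
proof -
  let ?m = "pole_order \<mu>"
  define e where "e = (\<lambda>k j. SOME e. (\<lambda>z. if z = 0 then e else z ^ ?m * Adj (\<mu> + z) k j / \<Delta> (\<mu> + z)) has_fps_expansion adj_coeff \<mu> k j)"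
  have e: "(\<lambda>z. if z = 0 then e k j else z ^ ?m * Adj (\<mu> + z) k j / \<Delta> (\<mu> + z)) has_fps_expansion adj_coeff \<mu> k j" for k j
    unfolding e_def by (rule someI_ex[OF adj_fps_expansion[OF nz]])
  define \<alpha> where "\<alpha> = (\<lambda>k j z. if z = 0 then e k j else z ^ ?m * Adj (\<mu> + z) k j / \<Delta> (\<mu> + z))"
  have \<alpha>: "\<alpha> k j has_fps_expansion adj_coeff \<mu> k j" for k j unfolding \<alpha>_def by (rule e)
  have TE: "(\<lambda>z. l' (T (\<mu> + z) h)) has_fps_expansion Abs_fps (\<lambda>s. l' ((T \<mu> ^^ s) (T \<mu> h)))" if "bounded_functional l'" for l'
    using S_fps_expansion[OF h that, of \<mu> 0] by (simp add: T_def)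
  have PE: "(\<lambda>z. l (Phi (\<mu> + z) k)) has_fps_expansion Abs_fps (\<lambda>s. l ((T \<mu> ^^ s) (Phi \<mu> k)))" for k
    using S_fps_expansion[OF L2_zero_fun l, of \<mu> "axis k 1"] by (simp add: Phi_def)
  define H where "H = (\<lambda>z. z ^ ?m * l (T (\<mu> + z) h) - (\<Sum>k\<in>UNIV. (\<Sum>j\<in>UNIV. \<alpha> k j z * bd (T (\<mu> + z) h) $ j) * l (Phi (\<mu> + z) k)))"
  define F where "F = fps_X ^ ?m * Abs_fps (\<lambda>s. l ((T \<mu> ^^ s) (T \<mu> h))) - (\<Sum>k\<in>UNIV. weight \<mu> h k * Abs_fps (\<lambda>s. l ((T \<mu> ^^ s) (Phi \<mu> k))))"
  have 1: "H has_fps_expansion F"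
    unfolding H_def F_def weight_def
    by (intro has_fps_expansion_diff has_fps_expansion_mult has_fps_expansion_sum has_fps_expansion_fps_X_power
        TE PE \<alpha> l bounded_functional_bd)
  have 2: "eventually (\<lambda>z. H z = z ^ ?m * l (R (\<mu> + z) h)) (at 0)"
    using eventually_\<Delta>_nonzero[OF nz, of \<mu>] eventually_at_ball'[of 1 0 UNIV, OF zero_less_one]
  proof eventually_elim
    case (elim z)
    then have z: "z \<noteq> 0" "\<Delta> (\<mu> + z) \<noteq> 0" by auto
    have "H z = z ^ ?m * (l (T (\<mu> + z) h) - (\<Sum>k\<in>UNIV. (\<Sum>j\<in>UNIV. Adj (\<mu> + z) k j * bd (T (\<mu> + z) h) $ j) * l (Phi (\<mu> + z) k)) / \<Delta> (\<mu> + z))"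
      using z by (simp add: H_def \<alpha>_def right_diff_distrib sum_distrib_left sum_distrib_right sum_divide_distrib mult.assoc)
    then show ?case unfolding l_R[OF h l z(2)] G_def using z by (simp add: diff_divide_distrib)
  qed
  have 3: "fps_nth F p = l (residual \<mu> h p)" if "p < ?m" for p
  proof -
    have "fps_nth (weight \<mu> h k * Abs_fps (\<lambda>s. l ((T \<mu> ^^ s) (Phi \<mu> k)))) p = (\<Sum>s\<le>p. fps_nth (weight \<mu> h k) (p - s) * l ((T \<mu> ^^ s) (Phi \<mu> k)))" for k
      unfolding mult.commute[of "weight \<mu> h k"] fps_mult_nth atLeast0AtMost by (simp add: mult.commute)
    then show ?thesis using that
      by (simp add: F_def functional_residual[OF l] fps_X_power_mult_nth fps_sum_nth)
  qed
  show ?thesis by (rule that[OF 1 2 3])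
qed

text \<open>The boundary form of the resolvent vanishes in a punctured neighbourhood of \<mu>, hence
  so does every coefficient of its expansion.\<close>

lemma residual_bd:
  assumes nz: "\<Delta> \<zeta>\<^sub>0 \<noteq> 0" and h: "h \<in> L2" and p: "p < pole_order \<mu>"
  shows "bd (residual \<mu> h p) = 0"
proof -
  have "bd (residual \<mu> h p) $ i = 0" for i
  proof -
    obtain H F where H: "H has_fps_expansion F"
      "eventually (\<lambda>z. H z = z ^ pole_order \<mu> * bd (R (\<mu> + z) h) $ i) (at 0)"
      "\<And>p. p < pole_order \<mu> \<Longrightarrow> fps_nth F p = bd (residual \<mu> h p) $ i"
      by (rule resolvent_fps_expansion[where \<mu> = \<mu>, OF nz h bounded_functional_bd[of i]]) blast
    have "eventually (\<lambda>z. H z = 0) (at 0)"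
      using H(2) eventually_\<Delta>_nonzero[OF nz, of \<mu>] by eventually_elim (simp add: R_bd h)
    then have "F = 0" by (rule has_fps_expansion_eventually_zero[OF H(1)])
    then show ?thesis using H(3)[OF p] by simp
  qed
  then show ?thesis by (simp add: vec_eq_iff)
qed

text \<open>Applying L - \<mu> lowers the index by one, because it maps
  \<open>(T \<mu> ^^ s) (Phi \<mu> k)\<close> to its predecessor and annihilates
  \<open>Phi \<mu> k\<close>. Together with the boundary conditions this makes the principal part a
  chain of root functions.\<close>

lemma residual_sol:
  "sol \<mu> (if p = 0 then (\<lambda>x. 0) else residual \<mu> h (p - 1)) (residual \<mu> h p)"
proof -
  let ?w = "\<lambda>k s. - fps_nth (weight \<mu> h k) s"
  define g where "g = (\<lambda>k s. if s = 0 then (\<lambda>x. 0) else (T \<mu> ^^ (s - 1)) (Phi \<mu> k))"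
  have "sol \<mu> (g k s) ((T \<mu> ^^ s) (Phi \<mu> k))" for k s
    by (cases s) (simp_all add: g_def Phi_sol T_sol C01_L2 T_iter_C01 Phi_C01)
  then have s: "sol \<mu> (\<lambda>x. \<Sum>k\<in>UNIV. \<Sum>s\<le>p. ?w k (p - s) *s g k s x) (residual \<mu> h p)"
    unfolding residual_def by (intro sol_sum sol_smult) auto
  have "(\<lambda>x. \<Sum>k\<in>UNIV. \<Sum>s\<le>p. ?w k (p - s) *s g k s x) = (if p = 0 then (\<lambda>x. 0) else residual \<mu> h (p - 1))"
  proof (cases p)
    case (Suc q)
    have "(\<Sum>s\<le>Suc q. ?w k (Suc q - s) *s g k s x) = (\<Sum>s\<le>q. ?w k (q - s) *s (T \<mu> ^^ s) (Phi \<mu> k) x)" for k x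
      by (subst sum.atMost_Suc_shift) (simp add: g_def)
    then show ?thesis using Suc by (simp add: residual_def)
  qed (simp add: g_def)
  with s show ?thesis by simp
qed

text \<open>If the coefficients below the pole order vanish, the expansion is divisible by z^m and
  the quotient extends across \<mu>.\<close>

lemma resolvent_removable:
  assumes nz: "\<Delta> \<zeta>\<^sub>0 \<noteq> 0" and h: "h \<in> L2" and l: "bounded_functional l"
    and van: "\<And>p. p < pole_order \<mu> \<Longrightarrow> l (residual \<mu> h p) = 0"
  obtains K where "(\<lambda>z. l (R (\<mu> + z) h)) \<midarrow>0\<rightarrow> K"
proof -
  let ?m = "pole_order \<mu>"
  obtain H F where H: "H has_fps_expansion F"
    "eventually (\<lambda>z. H z = z ^ ?m * l (R (\<mu> + z) h)) (at 0)"
    "\<And>p. p < ?m \<Longrightarrow> fps_nth F p = l (residual \<mu> h p)"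
    by (rule resolvent_fps_expansion[where \<mu> = \<mu>, OF nz h l]) blast
  define F' where "F' = fps_shift ?m F"
  have FF: "F = fps_X ^ ?m * F'"
    by (rule fps_ext) (auto simp: F'_def fps_X_power_mult_nth H(3) van)
  have r: "fps_conv_radius F' > 0" using H(1) by (simp add: F'_def has_fps_expansion_def)
  then have F': "eval_fps F' has_fps_expansion F'" by (rule eval_fps_has_fps_expansion)
  have "(\<lambda>z. z ^ ?m * eval_fps F' z - H z) has_fps_expansion fps_X ^ ?m * F' - F"
    by (intro has_fps_expansion_diff has_fps_expansion_mult has_fps_expansion_fps_X_power F' H(1))
  then have "eventually (\<lambda>z. z ^ ?m * eval_fps F' z - H z = 0) (nhds 0)"
    by (simp add: FF[symmetric] has_fps_expansion_0_iff)
  then have ev: "eventually (\<lambda>z. z ^ ?m * eval_fps F' z - H z = 0) (at 0)"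
    by (auto simp: eventually_at_filter elim: eventually_mono)
  have "isCont (eval_fps F') 0" using has_fps_expansion_imp_continuous[OF F', of UNIV] by simp
  then have "eval_fps F' \<midarrow>0\<rightarrow> eval_fps F' 0" by (simp add: isCont_def)
  moreover have "eventually (\<lambda>z. l (R (\<mu> + z) h) = eval_fps F' z) (at 0)"
    using ev H(2) eventually_at_ball'[of 1 0 UNIV, OF zero_less_one] by eventually_elim auto
  ultimately have "(\<lambda>z. l (R (\<mu> + z) h)) \<midarrow>0\<rightarrow> eval_fps F' 0" by (simp add: filterlim_cong[OF refl refl])
  then show ?thesis by (rule that)
qed

end


section \<open>Growth of the resolvent\<close>

text \<open>If the quotient were unbounded on the strip, a normal families argument applied to horizontal
  translates of \<open>D\<close> would produce circles on which \<open>D\<close> is uniformly bounded below, contradicting the maximum principle.\<close>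

proposition entire_quotient_bounded_on_strip:
  fixes F G D :: "complex \<Rightarrow> complex"
  assumes F: "F holomorphic_on UNIV" and D: "D holomorphic_on UNIV"
    and FG: "\<And>\<zeta>. D \<zeta> \<noteq> 0 \<Longrightarrow> F \<zeta> = G \<zeta> / D \<zeta>"
    and GB: "\<And>R. \<exists>B. \<forall>\<zeta>. \<bar>Im \<zeta>\<bar> \<le> R \<longrightarrow> norm (G \<zeta>) \<le> B"
    and DB: "\<And>R. \<exists>B. \<forall>\<zeta>. \<bar>Im \<zeta>\<bar> \<le> R \<longrightarrow> norm (D \<zeta>) \<le> B"
    and c: "c > 0" and M: "M > 0" and lower: "\<And>\<zeta>. Im \<zeta> = M \<Longrightarrow> norm (D \<zeta>) \<ge> c"
  shows "\<exists>B. \<forall>\<zeta>. \<bar>Im \<zeta>\<bar> \<le> M \<longrightarrow> norm (F \<zeta>) \<le> B"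
proof (rule ccontr)
  assume "\<not> ?thesis"
  then have "\<forall>k::nat. \<exists>\<zeta>. \<bar>Im \<zeta>\<bar> \<le> M \<and> norm (F \<zeta>) > real k" by (meson not_le)
  then obtain w where w: "\<And>k. \<bar>Im (w k)\<bar> \<le> M" "\<And>k. norm (F (w k)) > real k" by metis
  \<comment> \<open>Translation moves the points of large values onto the imaginary axis. The bounds
    for \<open>D\<close> are unaffected, since they depend on the imaginary part only.\<close>
  define Dk where "Dk = (\<lambda>k z. D (z + of_real (Re (w k))))"
  have Dk: "Dk k holomorphic_on UNIV" for k
    unfolding Dk_def by (rule holomorphic_on_compose_gen[OF _ D, unfolded o_def]) (auto intro!: holomorphic_intros)
  have bound: "\<exists>B. \<forall>h\<in>range Dk. \<forall>z\<in>K. norm (h z) \<le> B" if "compact K" for K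
  proof -
    obtain R where "\<And>z. z \<in> K \<Longrightarrow> norm z \<le> R" using compact_imp_bounded[OF \<open>compact K\<close>] by (auto simp: bounded_iff)
    then have "\<bar>Im (z + of_real (Re (w k)))\<bar> \<le> R" if "z \<in> K" for z k
      using that abs_Im_le_cmod[of z] by force
    with DB[of R] show ?thesis unfolding Dk_def by blast
  qed
  obtain g r where g: "g holomorphic_on UNIV" and r: "strict_mono (r :: nat \<Rightarrow> nat)"
    and pt: "\<And>x. ((\<lambda>n. Dk (r n) x) \<longlongrightarrow> g x) sequentially"
    and ul: "\<And>K. compact K \<Longrightarrow> uniform_limit K (Dk \<circ> r) g sequentially"
    by (rule Montel[of UNIV "range Dk" Dk]) (use Dk bound in auto)
  \<comment> \<open>The lower bound on the line Im = M passes to the limit, so \<open>g\<close> is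
    not identically zero and has finitely many zeros in a disc.\<close>
  have "norm (g (\<i> * of_real M)) \<ge> c"
    by (rule tendsto_lowerbound[OF tendsto_norm[OF pt]]) (auto simp: Dk_def intro!: always_eventually lower)
  then have gM: "g (\<i> * of_real M) \<noteq> 0" using c by auto
  have "finite {z \<in> cball 0 (M + 2). g z = 0}"
  proof (cases "g constant_on UNIV")
    case True
    then have "{z \<in> cball 0 (M + 2). g z = 0} = {}" using gM by (auto simp: constant_on_def)
    then show ?thesis by (metis finite.emptyI)
  next
    case False
    then show ?thesis by (intro holomorphic_compact_finite_zeros[OF g]) auto
  qed
  then have "finite (norm ` {z \<in> cball 0 (M + 2). g z = 0})" by simp
  moreover have "infinite {M + 1<..<M + 2}" by (simp add: infinite_Ioo)
  \<comment> \<open>Only finitely many radii meet a zero of \<open>g\<close>. Any other radius above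
    M gives a circle around all the translated points.\<close>
  ultimately obtain \<rho> where \<rho>: "\<rho> \<in> {M + 1<..<M + 2}" "\<rho> \<notin> norm ` {z \<in> cball 0 (M + 2). g z = 0}"
    by (meson finite_subset subsetI)
  have \<rho>0: "\<rho> > 0" using \<rho>(1) M by simp
  have gz: "g z \<noteq> 0" if "z \<in> sphere 0 \<rho>" for z using that \<rho> by (force simp: image_iff)
  have "continuous_on (sphere 0 \<rho>) (\<lambda>z. norm (g z))"
    using holomorphic_on_imp_continuous_on[OF g] by (intro continuous_intros) (rule continuous_on_subset, auto)
  moreover have "sphere (0::complex) \<rho> \<noteq> {}" using \<rho>0 by simp
  ultimately obtain z0 where z0: "z0 \<in> sphere 0 \<rho>" "\<And>z. z \<in> sphere 0 \<rho> \<Longrightarrow> norm (g z0) \<le> norm (g z)"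
    using continuous_attains_inf[OF compact_sphere] by metis
  define \<delta> where "\<delta> = norm (g z0)"
  have \<delta>: "\<delta> > 0" using gz[OF z0(1)] by (simp add: \<delta>_def)
  have "eventually (\<lambda>n. \<forall>z\<in>sphere 0 \<rho>. dist ((Dk \<circ> r) n z) (g z) < \<delta> / 2) sequentially"
    using uniform_limitD[OF ul[OF compact_sphere], of "\<delta> / 2" 0 \<rho>] \<delta> by simp
  then obtain N where N: "\<And>n z. n \<ge> N \<Longrightarrow> z \<in> sphere 0 \<rho> \<Longrightarrow> dist (Dk (r n) z) (g z) < \<delta> / 2"
    unfolding eventually_sequentially o_def by blast
  obtain B where B: "\<And>\<zeta>. \<bar>Im \<zeta>\<bar> \<le> \<rho> \<Longrightarrow> norm (G \<zeta>) \<le> B" using GB by blast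
  have B0: "B \<ge> 0" using B[of 0] \<rho>0 norm_ge_zero[of "G 0"] by (smt (verit) norm_ge_zero zero_complex.simps(2))
  have bd: "norm (F (w (r n))) \<le> 2 * B / \<delta>" if n: "n \<ge> N" for n
  proof -
    let ?x = "complex_of_real (Re (w (r n)))"
    let ?f = "\<lambda>z. F (z + ?x)"
    have f: "?f holomorphic_on A" for A
      by (rule holomorphic_on_compose_gen[OF _ F, unfolded o_def]) (auto intro!: holomorphic_intros)
    \<comment> \<open>The maximum principle carries the bound for the quotient from the circle,
      where the translate of \<open>D\<close> stays away from zero, to the translated point
      inside.\<close>
    have "norm (?f (\<i> * of_real (Im (w (r n))))) \<le> 2 * B / \<delta>"
    proof (rule maximum_modulus_frontier[of ?f "cball 0 \<rho>"])
      fix z assume "z \<in> frontier (cball (0::complex) \<rho>)"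
      then have z: "z \<in> sphere 0 \<rho>" by (simp add: frontier_cball)
      have "\<delta> \<le> norm (g z)" unfolding \<delta>_def by (rule z0(2)[OF z])
      also have "\<dots> \<le> norm (D (z + ?x)) + norm (D (z + ?x) - g z)" by (metis norm_minus_commute norm_triangle_sub add.commute)
      also have "norm (D (z + ?x) - g z) < \<delta> / 2" using N[OF n z] by (simp add: dist_norm Dk_def)
      finally have d: "norm (D (z + ?x)) \<ge> \<delta> / 2" by simp
      then have "D (z + ?x) \<noteq> 0" using \<delta> by auto
      then have "norm (?f z) = norm (G (z + ?x)) / norm (D (z + ?x))" by (simp add: FG norm_divide)
      also have "\<dots> \<le> B / (\<delta> / 2)"
      proof (rule frac_le[OF B0 _ _ d])
        show "norm (G (z + ?x)) \<le> B" by (rule B) (use z abs_Im_le_cmod[of z] in simp)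
      qed (use \<delta> in simp)
      finally show "norm (?f z) \<le> 2 * B / \<delta>" by (simp add: mult.commute)
    next
      show "\<i> * of_real (Im (w (r n))) \<in> cball 0 \<rho>"
        using w(1)[of "r n"] \<rho>(1) by (simp add: norm_mult)
    qed (use f in \<open>auto intro!: holomorphic_on_imp_continuous_on\<close>)
    moreover have "\<i> * of_real (Im (w (r n))) + ?x = w (r n)" by (simp add: complex_eq_iff)
    ultimately show ?thesis by simp
  qed
  obtain k :: nat where k: "real k > 2 * B / \<delta>" using reals_Archimedean2 by blast
  let ?n = "max N k"
  have "real (r ?n) \<ge> real ?n" using seq_suble[OF r, of ?n] by simp
  then have "norm (F (w (r ?n))) > 2 * B / \<delta>" using w(2)[of "r ?n"] k by linarith
  then show False using bd[of ?n] by simp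
qed

section \<open>Solutions for large imaginary part of the parameter\<close>

definition proj :: "'n::finite set \<Rightarrow> complex^'n^'n" where
  "proj I = (\<chi> i j. if i = j \<and> i \<in> I then 1 else 0)"

lemma proj_nth: "(proj I *v v) $ i = (if i \<in> I then v $ i else 0)"
  by (cases "i \<in> I") (simp_all add: proj_def matrix_vector_mult_def mult_delta_left)

context boundary_problem
begin

text \<open>\<open>I\<close> marks the components that decay rightwards from 0; the others decay
  leftwards from 1. The vector \<open>c\<close> collects each component at the end from which it
  decays. The values at the opposite ends are small, so the boundary form is \<open>W *v c\<close>
  up to an error, and the invertibility of \<open>W\<close> bounds \<open>c\<close> and with it
  \<open>y\<close>.\<close>

lemma large_imaginary_part_bound:
  assumes nz: "det (C ** proj I + D ** proj (- I)) \<noteq> 0"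
  obtains K N where "K \<ge> 0" "N > 0"
    "\<And>\<zeta> g y x. (\<And>i. a i * Im \<zeta> > 0 \<longleftrightarrow> i \<in> I) \<Longrightarrow> \<bar>Im \<zeta>\<bar> \<ge> N \<Longrightarrow> sol \<zeta> g y \<Longrightarrow> x \<in> {0..1} \<Longrightarrow>
      norm (y x) \<le> K * (norm (bd y) + L2_norm g / sqrt \<bar>Im \<zeta>\<bar>)"
proof -
  define W where "W = C ** proj I + D ** proj (- I)"
  obtain V where V: "V ** W = mat 1"
    using nz unfolding W_def[symmetric] invertible_det_nz[symmetric] invertible_def by blast
  define n where "n = real CARD('n)"
  define a0 where "a0 = Min (range (\<lambda>i. \<bar>a i\<bar>))"
  have a0: "a0 > 0" "\<And>i. a0 \<le> \<bar>a i\<bar>" unfolding a0_def using a_nonzero by auto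
  define q where "q = L2_norm Q"
  define \<tau> where "\<tau> = n * norm V"
  define \<gamma> where "\<gamma> = n * (norm C + norm D) * n"
  define \<kappa> where "\<kappa> = asum / sqrt (2 * a0)"
  have pos: "n \<ge> 1" "q \<ge> 0" "\<tau> \<ge> 0" "\<gamma> \<ge> 0" "\<kappa> \<ge> 0"
    using a0 asum_nonneg L2_norm_nonneg[of Q] by (auto simp: n_def q_def \<tau>_def \<gamma>_def \<kappa>_def Suc_leI)
  \<comment> \<open>Chosen for the two absorptions below: the first summand gives \<tau> \<gamma>
    \<delta> \<le> 1 / 2, the squared one gives \<eta> q / sqrt t \<le> 1 / 2. The absorptions
    account for the factors 2 in \<open>K\<close>.\<close>
  define N where "N = 2 * \<tau> * \<gamma> / a0 + (2 * n * (2 * \<tau> * \<gamma> + 1) * \<kappa> * q)\<^sup>2 + 1"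
  define K where "K = 2 * n * (2 * \<tau>) + 2 * n * (2 * \<tau> * \<gamma> + 1) * \<kappa>"
  have "K \<ge> 0" unfolding K_def using pos by simp
  moreover have "N > 0" unfolding N_def using pos a0 by (intro add_nonneg_pos add_nonneg_nonneg) auto
  moreover have "norm (y x) \<le> K * (norm (bd y) + L2_norm g / sqrt \<bar>Im \<zeta>\<bar>)"
    if sgn: "\<And>i. a i * Im \<zeta> > 0 \<longleftrightarrow> i \<in> I" and N: "\<bar>Im \<zeta>\<bar> \<ge> N" and s: "sol \<zeta> g y" and x: "x \<in> {0..1}" for \<zeta> g y x
  proof -
    note g = sol_L2[OF s] and y = sol_C01[OF s]
    define t where "t = \<bar>Im \<zeta>\<bar>"
    have t: "t > 0" "t \<ge> N" using N \<open>N > 0\<close> by (auto simp: t_def)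
    have "continuous_on {0..1} (\<lambda>x. norm (y x))" by (intro continuous_intros C01_continuous[OF y])
    then obtain x0 where x0: "x0 \<in> {0..1}" "\<And>x. x \<in> {0..1} \<Longrightarrow> norm (y x) \<le> norm (y x0)"
      using continuous_attains_sup[of "{0..1::real}" "\<lambda>x. norm (y x)"] by auto
    define Y where "Y = norm (y x0)"
    have Y: "Y \<ge> 0" "\<And>x. x \<in> {0..1} \<Longrightarrow> norm (y x) \<le> Y" using x0 by (auto simp: Y_def)
    \<comment> \<open>Bounds the effect of the forcing on each component. It contains the maximum
      \<open>Y\<close> of the solution itself, because the term with \<open>Q\<close> counts as
      forcing.\<close>
    define e where "e = \<kappa> * (L2_norm g + q * Y) / sqrt t"
    have e0: "e \<ge> 0" unfolding e_def using pos Y t L2_norm_nonneg[of g] by simp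
    have f: "L2_norm (forcing g y i) / sqrt (2 * (\<bar>a i\<bar> * t)) \<le> e" for i
    proof -
      have gq: "(\<lambda>t. norm (g t) + Y * norm (Q t)) \<in> L2"
        by (intro L2_add L2_norm_fun g L2_bounded_linear[OF _ bounded_linear_mult_right] Q_L2)
      have "L2_norm (forcing g y i) \<le> L2_norm (\<lambda>t. asum * (norm (g t) + Y * norm (Q t)))"
      proof (rule L2_norm_mono[OF forcing_L2[OF g y] L2_bounded_linear[OF gq bounded_linear_mult_right]])
        fix t :: real assume "t \<in> {0..1}"
        then have "norm (Q t) * norm (y t) \<le> Y * norm (Q t)" using Y by (simp add: mult.commute mult_right_mono)
        then have "asum * (norm (g t) + norm (Q t) * norm (y t)) \<le> asum * (norm (g t) + Y * norm (Q t))"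
          by (intro mult_left_mono asum_nonneg) simp
        then show "norm (forcing g y i t) \<le> norm (asum * (norm (g t) + Y * norm (Q t)))"
          using forcing_bound[of g y i t] by simp
      qed
      also have "\<dots> = asum * L2_norm (\<lambda>t. norm (g t) + Y * norm (Q t))"
        using L2_norm_cmult[OF gq, of asum] asum_nonneg by simp
      also have "\<dots> \<le> asum * (L2_norm g + Y * q)"
      proof (intro mult_left_mono asum_nonneg)
        have "L2_norm (\<lambda>t. norm (g t) + Y * norm (Q t)) \<le> L2_norm (\<lambda>t. norm (g t)) + L2_norm (\<lambda>t. Y * norm (Q t))"
          by (intro L2_norm_triangle L2_norm_fun g L2_bounded_linear[OF _ bounded_linear_mult_right] Q_L2)
        also have "\<dots> = L2_norm g + Y * q"
          using L2_norm_cmult[OF L2_norm_fun[OF Q_L2], of Y] Y by (simp add: L2_norm_norm q_def)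
        finally show "L2_norm (\<lambda>t. norm (g t) + Y * norm (Q t)) \<le> L2_norm g + Y * q" .
      qed
      finally have 1: "L2_norm (forcing g y i) \<le> asum * (L2_norm g + Y * q)" .
      have "L2_norm (forcing g y i) / sqrt (2 * (\<bar>a i\<bar> * t)) \<le> asum * (L2_norm g + Y * q) / sqrt (2 * (a0 * t))"
        using 1 a0 t asum_nonneg Y pos L2_norm_nonneg[of g] by (intro frac_le) (auto intro!: mult_right_mono)
      also have "\<dots> = e" by (simp add: e_def \<kappa>_def real_sqrt_mult mult.commute)
      finally show ?thesis .
    qed
    \<comment> \<open>Exponential smallness is used only in the weak form exp (- s) \<le> 1 /
      s.\<close>
    define \<delta> where "\<delta> = 1 / (a0 * t)"
    have \<delta>0: "\<delta> \<ge> 0" using a0 t by (simp add: \<delta>_def)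
    have ex: "exp (- (\<bar>a i\<bar> * t)) \<le> \<delta>" for i
    proof -
      have "a0 * t \<le> exp (\<bar>a i\<bar> * t)"
        using exp_ge_add_one_self[of "\<bar>a i\<bar> * t"] mult_right_mono[OF a0(2)[of i], of t] t by linarith
      then show ?thesis using a0 t by (simp add: \<delta>_def exp_minus field_simps)
    qed
    define c where "c = (\<chi> i. if i \<in> I then y 0 $ i else y 1 $ i)"
    have at: "\<bar>a i\<bar> * t > 0" for i using a_nonzero t by simp
    have Re: "Re (\<i> * of_real (a i) * \<zeta>) = (if i \<in> I then - (\<bar>a i\<bar> * t) else \<bar>a i\<bar> * t)" for i
    proof -
      have "\<bar>a i\<bar> * t = \<bar>a i * Im \<zeta>\<bar>" by (simp add: t_def abs_mult)
      then show ?thesis using sgn[of i] by (auto simp: abs_if)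
    qed
    have yi: "norm (y x $ i) \<le> exp (- (\<bar>a i\<bar> * t) * (if i \<in> I then x else 1 - x)) * norm (c $ i) + e" if x: "x \<in> {0..1}" for x i
    proof (cases "i \<in> I")
      case True
      have "norm (y x $ i) \<le> exp (- (\<bar>a i\<bar> * t) * x) * norm (y 0 $ i) + L2_norm (forcing g y i) / sqrt (2 * (\<bar>a i\<bar> * t))"
        by (rule decaying_solution_bound[OF forcing_L2[OF g y] C01_component_continuous[OF y] sol_component[OF s] x _ at])
          (use Re[of i] True in auto)
      then show ?thesis using f[of i] True by (simp add: c_def)
    next
      case False
      have "norm (y x $ i) \<le> exp (- (\<bar>a i\<bar> * t) * (1 - x)) * norm (y 1 $ i) + L2_norm (forcing g y i) / sqrt (2 * (\<bar>a i\<bar> * t))"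
        by (rule growing_solution_bound[OF forcing_L2[OF g y] C01_component_continuous[OF y] sol_component[OF s] x _ at])
          (use Re[of i] False in auto)
      then show ?thesis using f[of i] False by (simp add: c_def)
    qed
    have small: "norm (y (if i \<in> I then 1 else 0) $ i) \<le> \<delta> * norm c + e" for i
    proof -
      have "norm (y (if i \<in> I then 1 else 0) $ i) \<le> exp (- (\<bar>a i\<bar> * t)) * norm (c $ i) + e"
        using yi[of 0 i] yi[of 1 i] by (cases "i \<in> I") simp_all
      also have "\<dots> \<le> \<delta> * norm c + e"
        using \<delta>0 by (intro add_right_mono mult_mono ex Finite_Cartesian_Product.norm_nth_le) auto
      finally show ?thesis .
    qed
    have all: "norm (y x $ i) \<le> norm c + e" if x: "x \<in> {0..1}" for x i
    proof -
      have "exp (- (\<bar>a i\<bar> * t) * (if i \<in> I then x else 1 - x)) \<le> 1"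
        using x at[of i] by (auto intro!: mult_nonneg_nonneg)
      then have "exp (- (\<bar>a i\<bar> * t) * (if i \<in> I then x else 1 - x)) * norm (c $ i) \<le> 1 * norm c"
        by (intro mult_mono Finite_Cartesian_Product.norm_nth_le) auto
      then show ?thesis using yi[OF x, of i] by linarith
    qed
    \<comment> \<open>\<open>z\<close> and \<open>w\<close> hold the components at the end where
      they have already decayed; they are the error terms of the boundary form.\<close>
    define z where "z = proj (- I) *v y 0"
    define w where "w = proj I *v y 1"
    have y0: "y 0 = proj I *v c + z" and y1: "y 1 = proj (- I) *v c + w"
      by (simp_all add: vec_eq_iff z_def w_def proj_nth c_def del: vector_add_component add: vector_add_component)
    have bdy: "bd y = W *v c + (C *v z + D *v w)"
      unfolding bd_def y0 y1 W_def
      by (simp add: matrix_vector_right_distrib matrix_vector_mult_add_rdistrib matrix_vector_mul_assoc)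
    have de0: "\<delta> * norm c + e \<ge> 0" using \<delta>0 e0 by simp
    have nz: "norm z \<le> n * (\<delta> * norm c + e)"
    proof -
      have "norm z \<le> (\<Sum>i\<in>UNIV. norm (z $ i))" by (rule norm_vec_le_sum)
      also have "\<dots> \<le> (\<Sum>i\<in>(UNIV::'n set). \<delta> * norm c + e)"
      proof (rule sum_mono)
        fix i show "norm (z $ i) \<le> \<delta> * norm c + e"
          using small[of i] de0 by (auto simp: z_def proj_nth split: if_splits)
      qed
      finally show ?thesis by (simp add: n_def)
    qed
    have nw: "norm w \<le> n * (\<delta> * norm c + e)"
    proof -
      have "norm w \<le> (\<Sum>i\<in>UNIV. norm (w $ i))" by (rule norm_vec_le_sum)
      also have "\<dots> \<le> (\<Sum>i\<in>(UNIV::'n set). \<delta> * norm c + e)"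
      proof (rule sum_mono)
        fix i show "norm (w $ i) \<le> \<delta> * norm c + e"
          using small[of i] de0 by (auto simp: w_def proj_nth split: if_splits)
      qed
      finally show ?thesis by (simp add: n_def)
    qed
    have "norm (C *v z + D *v w) \<le> n * (norm C * norm z) + n * (norm D * norm w)"
      unfolding n_def by (rule order_trans[OF norm_triangle_ineq add_mono[OF norm_matrix_vector_mult_le norm_matrix_vector_mult_le]])
    also have "\<dots> \<le> n * (norm C * (n * (\<delta> * norm c + e))) + n * (norm D * (n * (\<delta> * norm c + e)))"
      using pos by (intro add_mono mult_left_mono nz nw) auto
    also have "\<dots> = \<gamma> * (\<delta> * norm c + e)" by (simp add: \<gamma>_def algebra_simps)
    finally have ncd: "norm (C *v z + D *v w) \<le> \<gamma> * (\<delta> * norm c + e)" .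
    have "c = V *v (W *v c)" using V by (simp add: matrix_vector_mul_assoc)
    then have "norm c \<le> \<tau> * norm (W *v c)"
      using norm_matrix_vector_mult_le[of V "W *v c"] by (simp add: \<tau>_def n_def mult.assoc)
    also have "W *v c = bd y - (C *v z + D *v w)" using bdy by simp
    also have "norm (bd y - (C *v z + D *v w)) \<le> norm (bd y) + \<gamma> * (\<delta> * norm c + e)"
      using norm_triangle_ineq4[of "bd y" "C *v z + D *v w"] ncd by linarith
    finally have c1: "norm c \<le> \<tau> * (norm (bd y) + \<gamma> * (\<delta> * norm c + e))" using pos by (simp add: mult_left_mono)
    have "\<tau> * \<gamma> * \<delta> \<le> 1 / 2"
    proof -
      have "2 * \<tau> * \<gamma> / a0 \<le> t" using t(2) zero_le_power2[of "2 * n * (2 * \<tau> * \<gamma> + 1) * \<kappa> * q"] unfolding N_def by linarith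
      then show ?thesis using a0 t(1) by (simp add: \<delta>_def field_simps)
    qed
    \<comment> \<open>First absorption: at most half of \<open>norm c\<close> returns on the
      right.\<close>
    then have "\<tau> * \<gamma> * \<delta> * norm c \<le> 1 / 2 * norm c" by (intro mult_right_mono) auto
    then have c2: "norm c \<le> 2 * \<tau> * norm (bd y) + 2 * \<tau> * \<gamma> * e" using c1 by (simp add: algebra_simps)
    have "Y \<le> (\<Sum>i\<in>UNIV. norm (y x0 $ i))" unfolding Y_def by (rule norm_vec_le_sum)
    also have "\<dots> \<le> (\<Sum>i\<in>(UNIV::'n set). norm c + e)" by (intro sum_mono all x0)
    finally have "Y \<le> n * (norm c + e)" by (simp add: n_def)
    also have "\<dots> \<le> n * (2 * \<tau> * norm (bd y) + 2 * \<tau> * \<gamma> * e + e)" using c2 pos by (intro mult_left_mono) auto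
    finally have Y1: "Y \<le> n * (2 * \<tau>) * norm (bd y) + n * (2 * \<tau> * \<gamma> + 1) * e" by (simp add: algebra_simps)
    define \<eta> where "\<eta> = n * (2 * \<tau> * \<gamma> + 1) * \<kappa>"
    have \<eta>0: "\<eta> \<ge> 0" using pos by (simp add: \<eta>_def)
    have ne: "n * (2 * \<tau> * \<gamma> + 1) * e = \<eta> * L2_norm g / sqrt t + (\<eta> * q / sqrt t) * Y"
      by (simp add: e_def \<eta>_def algebra_simps add_divide_distrib)
    have "\<eta> * q / sqrt t \<le> 1 / 2"
    proof -
      have "(2 * (\<eta> * q))\<^sup>2 \<le> t"
      proof -
        have eq: "2 * (\<eta> * q) = 2 * n * (2 * \<tau> * \<gamma> + 1) * \<kappa> * q" by (simp add: \<eta>_def)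
        have "2 * \<tau> * \<gamma> / a0 \<ge> 0" using pos a0 by simp
        then show ?thesis unfolding eq using t(2) unfolding N_def by linarith
      qed
      then have "2 * (\<eta> * q) \<le> sqrt t" by (rule real_le_rsqrt)
      then show ?thesis using t(1) by (simp add: field_simps)
    qed
    \<comment> \<open>Second absorption: \<open>Y\<close> enters its own bound with a factor of at
      most one half.\<close>
    then have "(\<eta> * q / sqrt t) * Y \<le> 1 / 2 * Y" using Y by (intro mult_right_mono) auto
    moreover have "Y \<le> n * (2 * \<tau>) * norm (bd y) + (\<eta> * (L2_norm g / sqrt t) + (\<eta> * q / sqrt t) * Y)"
      using Y1 unfolding ne by simp
    ultimately have "Y \<le> 2 * (n * (2 * \<tau>) * norm (bd y)) + 2 * (\<eta> * (L2_norm g / sqrt t))" by linarith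
    then have "Y \<le> 2 * (n * (2 * \<tau>)) * norm (bd y) + 2 * \<eta> * (L2_norm g / sqrt t)" by (simp only: mult.assoc)
    also have "\<dots> \<le> K * norm (bd y) + K * (L2_norm g / sqrt t)"
      using pos \<eta>0 t L2_norm_nonneg[of g] by (intro add_mono mult_right_mono) (auto simp: K_def \<eta>_def)
    finally show ?thesis using Y(2)[OF x] by (simp add: t_def distrib_left)
  qed
  ultimately show ?thesis using that by blast
qed

section \<open>Bounds on horizontal strips\<close>

lemma S_bounded_on_strip:
  assumes h: "h \<in> L2" and l: "bounded_functional l"
  shows "\<exists>B. \<forall>\<zeta>. \<bar>Im \<zeta>\<bar> \<le> \<rho> \<longrightarrow> norm (l (S \<zeta> c h)) \<le> B"
proof -
  obtain K where K: "K \<ge> 0" "\<And>\<zeta> g y x. \<bar>Im \<zeta>\<bar> \<le> \<rho> \<Longrightarrow> sol \<zeta> g y \<Longrightarrow> x \<in> {0..1} \<Longrightarrow>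
    (norm (y x))\<^sup>2 \<le> K * ((norm (y 0))\<^sup>2 + integral {0..x} (\<lambda>t. (norm (g t))\<^sup>2))"
    using solution_bound[of \<rho>] by metis
  obtain L where L: "L \<ge> 0" "\<And>u m. u \<in> C01 \<Longrightarrow> (\<And>x. x \<in> {0..1} \<Longrightarrow> norm (u x) \<le> m) \<Longrightarrow> norm (l u) \<le> L * m"
    using bounded_functional_bound[OF l] by metis
  define m where "m = sqrt (K * ((norm c)\<^sup>2 + (L2_norm h)\<^sup>2))"
  have "norm (l (S \<zeta> c h)) \<le> L * m" if "\<bar>Im \<zeta>\<bar> \<le> \<rho>" for \<zeta>
  proof (rule L(2)[OF S_C01[OF h]])
    fix x :: real assume x: "x \<in> {0..1}"
    have "(norm (S \<zeta> c h x))\<^sup>2 \<le> K * ((norm c)\<^sup>2 + integral {0..x} (\<lambda>t. (norm (h t))\<^sup>2))"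
      using K(2)[OF that S_sol[OF h] x] S_init[OF h] by simp
    also have "\<dots> \<le> K * ((norm c)\<^sup>2 + (L2_norm h)\<^sup>2)"
      unfolding L2_norm_power2[OF h] using x K(1) L2_sq_integrable_on[OF h]
      by (intro mult_left_mono add_left_mono integral_subset_le) auto
    finally show "norm (S \<zeta> c h x) \<le> m" unfolding m_def by (rule real_le_rsqrt)
  qed
  then show ?thesis by blast
qed

text \<open>A class closed under sums and products, hence under determinants of matrices with
  entries in it.\<close>

definition strip_bounded :: "(complex \<Rightarrow> complex) \<Rightarrow> bool" where
  "strip_bounded f \<longleftrightarrow> (\<forall>\<rho>. \<exists>B. \<forall>\<zeta>. \<bar>Im \<zeta>\<bar> \<le> \<rho> \<longrightarrow> norm (f \<zeta>) \<le> B)"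

lemma strip_bounded_const: "strip_bounded (\<lambda>\<zeta>. c)"
  unfolding strip_bounded_def by blast

lemma strip_bounded_mult:
  assumes "strip_bounded f" "strip_bounded g" shows "strip_bounded (\<lambda>\<zeta>. f \<zeta> * g \<zeta>)"
  unfolding strip_bounded_def
proof
  fix \<rho>
  obtain B where B: "\<And>\<zeta>. \<bar>Im \<zeta>\<bar> \<le> \<rho> \<Longrightarrow> norm (f \<zeta>) \<le> B" using assms(1) unfolding strip_bounded_def by blast
  obtain B' where B': "\<And>\<zeta>. \<bar>Im \<zeta>\<bar> \<le> \<rho> \<Longrightarrow> norm (g \<zeta>) \<le> B'" using assms(2) unfolding strip_bounded_def by blast
  have "norm (f \<zeta> * g \<zeta>) \<le> B * B'" if "\<bar>Im \<zeta>\<bar> \<le> \<rho>" for \<zeta>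
    unfolding norm_mult by (rule mult_mono'[OF B[OF that] B'[OF that]]) auto
  then show "\<exists>B. \<forall>\<zeta>. \<bar>Im \<zeta>\<bar> \<le> \<rho> \<longrightarrow> norm (f \<zeta> * g \<zeta>) \<le> B" by blast
qed

lemma strip_bounded_add:
  assumes "strip_bounded f" "strip_bounded g" shows "strip_bounded (\<lambda>\<zeta>. f \<zeta> + g \<zeta>)"
  unfolding strip_bounded_def
proof
  fix \<rho>
  obtain B where B: "\<And>\<zeta>. \<bar>Im \<zeta>\<bar> \<le> \<rho> \<Longrightarrow> norm (f \<zeta>) \<le> B" using assms(1) unfolding strip_bounded_def by blast
  obtain B' where B': "\<And>\<zeta>. \<bar>Im \<zeta>\<bar> \<le> \<rho> \<Longrightarrow> norm (g \<zeta>) \<le> B'" using assms(2) unfolding strip_bounded_def by blast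
  have "norm (f \<zeta> + g \<zeta>) \<le> B + B'" if "\<bar>Im \<zeta>\<bar> \<le> \<rho>" for \<zeta>
    by (rule norm_triangle_mono[OF B[OF that] B'[OF that]])
  then show "\<exists>B. \<forall>\<zeta>. \<bar>Im \<zeta>\<bar> \<le> \<rho> \<longrightarrow> norm (f \<zeta> + g \<zeta>) \<le> B" by blast
qed

lemma strip_bounded_sum:
  assumes "\<And>i. i \<in> A \<Longrightarrow> strip_bounded (f i)" shows "strip_bounded (\<lambda>\<zeta>. \<Sum>i\<in>A. f i \<zeta>)"
  using assms by (induction A rule: infinite_finite_induct) (simp_all add: strip_bounded_const strip_bounded_add)

lemma strip_bounded_prod:
  assumes "\<And>i. i \<in> A \<Longrightarrow> strip_bounded (f i)" shows "strip_bounded (\<lambda>\<zeta>. \<Prod>i\<in>A. f i \<zeta>)"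
  using assms by (induction A rule: infinite_finite_induct) (simp_all add: strip_bounded_const strip_bounded_mult)

lemma strip_bounded_det:
  fixes A :: "complex \<Rightarrow> complex^'n^'n"
  assumes "\<And>i j. strip_bounded (\<lambda>\<zeta>. A \<zeta> $ i $ j)" shows "strip_bounded (\<lambda>\<zeta>. det (A \<zeta>))"
  unfolding det_def by (intro strip_bounded_sum strip_bounded_mult strip_bounded_const strip_bounded_prod assms)

lemma strip_bounded_S: "h \<in> L2 \<Longrightarrow> bounded_functional l \<Longrightarrow> strip_bounded (\<lambda>\<zeta>. l (S \<zeta> c h))"
  unfolding strip_bounded_def using S_bounded_on_strip by blast

lemma strip_bounded_M: "strip_bounded (\<lambda>\<zeta>. M \<zeta> $ i $ k)"
  unfolding M_def Phi_def by (simp add: strip_bounded_S[OF L2_zero_fun bounded_functional_bd])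

lemma strip_bounded_\<Delta>: "strip_bounded \<Delta>"
  unfolding \<Delta>_def[abs_def] by (intro strip_bounded_det strip_bounded_M)

lemma strip_bounded_Adj: "strip_bounded (\<lambda>\<zeta>. Adj \<zeta> k j)"
  unfolding Adj_def
proof (rule strip_bounded_det)
  fix r s show "strip_bounded (\<lambda>\<zeta>. (\<chi> r s. if s = k then axis j 1 $ r else M \<zeta> $ r $ s) $ r $ s)"
    by (cases "s = k") (simp_all add: strip_bounded_M strip_bounded_const)
qed

lemma strip_bounded_G: assumes "h \<in> L2" "bounded_functional l" shows "strip_bounded (G l h)"
proof -
  have "strip_bounded (\<lambda>\<zeta>. \<Delta> \<zeta> * l (S \<zeta> 0 h) + (-1) * (\<Sum>k\<in>UNIV. (\<Sum>j\<in>UNIV. Adj \<zeta> k j * bd (S \<zeta> 0 h) $ j) * l (S \<zeta> (axis k 1) (\<lambda>x. 0))))"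
    by (intro strip_bounded_add strip_bounded_mult strip_bounded_sum strip_bounded_const strip_bounded_\<Delta> strip_bounded_Adj
        strip_bounded_S bounded_functional_bd L2_zero_fun assms)
  then show ?thesis by (simp add: G_def[abs_def] T_def Phi_def)
qed

end

section \<open>Resolvent bounds in both half planes and Liouville's theorem\<close>

locale regular_problem = boundary_problem a Q C D for a :: "'n::finite \<Rightarrow> real" and Q C D +
  assumes regular_upper: "det (C ** proj {i. a i > 0} + D ** proj {i. a i < 0}) \<noteq> 0"
    and regular_lower: "det (C ** proj {i. a i < 0} + D ** proj {i. a i > 0}) \<noteq> 0"
begin

text \<open>For Im \<zeta> > 0 the components with a i > 0 decay from 0, for Im \<zeta> < 0 those
  with a i < 0, so each half plane uses one of the two determinants. The larger constants serve
  both.\<close>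

lemma half_plane_bound:
  obtains K N where "K \<ge> 0" "N > 0"
    "\<And>\<zeta> g y x. \<bar>Im \<zeta>\<bar> \<ge> N \<Longrightarrow> sol \<zeta> g y \<Longrightarrow> x \<in> {0..1} \<Longrightarrow>
      norm (y x) \<le> K * (norm (bd y) + L2_norm g / sqrt \<bar>Im \<zeta>\<bar>)"
proof -
  have c: "- {i. a i > 0} = {i. a i < 0}" "- {i. a i < 0} = {i. a i > 0}"
    using a_nonzero by (auto simp: not_less order.order_iff_strict)
  obtain K N where K: "K \<ge> 0" "N > 0" "\<And>\<zeta> g y x. (\<And>i. a i * Im \<zeta> > 0 \<longleftrightarrow> i \<in> {i. a i > 0}) \<Longrightarrow> \<bar>Im \<zeta>\<bar> \<ge> N \<Longrightarrow> sol \<zeta> g y \<Longrightarrow> x \<in> {0..1} \<Longrightarrow>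
      norm (y x) \<le> K * (norm (bd y) + L2_norm g / sqrt \<bar>Im \<zeta>\<bar>)"
    by (rule large_imaginary_part_bound[of "{i. a i > 0}"]) (use regular_upper in \<open>simp add: c\<close>, blast)
  obtain K' N' where K': "K' \<ge> 0" "N' > 0" "\<And>\<zeta> g y x. (\<And>i. a i * Im \<zeta> > 0 \<longleftrightarrow> i \<in> {i. a i < 0}) \<Longrightarrow> \<bar>Im \<zeta>\<bar> \<ge> N' \<Longrightarrow> sol \<zeta> g y \<Longrightarrow> x \<in> {0..1} \<Longrightarrow>
      norm (y x) \<le> K' * (norm (bd y) + L2_norm g / sqrt \<bar>Im \<zeta>\<bar>)"
    by (rule large_imaginary_part_bound[of "{i. a i < 0}"]) (use regular_lower in \<open>simp add: c\<close>, blast)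
  have "norm (y x) \<le> max K K' * (norm (bd y) + L2_norm g / sqrt \<bar>Im \<zeta>\<bar>)"
    if "\<bar>Im \<zeta>\<bar> \<ge> max N N'" "sol \<zeta> g y" "x \<in> {0..1}" for \<zeta> g y x
  proof -
    have p: "norm (bd y) + L2_norm g / sqrt \<bar>Im \<zeta>\<bar> \<ge> 0" using L2_norm_nonneg[of g] by simp
    have "Im \<zeta> > 0 \<or> Im \<zeta> < 0" using that(1) K(2) by auto
    then show ?thesis
    proof
      assume 1: "Im \<zeta> > 0"
      have "norm (y x) \<le> K * (norm (bd y) + L2_norm g / sqrt \<bar>Im \<zeta>\<bar>)"
        by (rule K(3)[OF _ _ that(2,3)]) (use 1 that(1) in \<open>auto simp: zero_less_mult_iff\<close>)
      also have "\<dots> \<le> max K K' * (norm (bd y) + L2_norm g / sqrt \<bar>Im \<zeta>\<bar>)" using p by (intro mult_right_mono) auto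
      finally show ?thesis .
    next
      assume 2: "Im \<zeta> < 0"
      have "norm (y x) \<le> K' * (norm (bd y) + L2_norm g / sqrt \<bar>Im \<zeta>\<bar>)"
        by (rule K'(3)[OF _ _ that(2,3)]) (use 2 that(1) in \<open>auto simp: zero_less_mult_iff\<close>)
      also have "\<dots> \<le> max K K' * (norm (bd y) + L2_norm g / sqrt \<bar>Im \<zeta>\<bar>)" using p by (intro mult_right_mono) auto
      finally show ?thesis .
    qed
  qed
  then show ?thesis using that[of "max K K'" "max N N'"] K K' by auto
qed

text \<open>With zero forcing, the half-plane bound at x = 0 says that \<open>M \<zeta>\<close> has
  an inverse with entries of modulus at most K, uniformly in \<zeta>. The Leibniz formula bounds the
  determinant of this inverse, whose product with \<open>\<Delta> \<zeta>\<close> is 1.\<close>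

lemma \<Delta>_lower_bound:
  obtains N c where "N > 0" "c > 0" "\<And>\<zeta>. \<bar>Im \<zeta>\<bar> \<ge> N \<Longrightarrow> norm (\<Delta> \<zeta>) \<ge> c"
proof -
  obtain K N where K: "K \<ge> 0" and N: "N > 0" and b: "\<And>\<zeta> g y x. \<bar>Im \<zeta>\<bar> \<ge> N \<Longrightarrow> sol \<zeta> g y \<Longrightarrow> x \<in> {0..1} \<Longrightarrow>
      norm (y x) \<le> K * (norm (bd y) + L2_norm g / sqrt \<bar>Im \<zeta>\<bar>)"
    by (rule half_plane_bound) blast
  have inv: "norm c \<le> K * norm (M \<zeta> *v c)" if "\<bar>Im \<zeta>\<bar> \<ge> N" for c \<zeta>
  proof -
    have "T \<zeta> (\<lambda>x. 0) = (\<lambda>x. 0)"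
      using T_smult[OF L2_zero_fun, of \<zeta> 0] by simp
    then have "bd (T \<zeta> (\<lambda>x. 0)) = 0" by (simp add: bd_def)
    then have "bd (S \<zeta> c (\<lambda>x. 0)) = M \<zeta> *v c" using bd_S[OF L2_zero_fun, of \<zeta> c] by simp
    moreover have "L2_norm (\<lambda>x. 0 :: complex^'n) = 0" by (simp add: L2_norm_def)
    ultimately show ?thesis using b[OF that S_sol[OF L2_zero_fun, of \<zeta> c], of 0] S_init[OF L2_zero_fun, of \<zeta> c] by simp
  qed
  \<comment> \<open>Reciprocal of the Leibniz bound for the determinant of the inverse; the summand
    1 keeps the denominator positive even when K = 0.\<close>
  define c where "c = inverse (fact CARD('n) * K ^ CARD('n) + 1)"
  have "norm (\<Delta> \<zeta>) \<ge> c" if \<zeta>: "\<bar>Im \<zeta>\<bar> \<ge> N" for \<zeta>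
  proof -
    have "\<forall>x. M \<zeta> *v x = 0 \<longrightarrow> x = 0" using inv[OF \<zeta>] by (metis mult_zero_right norm_le_zero_iff norm_zero)
    then obtain X where X: "X ** M \<zeta> = mat 1" using matrix_left_invertible_ker by blast
    then have MX: "M \<zeta> ** X = mat 1" using matrix_left_right_inverse by blast
    have Xij: "norm (X $ i $ j) \<le> K" for i j
    proof -
      have "X $ i $ j = (X *v axis j 1) $ i" by (simp add: matrix_vector_mult_def axis_def mult_delta_right)
      also have "norm \<dots> \<le> norm (X *v axis j 1)" by (rule Finite_Cartesian_Product.norm_nth_le)
      also have "\<dots> \<le> K * norm (M \<zeta> *v (X *v axis j 1))" by (rule inv[OF \<zeta>])
      also have "M \<zeta> *v (X *v axis j 1) = axis j 1" using MX by (simp add: matrix_vector_mul_assoc)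
      also have "norm (axis j 1 :: complex^'n) = 1"
        by (simp add: norm_vec_def L2_set_def axis_def if_distrib[of norm] if_distrib[of "\<lambda>x. x\<^sup>2"] cong: if_cong)
      finally show ?thesis by simp
    qed
    have "norm (det X) \<le> (\<Sum>p\<in>{p. p permutes (UNIV::'n set)}. K ^ CARD('n))"
      unfolding det_def
    proof (rule order_trans[OF norm_sum sum_mono])
      fix p assume "p \<in> {p. p permutes (UNIV::'n set)}"
      have "norm (of_int (sign p) * (\<Prod>i\<in>UNIV. X $ i $ p i)) = (\<Prod>i\<in>UNIV. norm (X $ i $ p i))"
        by (simp add: norm_mult prod_norm sign_def)
      also have "\<dots> \<le> (\<Prod>i\<in>(UNIV::'n set). K)" by (rule prod_mono) (simp add: Xij)
      finally show "norm (of_int (sign p) * (\<Prod>i\<in>UNIV. X $ i $ p i)) \<le> K ^ CARD('n)" by simp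
    qed
    also have "\<dots> = fact CARD('n) * K ^ CARD('n)" by (simp add: card_permutations)
    finally have dX: "norm (det X) \<le> fact CARD('n) * K ^ CARD('n)" .
    have "det (M \<zeta>) * det X = 1" using MX by (metis det_I det_mul)
    then have "norm (\<Delta> \<zeta>) * norm (det X) = 1" unfolding \<Delta>_def by (metis norm_mult norm_one)
    moreover have "norm (\<Delta> \<zeta>) * norm (det X) \<le> norm (\<Delta> \<zeta>) * (fact CARD('n) * K ^ CARD('n) + 1)"
      using dX by (intro mult_left_mono) auto
    moreover have "fact CARD('n) * K ^ CARD('n) + 1 > (0::real)" using K by (intro add_nonneg_pos) auto
    ultimately show ?thesis unfolding c_def by (simp add: field_simps)
  qed
  moreover have "c > 0" unfolding c_def using K by (simp add: add_nonneg_pos)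
  ultimately show ?thesis using that N by blast
qed

lemma \<Delta>_nontrivial: obtains \<zeta> where "\<Delta> \<zeta> \<noteq> 0"
proof -
  obtain N c where "N > 0" "c > 0" "\<And>\<zeta>. \<bar>Im \<zeta>\<bar> \<ge> N \<Longrightarrow> norm (\<Delta> \<zeta>) \<ge> c" by (rule \<Delta>_lower_bound) blast
  from this(2) this(3)[of "\<i> * of_real N"] have "\<Delta> (\<i> * of_real N) \<noteq> 0" by force
  then show ?thesis by (rule that)
qed

text \<open>The decay in the half planes is used twice: it bounds the entire function outside a
  strip, and after Liouville's theorem it forces the constant to be zero.\<close>

theorem resolvent_functional_vanishes:
  assumes h: "h \<in> L2" and l: "bounded_functional l"
    and van: "\<And>\<mu> p. p < pole_order \<mu> \<Longrightarrow> l (residual \<mu> h p) = 0"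
    and \<zeta>: "\<Delta> \<zeta> \<noteq> 0"
  shows "l (R \<zeta> h) = 0"
proof -
  define f where "f = (\<lambda>\<zeta>. l (R \<zeta> h))"
  have fana: "f analytic_on {\<mu>}" if "\<Delta> \<mu> \<noteq> 0" for \<mu>
  proof -
    have "open {\<zeta>. \<Delta> \<zeta> \<noteq> 0}"
      using holomorphic_on_imp_continuous_on[OF holomorphic_\<Delta>[of UNIV]]
      by (intro open_Collect_neq) (auto intro: continuous_on_const)
    moreover have "f holomorphic_on {\<zeta>. \<Delta> \<zeta> \<noteq> 0}"
    proof (rule holomorphic_transform)
      show "(\<lambda>\<zeta>. G l h \<zeta> / \<Delta> \<zeta>) holomorphic_on {\<zeta>. \<Delta> \<zeta> \<noteq> 0}"
        by (intro holomorphic_intros holomorphic_G[OF h l] holomorphic_\<Delta>) auto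
    qed (simp add: f_def l_R[OF h l])
    ultimately show ?thesis using that analytic_at by blast
  qed
  have iso: "isolated_singularity_at f \<mu>" for \<mu>
  proof -
    have "eventually (\<lambda>z. \<Delta> z \<noteq> 0) (at \<mu>)"
      using eventually_\<Delta>_nonzero[OF \<zeta>, of \<mu>]
      by (subst at_to_0) (simp add: eventually_filtermap add.commute)
    then show ?thesis unfolding isolated_singularity_at_altdef
      by (rule eventually_mono) (rule fana)
  qed
  have lim: "\<exists>K. f \<midarrow>\<mu>\<rightarrow> K" for \<mu>
  proof -
    obtain K where "(\<lambda>z. l (R (\<mu> + z) h)) \<midarrow>0\<rightarrow> K"
      by (rule resolvent_removable[OF \<zeta> h l, of \<mu>]) (use van in auto)
    then have "f \<midarrow>\<mu>\<rightarrow> K" unfolding f_def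
      by (subst at_to_0) (simp add: filterlim_filtermap add.commute)
    then show ?thesis ..
  qed
  \<comment> \<open>At the zeros of \<open>\<Delta>\<close> the values of \<open>f\<close> are
    meaningless; they are replaced by the limits.\<close>
  define F where "F = remove_sings f"
  have "F analytic_on {\<mu>}" for \<mu> unfolding F_def using remove_sings_analytic_at[OF iso] lim by blast
  then have "F analytic_on UNIV" using analytic_on_analytic_at by blast
  then have Fh: "F holomorphic_on UNIV" by (rule analytic_imp_holomorphic)
  have Ff: "F \<mu> = f \<mu>" if "\<Delta> \<mu> \<noteq> 0" for \<mu> unfolding F_def by (rule remove_sings_at_analytic[OF fana[OF that]])
  obtain N c where N: "N > 0" and c: "c > 0" and low: "\<And>\<zeta>. \<bar>Im \<zeta>\<bar> \<ge> N \<Longrightarrow> norm (\<Delta> \<zeta>) \<ge> c" by (rule \<Delta>_lower_bound) blast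
  obtain K N' where K: "K \<ge> 0" and N': "N' > 0" and b: "\<And>\<zeta> g y x. \<bar>Im \<zeta>\<bar> \<ge> N' \<Longrightarrow> sol \<zeta> g y \<Longrightarrow> x \<in> {0..1} \<Longrightarrow>
      norm (y x) \<le> K * (norm (bd y) + L2_norm g / sqrt \<bar>Im \<zeta>\<bar>)"
    by (rule half_plane_bound) blast
  obtain L where L: "L \<ge> 0" "\<And>u m. u \<in> C01 \<Longrightarrow> (\<And>x. x \<in> {0..1} \<Longrightarrow> norm (u x) \<le> m) \<Longrightarrow> norm (l u) \<le> L * m"
    by (rule bounded_functional_bound[OF l]) blast
  define P where "P = max N N'"
  have P: "P > 0" using N by (simp add: P_def)
  define A where "A = L * (K * L2_norm h)"
  have A0: "A \<ge> 0" unfolding A_def using L(1) K L2_norm_nonneg[of h] by simp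
  have decay: "norm (F \<mu>) \<le> A / sqrt \<bar>Im \<mu>\<bar>" if "\<bar>Im \<mu>\<bar> \<ge> P" for \<mu>
  proof -
    have nz: "\<Delta> \<mu> \<noteq> 0" using low[of \<mu>] c that by (auto simp: P_def)
    have "norm (l (R \<mu> h)) \<le> L * (K * (L2_norm h / sqrt \<bar>Im \<mu>\<bar>))"
    proof (rule L(2)[OF R_C01[OF h]])
      fix x :: real assume "x \<in> {0..1}"
      from b[OF _ R_sol[OF h] this, of \<mu>] that R_bd[OF nz h]
      show "norm (R \<mu> h x) \<le> K * (L2_norm h / sqrt \<bar>Im \<mu>\<bar>)" by (simp add: P_def)
    qed
    then show ?thesis using Ff[OF nz] by (simp add: f_def A_def)
  qed
  have "\<exists>B. \<forall>\<zeta>. \<bar>Im \<zeta>\<bar> \<le> P \<longrightarrow> norm (F \<zeta>) \<le> B"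
  proof (rule entire_quotient_bounded_on_strip[OF Fh holomorphic_\<Delta>[of UNIV], of "G l h" c])
    show "\<exists>B. \<forall>\<zeta>. \<bar>Im \<zeta>\<bar> \<le> \<rho> \<longrightarrow> norm (G l h \<zeta>) \<le> B" for \<rho>
      using strip_bounded_G[OF h l] by (simp add: strip_bounded_def)
    show "\<exists>B. \<forall>\<zeta>. \<bar>Im \<zeta>\<bar> \<le> \<rho> \<longrightarrow> norm (\<Delta> \<zeta>) \<le> B" for \<rho>
      using strip_bounded_\<Delta> by (simp add: strip_bounded_def)
    show "c \<le> norm (\<Delta> \<zeta>)" if "Im \<zeta> = P" for \<zeta>
      using low[of \<zeta>] that P by (simp add: P_def)
  qed (auto simp: Ff f_def l_R[OF h l] c P)
  then obtain B where B: "\<And>\<zeta>. \<bar>Im \<zeta>\<bar> \<le> P \<Longrightarrow> norm (F \<zeta>) \<le> B" by blast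
  have "norm (F \<mu>) \<le> max B (A / sqrt P)" for \<mu>
  proof (cases "\<bar>Im \<mu>\<bar> \<le> P")
    case True then show ?thesis using B by (simp add: le_max_iff_disj)
  next
    case False
    then have "norm (F \<mu>) \<le> A / sqrt \<bar>Im \<mu>\<bar>" by (intro decay) simp
    also have "\<dots> \<le> A / sqrt P" using False P A0 by (intro divide_left_mono) auto
    finally show ?thesis by simp
  qed
  then have "bounded (range F)" unfolding bounded_iff by blast
  then obtain k where k: "\<And>\<mu>. F \<mu> = k" using Liouville_theorem[OF Fh] by (auto simp: constant_on_def)
  have "norm k \<le> A / sqrt t" if "t \<ge> P" for t
    using decay[of "\<i> * of_real t"] k that P by simp
  then have "eventually (\<lambda>t. norm k \<le> A / sqrt t) at_top" unfolding eventually_at_top_linorder by blast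
  moreover have "((\<lambda>t. A / sqrt t) \<longlongrightarrow> 0) at_top"
    by (intro real_tendsto_divide_at_top[OF tendsto_const] sqrt_at_top)
  ultimately have "norm k \<le> 0" by (intro tendsto_lowerbound) auto
  then show ?thesis using k[of \<zeta>] Ff[OF \<zeta>] by (simp add: f_def)
qed

end


section \<open>Density and separation in the space of square integrable functions\<close>

lemma L2_dominated_convergence:
  fixes f :: "real \<Rightarrow> 'a::euclidean_space" and s :: "nat \<Rightarrow> real \<Rightarrow> 'a"
  assumes "f \<in> borel_measurable (lebesgue_on {0..1})" "\<And>n. s n \<in> borel_measurable (lebesgue_on {0..1})"
    and w: "w \<in> L2" and fw: "\<And>x. x \<in> {0..1} \<Longrightarrow> norm (f x) \<le> (w x :: real)"
    and sw: "\<And>n x. x \<in> {0..1} \<Longrightarrow> norm (s n x) \<le> w x"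
    and lim: "AE x in lebesgue_on {0..1}. (\<lambda>n. s n x) \<longlonglongrightarrow> f x"
  shows "(\<lambda>n. L2_norm (\<lambda>x. f x - s n x)) \<longlonglongrightarrow> 0"
proof -
  have "(\<lambda>n. integral\<^sup>L (lebesgue_on {0..1}) (\<lambda>x. (norm (f x - s n x))\<^sup>2)) \<longlonglongrightarrow> integral\<^sup>L (lebesgue_on {0..1::real}) (\<lambda>x. 0 :: real)"
  proof (rule integral_dominated_convergence[where w = "\<lambda>x. 4 * (w x)\<^sup>2"])
    show "integrable (lebesgue_on {0..1}) (\<lambda>x. 4 * (w x)\<^sup>2)"
      using w by (simp add: L2_def)
    show "AE x in lebesgue_on {0..1}. norm ((norm (f x - s n x))\<^sup>2) \<le> 4 * (w x)\<^sup>2" for n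
    proof (rule AE_I2)
      fix x assume "x \<in> space (lebesgue_on {0..1::real})"
      then have "norm (f x - s n x) \<le> 2 * w x"
        using norm_triangle_ineq4[of "f x" "s n x"] fw[of x] sw[of x n] by auto
      then have "(norm (f x - s n x))\<^sup>2 \<le> (2 * w x)\<^sup>2" by (intro power_mono) auto
      then show "norm ((norm (f x - s n x))\<^sup>2) \<le> 4 * (w x)\<^sup>2" by (simp add: power_mult_distrib)
    qed
    show "AE x in lebesgue_on {0..1}. (\<lambda>n. (norm (f x - s n x))\<^sup>2) \<longlonglongrightarrow> 0"
      using lim
    proof (rule AE_mp, intro AE_I2 impI)
      fix x assume "(\<lambda>n. s n x) \<longlonglongrightarrow> f x"
      then have "(\<lambda>n. (norm (f x - s n x))\<^sup>2) \<longlonglongrightarrow> (norm (f x - f x))\<^sup>2" by (intro tendsto_intros)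
      then show "(\<lambda>n. (norm (f x - s n x))\<^sup>2) \<longlonglongrightarrow> 0" by simp
    qed
  qed (use assms(1,2) in measurable)
  from tendsto_real_sqrt[OF this] show ?thesis by (simp add: L2_norm_def)
qed

lemma L2_norm_triangle_diff:
  fixes f g h :: "real \<Rightarrow> 'a::euclidean_space"
  assumes "f \<in> L2" "g \<in> L2" "h \<in> L2"
  shows "L2_norm (\<lambda>x. f x - h x) \<le> L2_norm (\<lambda>x. f x - g x) + L2_norm (\<lambda>x. g x - h x)"
  using L2_norm_triangle[of "\<lambda>x. f x - g x" "\<lambda>x. g x - h x"] assms by (simp add: L2_diff)

lemma L2_norm_le_sup:
  fixes f :: "real \<Rightarrow> 'a::euclidean_space"
  assumes "f \<in> L2" "\<And>x. x \<in> {0..1} \<Longrightarrow> norm (f x) \<le> m"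
  shows "L2_norm f \<le> m"
proof -
  have m: "m \<ge> 0" using assms(2)[of 0] norm_ge_zero[of "f 0"] by (simp del: norm_ge_zero)
  have "L2_norm f \<le> L2_norm (\<lambda>x. m)" by (rule L2_norm_mono[OF assms(1) L2_const]) (use assms(2) m in auto)
  also have "\<dots> = m" using m by (simp add: L2_norm_def measure_restrict_space)
  finally show ?thesis .
qed

lemma L2_truncation_dense:
  fixes g :: "real \<Rightarrow> 'a::euclidean_space"
  assumes g: "g \<in> L2" and e: "e > 0"
  obtains k u where "k > 0" "u \<in> borel_measurable (lebesgue_on {0..1})" "\<And>x. norm (u x) \<le> k"
    "L2_norm (\<lambda>x. g x - u x) < e"
proof -
  define s where "s = (\<lambda>n x. if norm (g x) \<le> real (Suc n) then g x else 0)"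
  have gm: "g \<in> borel_measurable (lebesgue_on {0..1})" by (rule L2_measurable[OF g])
  have sm: "s n \<in> borel_measurable (lebesgue_on {0..1})" for n
    unfolding s_def using gm by measurable
  have "(\<lambda>n. L2_norm (\<lambda>x. g x - s n x)) \<longlonglongrightarrow> 0"
  proof (rule L2_dominated_convergence[OF gm sm L2_norm_fun[OF g]])
    show "AE x in lebesgue_on {0..1}. (\<lambda>n. s n x) \<longlonglongrightarrow> g x"
    proof (rule AE_I2)
      fix x
      obtain N :: nat where "norm (g x) \<le> real N" using real_arch_simple by blast
      then have "eventually (\<lambda>n. s n x = g x) sequentially"
        by (intro eventually_sequentiallyI[of N]) (auto simp: s_def)
      then show "(\<lambda>n. s n x) \<longlonglongrightarrow> g x" by (rule tendsto_eventually)
    qed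
  qed (auto simp: s_def)
  then have "eventually (\<lambda>n. L2_norm (\<lambda>x. g x - s n x) < e) sequentially" using e by (rule order_tendstoD)
  then obtain n where "L2_norm (\<lambda>x. g x - s n x) < e" by (auto simp: eventually_sequentially)
  moreover have "norm (s n x) \<le> real (Suc n)" for x by (auto simp: s_def)
  ultimately show ?thesis using that[of "real (Suc n)" "s n"] sm by auto
qed

text \<open>Measurability gives continuous functions converging almost everywhere, but without a
  common bound. Composing them with the nearest-point map onto a ball that contains the truncated
  values preserves continuity and the limit and supplies a dominating constant.\<close>

lemma L2_continuous_dense:
  fixes g :: "real \<Rightarrow> 'a::euclidean_space"
  assumes "g \<in> L2" "e > 0"
  obtains u where "continuous_on UNIV u" "L2_norm (\<lambda>x. g x - u x) < e"
proof -
  obtain k v where k: "k > 0" and v: "v \<in> borel_measurable (lebesgue_on {0..1})" "\<And>x. norm (v x) \<le> k"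
    and gv: "L2_norm (\<lambda>x. g x - v x) < e / 2"
    by (rule L2_truncation_dense[OF assms(1), of "e / 2"]) (use assms in auto)
  have v2: "v \<in> L2" by (rule L2_I_bounded[OF v(1)]) (use v(2) in blast)
  have "v measurable_on {0..1}" using v(1) by (simp add: measurable_on_iff_borel_measurable)
  then obtain N f where N: "negligible N" and f: "\<And>n::nat. continuous_on UNIV (f n)"
    and lim: "\<And>x. x \<notin> N \<Longrightarrow> (\<lambda>n. f n x) \<longlonglongrightarrow> (if x \<in> {0..1} then v x else 0)"
    unfolding measurable_on_def by blast
  let ?c = "closest_point (cball (0::'a) k)"
  have c: "continuous_on UNIV ?c" using k by (intro continuous_on_closest_point) auto
  have cn: "norm (?c z) \<le> k" for z using closest_point_in_set[of "cball (0::'a) k" z] k by auto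
  define s where "s = (\<lambda>n x. ?c (f n x))"
  have sc: "continuous_on UNIV (s n)" for n
    unfolding s_def by (rule continuous_on_compose2[OF c f]) auto
  have sm: "s n \<in> borel_measurable (lebesgue_on {0..1})" for n
    by (rule continuous_imp_measurable_on_sets_lebesgue[OF continuous_on_subset[OF sc]]) auto
  have "(\<lambda>n. L2_norm (\<lambda>x. v x - s n x)) \<longlonglongrightarrow> 0"
  proof (rule L2_dominated_convergence[OF v(1) sm L2_const[of k]])
    have "AE x in lebesgue. x \<in> {0..1} \<longrightarrow> (\<lambda>n. s n x) \<longlonglongrightarrow> v x"
    proof (rule AE_I'[of N])
      show "N \<in> null_sets lebesgue" using N by (simp add: negligible_iff_null_sets)
      show "{x \<in> space lebesgue. \<not> (x \<in> {0..1} \<longrightarrow> (\<lambda>n. s n x) \<longlonglongrightarrow> v x)} \<subseteq> N"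
      proof (rule ccontr)
        assume "\<not> ?thesis"
        then obtain x where x: "x \<notin> N" "x \<in> {0..1}" "\<not> (\<lambda>n. s n x) \<longlonglongrightarrow> v x" by blast
        have "(\<lambda>n. ?c (f n x)) \<longlonglongrightarrow> ?c (v x)"
          using lim[OF x(1)] x(2) c by (intro isCont_tendsto_compose[of _ ?c]) (auto simp: continuous_on_eq_continuous_at)
        moreover have "?c (v x) = v x" using v(2)[of x] by (intro closest_point_self) auto
        ultimately show False using x(3) by (simp add: s_def)
      qed
    qed
    then show "AE x in lebesgue_on {0..1}. (\<lambda>n. s n x) \<longlonglongrightarrow> v x" by (simp add: AE_restrict_space_iff)
  qed (auto simp: v(2) s_def cn)
  then have "eventually (\<lambda>n. L2_norm (\<lambda>x. v x - s n x) < e / 2) sequentially" using assms(2) by (intro order_tendstoD) auto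
  then obtain n where n: "L2_norm (\<lambda>x. v x - s n x) < e / 2" by (auto simp: eventually_sequentially)
  have "s n \<in> L2" by (rule continuous_on_imp_L2[OF continuous_on_subset[OF sc]]) auto
  from L2_norm_triangle_diff[OF assms(1) v2 this] n gv have "L2_norm (\<lambda>x. g x - s n x) < e" by simp
  then show ?thesis using that sc by blast
qed

text \<open>Functions vanishing at both end points satisfy any condition C y(0) + D y(1) = 0, so
  they will lie in the domain of the operator. They arise from polynomials by a cutoff that costs
  arbitrarily little in L2.\<close>

lemma L2_smooth_dense:
  fixes g :: "real \<Rightarrow> complex^'n"
  assumes g: "g \<in> L2" and e: "e > 0"
  obtains y y' where "y \<in> C01" "continuous_on {0..1} y'"
    "\<And>x. x \<in> {0..1} \<Longrightarrow> (y has_vector_derivative y' x) (at x within {0..1})"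
    "y 0 = 0" "y 1 = 0" "L2_norm (\<lambda>x. g x - y x) < e"
proof -
  have e3: "e / 3 > 0" using e by simp
  obtain u where u: "continuous_on UNIV u" "L2_norm (\<lambda>x. g x - u x) < e / 3"
    by (rule L2_continuous_dense[OF g e3])
  have u01: "continuous_on {0..1} u" by (rule continuous_on_subset[OF u(1)]) auto
  obtain P where P: "polynomial_function P" "\<And>x. x \<in> {0..1} \<Longrightarrow> norm (u x - P x) < e / 3"
    using Stone_Weierstrass_polynomial_function[OF compact_Icc u01 e3] by blast
  obtain P' where P': "polynomial_function P'" "\<And>x. (P has_vector_derivative P' x) (at x)"
    using has_vector_derivative_polynomial_function[OF P(1)] by blast
  have cP: "continuous_on A P" "continuous_on A P'" for A
    using P(1) P'(1) by (auto intro: continuous_on_polymonial_function)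
  \<comment> \<open>A polynomial cutoff: zero at 0 and 1, of modulus at most 1 on the interval, and
    tending to 1 at every interior point.\<close>
  define q where "q = (\<lambda>n (x::real). 1 - x ^ Suc n - (1 - x) ^ Suc n)"
  define s where "s = (\<lambda>n x. q n x *\<^sub>R P x)"
  have q1: "\<bar>q n x\<bar> \<le> 1" if "x \<in> {0..1}" for n x
  proof -
    have "x ^ Suc n \<le> x" "(1 - x) ^ Suc n \<le> 1 - x" "x ^ Suc n \<ge> 0" "(1 - x) ^ Suc n \<ge> 0"
      using that power_decreasing[of 1 "Suc n" x] power_decreasing[of 1 "Suc n" "1 - x"] by auto
    then show ?thesis unfolding q_def by linarith
  qed
  have Pm: "P \<in> borel_measurable (lebesgue_on {0..1})"
    by (rule continuous_imp_measurable_on_sets_lebesgue[OF cP(1)]) auto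
  have sc: "continuous_on A (s n)" for n A unfolding s_def q_def by (intro continuous_intros cP)
  have sm: "s n \<in> borel_measurable (lebesgue_on {0..1})" for n
    by (rule continuous_imp_measurable_on_sets_lebesgue[OF sc]) auto
  have P2: "P \<in> L2" by (rule continuous_on_imp_L2[OF cP(1)])
  have "(\<lambda>n. L2_norm (\<lambda>x. P x - s n x)) \<longlonglongrightarrow> 0"
  proof (rule L2_dominated_convergence[OF Pm sm L2_norm_fun[OF P2]])
    show "norm (s n x) \<le> norm (P x)" if "x \<in> {0..1}" for n x
      using q1[OF that, of n] by (simp add: s_def mult_left_le_one_le)
    have "AE x in lebesgue. x \<in> {0..1} \<longrightarrow> (\<lambda>n. s n x) \<longlonglongrightarrow> P x"
    proof (rule AE_I'[of "{0, 1}"])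
      show "{0, 1::real} \<in> null_sets lebesgue" by (simp add: negligible_iff_null_sets[symmetric])
      show "{x \<in> space lebesgue. \<not> (x \<in> {0..1} \<longrightarrow> (\<lambda>n. s n x) \<longlonglongrightarrow> P x)} \<subseteq> {0, 1}"
      proof (rule ccontr)
        assume "\<not> ?thesis"
        then obtain x where x: "x \<notin> {0, 1}" "x \<in> {0..1}" "\<not> (\<lambda>n. s n x) \<longlonglongrightarrow> P x" by blast
        then have "\<bar>x\<bar> < 1" "\<bar>1 - x\<bar> < 1" by auto
        then have "(\<lambda>n. x ^ Suc n) \<longlonglongrightarrow> 0" "(\<lambda>n. (1 - x) ^ Suc n) \<longlonglongrightarrow> 0"
          by (intro LIMSEQ_Suc LIMSEQ_power_zero; simp)+
        then have "(\<lambda>n. (1 - x ^ Suc n - (1 - x) ^ Suc n) *\<^sub>R P x) \<longlonglongrightarrow> (1 - 0 - 0) *\<^sub>R P x"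
          by (intro tendsto_intros)
        then show False using x(3) by (simp add: s_def q_def)
      qed
    qed
    then show "AE x in lebesgue_on {0..1}. (\<lambda>n. s n x) \<longlonglongrightarrow> P x" by (simp add: AE_restrict_space_iff)
  qed auto
  then have "eventually (\<lambda>n. L2_norm (\<lambda>x. P x - s n x) < e / 3) sequentially" using e3 by (intro order_tendstoD) auto
  then obtain n where n: "L2_norm (\<lambda>x. P x - s n x) < e / 3" by (auto simp: eventually_sequentially)
  define y where "y = (\<lambda>x. if x \<in> {0..1} then s n x else 0)"
  define q' where "q' = (\<lambda>x::real. - (real (Suc n) * x ^ n) + real (Suc n) * (1 - x) ^ n)"
  define y' where "y' = (\<lambda>x. q n x *\<^sub>R P' x + q' x *\<^sub>R P x)"
  have dq: "(q n has_real_derivative q' x) (at x)" for x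
    unfolding q_def q'_def by (rule derivative_eq_intros refl)+ simp
  have ds: "(s n has_vector_derivative y' x) (at x within {0..1})" for x
  proof -
    have "(s n has_vector_derivative y' x) (at x)"
      unfolding s_def y'_def by (rule has_vector_derivative_scaleR[OF dq P'(2)])
    then show ?thesis by (rule has_vector_derivative_at_within)
  qed
  have yc: "y \<in> C01"
  proof -
    have "continuous_on {0..1} y \<longleftrightarrow> continuous_on {0..1} (s n)"
      by (rule continuous_on_cong) (auto simp: y_def)
    then show ?thesis using sc by (auto simp: C01_def y_def)
  qed
  have dy: "(y has_vector_derivative y' x) (at x within {0..1})" if "x \<in> {0..1}" for x
    by (rule has_vector_derivative_transform[OF that _ ds]) (simp add: y_def)
  have y'c: "continuous_on {0..1} y'" unfolding y'_def q_def q'_def by (intro continuous_intros cP)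
  have L: "L2_norm (\<lambda>x. g x - y x) < e"
  proof -
    have u2: "u \<in> L2" by (rule continuous_on_imp_L2[OF u01])
    have "L2_norm (\<lambda>x. P x - y x) \<le> L2_norm (\<lambda>x. P x - s n x)"
      by (rule L2_norm_mono[OF L2_diff[OF P2 C01_L2[OF yc]] L2_diff[OF P2 continuous_on_imp_L2[OF sc]]]) (simp add: y_def)
    moreover have "L2_norm (\<lambda>x. u x - P x) \<le> e / 3"
      by (rule L2_norm_le_sup) (use P(2) in \<open>auto intro!: L2_diff u2 P2 less_imp_le\<close>)
    ultimately show ?thesis
      using L2_norm_triangle_diff[OF g u2 C01_L2[OF yc]] L2_norm_triangle_diff[OF u2 P2 C01_L2[OF yc]] u(2) n by linarith
  qed
  have "y 0 = 0" "y 1 = 0" by (simp_all add: y_def s_def q_def)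
  then show ?thesis using that[OF yc y'c dy _ _ L] by blast
qed

section \<open>Functionals on L2 and separation from a closed span\<close>

definition L2_functional :: "((real \<Rightarrow> complex^'n) \<Rightarrow> complex) \<Rightarrow> bool" where
  "L2_functional l \<longleftrightarrow>
     (\<forall>u\<in>L2. \<forall>v\<in>L2. l (\<lambda>x. u x + v x) = l u + l v) \<and>
     (\<forall>c. \<forall>u\<in>L2. l (\<lambda>x. c *s u x) = c * l u) \<and>
     (\<exists>K. \<forall>u\<in>L2. norm (l u) \<le> K * L2_norm u)"

lemma L2_functional_imp_bounded_functional:
  assumes "L2_functional l" shows "bounded_functional l"
proof -
  obtain K where K: "\<And>u. u \<in> L2 \<Longrightarrow> norm (l u) \<le> K * L2_norm u" using assms unfolding L2_functional_def by blast
  have "norm (l u) \<le> \<bar>K\<bar> * m" if u: "u \<in> C01" "\<forall>x\<in>{0..1}. norm (u x) \<le> m" for u m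
  proof -
    have "norm (l u) \<le> \<bar>K\<bar> * L2_norm u"
      using K[OF C01_L2[OF u(1)]] mult_right_mono[OF abs_ge_self L2_norm_nonneg, of K u] by linarith
    also have "\<dots> \<le> \<bar>K\<bar> * m" using L2_norm_le_sup[OF C01_L2[OF u(1)], of m] u(2) by (intro mult_left_mono) auto
    finally show ?thesis .
  qed
  then show ?thesis using assms C01_L2 unfolding L2_functional_def bounded_functional_def by blast
qed

lemma cfun_span_L2:
  assumes "X \<subseteq> L2" "h \<in> cfun.span X" shows "h \<in> L2"
  using assms(2)
proof (induction rule: cfun.span_induct_alt)
  case base show ?case by (rule L2_zero)
next
  case (step c x y)
  have "(\<lambda>t. c *s x t + y t) \<in> L2" using step assms(1) by (intro L2_add L2_smult) auto
  then show ?case by (simp add: plus_fun_def)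
qed

lemma L2_functional_span_zero:
  assumes l: "L2_functional l" and X: "X \<subseteq> L2" "\<And>u. u \<in> X \<Longrightarrow> l u = 0" and h: "h \<in> cfun.span X"
  shows "l h = 0"
proof -
  have "h \<in> L2 \<and> l h = 0"
    using h
  proof (induction rule: cfun.span_induct_alt)
    case base
    have "l (\<lambda>x. 0 *s (0::real \<Rightarrow> complex^'a) x) = 0 * l 0" using l L2_zero unfolding L2_functional_def by blast
    then show ?case using L2_zero by (simp add: zero_fun_def)
  next
    case (step c x y)
    then have x: "x \<in> L2" "y \<in> L2" "l x = 0" "l y = 0" using X by auto
    have "l (\<lambda>t. c *s x t + y t) = l (\<lambda>t. c *s x t) + l y"
      by (rule l[unfolded L2_functional_def, THEN conjunct1, rule_format, OF L2_smult[OF x(1)] x(2)])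
    also have "l (\<lambda>t. c *s x t) = c * l x" using l x(1) unfolding L2_functional_def by blast
    finally have "l (\<lambda>t. c *s x t + y t) = 0" using x by simp
    then show ?case using x by (simp add: plus_fun_def L2_add L2_smult)
  qed
  then show ?thesis ..
qed

text \<open>A real inner product; for complex vectors it is the real part of the Hermitian one, and
  complex functionals are recovered from it afterwards.\<close>

definition L2_ip :: "(real \<Rightarrow> 'a::euclidean_space) \<Rightarrow> (real \<Rightarrow> 'a) \<Rightarrow> real" where
  "L2_ip f g = integral {0..1} (\<lambda>x. inner (f x) (g x))"

lemma L2_inner_integrable_on:
  fixes f g :: "real \<Rightarrow> 'a::euclidean_space"
  assumes f: "f \<in> L2" and g: "g \<in> L2"
  shows "(\<lambda>x. inner (f x) (g x)) integrable_on {0..1}"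
proof -
  have "(\<lambda>x. inner (f x) (g x)) absolutely_integrable_on {0..1}"
  proof (rule measurable_bounded_by_integrable_imp_absolutely_integrable)
    show "(\<lambda>x. norm (f x) * norm (g x)) integrable_on {0..1}"
      using L2_mult_absolutely_integrable[OF L2_norm_fun[OF f] L2_norm_fun[OF g]] absolutely_integrable_on_def by blast
    show "(\<lambda>x. inner (f x) (g x)) \<in> borel_measurable (lebesgue_on {0..1})"
      using L2_measurable[OF f] L2_measurable[OF g] by (rule borel_measurable_inner)
  qed (auto simp: Cauchy_Schwarz_ineq2)
  then show ?thesis using absolutely_integrable_on_def by blast
qed

lemma L2_ip_add:
  fixes f g h :: "real \<Rightarrow> 'a::euclidean_space"
  assumes "f \<in> L2" "g \<in> L2" "h \<in> L2" shows "L2_ip (\<lambda>x. f x + g x) h = L2_ip f h + L2_ip g h"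
  unfolding L2_ip_def inner_add_left
  by (rule Henstock_Kurzweil_Integration.integral_add) (auto intro: L2_inner_integrable_on assms)

lemma L2_ip_diff:
  fixes f g h :: "real \<Rightarrow> 'a::euclidean_space"
  assumes "f \<in> L2" "g \<in> L2" "h \<in> L2" shows "L2_ip (\<lambda>x. f x - g x) h = L2_ip f h - L2_ip g h"
  unfolding L2_ip_def inner_diff_left
  by (rule Henstock_Kurzweil_Integration.integral_diff) (auto intro: L2_inner_integrable_on assms)

lemma L2_ip_scaleR: "L2_ip (\<lambda>x. c *\<^sub>R f x) h = c * L2_ip f h"
  unfolding L2_ip_def inner_scaleR_left by simp

lemma L2_ip_commute: "L2_ip f g = L2_ip g f"
  unfolding L2_ip_def by (simp add: inner_commute)

lemma L2_ip_self: "f \<in> L2 \<Longrightarrow> L2_ip f f = (L2_norm f)\<^sup>2"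
  unfolding L2_ip_def L2_norm_power2 by (simp add: power2_norm_eq_inner)

lemma L2_norm_diff_scaleR:
  fixes f g :: "real \<Rightarrow> 'a::euclidean_space"
  assumes "f \<in> L2" "g \<in> L2"
  shows "(L2_norm (\<lambda>x. f x - t *\<^sub>R g x))\<^sup>2 = (L2_norm f)\<^sup>2 - 2 * t * L2_ip f g + t\<^sup>2 * (L2_norm g)\<^sup>2"
proof -
  have tg: "(\<lambda>x. t *\<^sub>R g x) \<in> L2" by (rule L2_bounded_linear[OF assms(2) bounded_linear_scaleR_right])
  note fg = L2_diff[OF assms(1) tg]
  have "(L2_norm (\<lambda>x. f x - t *\<^sub>R g x))\<^sup>2 = L2_ip (\<lambda>x. f x - t *\<^sub>R g x) (\<lambda>x. f x - t *\<^sub>R g x)"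
    by (rule L2_ip_self[OF fg, symmetric])
  also have "\<dots> = L2_ip f (\<lambda>x. f x - t *\<^sub>R g x) - t * L2_ip g (\<lambda>x. f x - t *\<^sub>R g x)"
    by (simp add: L2_ip_diff[OF assms(1) tg fg] L2_ip_scaleR)
  also have "\<dots> = (L2_ip f f - t * L2_ip g f) - t * (L2_ip f g - t * L2_ip g g)"
    unfolding L2_ip_commute[of _ "\<lambda>x. f x - t *\<^sub>R g x"]
    by (simp add: L2_ip_diff[OF assms(1) tg assms(1)] L2_ip_diff[OF assms(1) tg assms(2)] L2_ip_scaleR)
  finally show ?thesis
    by (simp add: L2_ip_self assms L2_ip_commute[of g f] power2_eq_square algebra_simps)
qed

lemma L2_Cauchy_Schwarz:
  fixes f g :: "real \<Rightarrow> 'a::euclidean_space"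
  assumes "f \<in> L2" "g \<in> L2" shows "\<bar>L2_ip f g\<bar> \<le> L2_norm f * L2_norm g"
proof -
  have "(L2_ip f g)\<^sup>2 \<le> (L2_norm f)\<^sup>2 * (L2_norm g)\<^sup>2"
  proof (rule quadratic_nonneg_discriminant)
    fix t show "0 \<le> (L2_norm f)\<^sup>2 - 2 * t * L2_ip f g + t\<^sup>2 * (L2_norm g)\<^sup>2"
      unfolding L2_norm_diff_scaleR[OF assms, symmetric] by simp
  qed simp
  then have "(L2_ip f g)\<^sup>2 \<le> (L2_norm f * L2_norm g)\<^sup>2" by (simp add: power_mult_distrib)
  then show ?thesis by (rule power2_le_imp_le[of "\<bar>L2_ip f g\<bar>", simplified]) (simp add: L2_norm_nonneg)
qed

text \<open>The functional is the limit of the inner products with a minimizing sequence for the distance to the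
  span; this avoids the completeness of the space of square integrable functions.\<close>

proposition separating_functional:
  fixes y :: "real \<Rightarrow> complex^'n"
  assumes X: "X \<subseteq> L2" and y: "y \<in> L2" "y \<notin> closed_span X"
  obtains l where "L2_functional l" "\<And>u. u \<in> X \<Longrightarrow> l u = 0" "l y \<noteq> 0"
proof -
  let ?V = "cfun.span X"
  have V2: "h \<in> L2" if "h \<in> ?V" for h by (rule cfun_span_L2[OF X that])
  have Vadd: "(\<lambda>x. h x + k x) \<in> ?V" if "h \<in> ?V" "k \<in> ?V" for h k
    using cfun.span_add[OF that] by (simp add: plus_fun_def)
  have Vsm: "(\<lambda>x. c *s h x) \<in> ?V" if "h \<in> ?V" for h c
    using cfun.span_scale[OF that] by simp
  have Vdiff: "(\<lambda>x. h x - k x) \<in> ?V" if "h \<in> ?V" "k \<in> ?V" for h k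
    using cfun.span_diff[OF that] by (simp add: fun_diff_def)
  have Vsc: "(\<lambda>x. t *\<^sub>R h x) \<in> ?V" if "h \<in> ?V" for h t
  proof -
    have "(\<lambda>x. t *\<^sub>R h x) = (\<lambda>x. complex_of_real t *s h x)"
      unfolding fun_eq_iff vec_eq_iff vector_scaleR_component vector_smult_component by (simp add: scaleR_conv_of_real)
    then show ?thesis using Vsm[OF that, of "of_real t"] by simp
  qed
  obtain \<epsilon> where \<epsilon>: "\<epsilon> > 0" "\<And>h. h \<in> ?V \<Longrightarrow> L2_norm (\<lambda>x. y x - h x) \<ge> \<epsilon>"
    using y unfolding closed_span_def by (auto simp: fun_diff_def not_less)
  \<comment> \<open>Squared distance from \<open>y\<close>. Its infimum \<open>d\<close> over the
    span is positive because \<open>y\<close> is not in the closed span.\<close>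
  define N where "N = (\<lambda>h. (L2_norm (\<lambda>x. y x - h x))\<^sup>2)"
  define d where "d = Inf (N ` ?V)"
  have ne: "N ` ?V \<noteq> {}" using cfun.span_zero by blast
  have low: "\<epsilon>\<^sup>2 \<le> N h" if "h \<in> ?V" for h unfolding N_def using \<epsilon> that by (intro power_mono) auto
  have bdd: "bdd_below (N ` ?V)" using low by (auto intro!: bdd_belowI[of _ "\<epsilon>\<^sup>2"])
  have d_le: "d \<le> N h" if "h \<in> ?V" for h unfolding d_def using that bdd by (intro cInf_lower) auto
  have "d \<ge> \<epsilon>\<^sup>2" unfolding d_def using ne low by (intro cInf_greatest) auto
  then have d: "d > 0" using \<epsilon>(1) by (meson less_le_trans zero_less_power)
  define \<delta> where "\<delta> = (\<lambda>k::nat. 1 / real (Suc k))"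
  have \<delta>: "\<delta> k > 0" "\<delta> k \<le> 1" for k by (auto simp: \<delta>_def)
  have "\<exists>h. h \<in> ?V \<and> N h < d + \<delta> k" for k
    using cInf_lessD[OF ne, of "d + \<delta> k"] \<delta>[of k] unfolding d_def by auto
  then obtain H where H: "\<And>k. H k \<in> ?V" "\<And>k. N (H k) < d + \<delta> k" by metis
  define u where "u = (\<lambda>k x. y x - H k x)"
  have u2: "u k \<in> L2" for k unfolding u_def by (intro L2_diff y V2 H)
  have Nu: "(L2_norm (u k))\<^sup>2 = N (H k)" for k by (simp add: u_def N_def)
  \<comment> \<open>Near-minimality forces near-orthogonality: moving along \<open>s\<close> lowers
    the squared distance by at most \<open>\<delta> k\<close>, and the discriminant inequality turns
    this into a bound for the inner product.\<close>
  have orth: "\<bar>L2_ip (u k) s\<bar> \<le> L2_norm s * sqrt (\<delta> k)" if s: "s \<in> ?V" for s k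
  proof -
    have "(L2_ip (u k) s)\<^sup>2 \<le> \<delta> k * (L2_norm s)\<^sup>2"
    proof (rule quadratic_nonneg_discriminant)
      fix t
      have "d \<le> N (\<lambda>x. H k x + t *\<^sub>R s x)" by (intro d_le Vadd Vsc H s)
      also have "\<dots> = (L2_norm (\<lambda>x. u k x - t *\<^sub>R s x))\<^sup>2" by (simp add: N_def u_def algebra_simps)
      also have "\<dots> = (L2_norm (u k))\<^sup>2 - 2 * t * L2_ip (u k) s + t\<^sup>2 * (L2_norm s)\<^sup>2"
        by (rule L2_norm_diff_scaleR[OF u2 V2[OF s]])
      finally show "0 \<le> \<delta> k - 2 * t * L2_ip (u k) s + t\<^sup>2 * (L2_norm s)\<^sup>2" using H(2)[of k] Nu[of k] by simp
    qed simp
    also have "\<dots> = (L2_norm s * sqrt (\<delta> k))\<^sup>2" using \<delta>[of k] by (simp add: power_mult_distrib)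
    finally have "(L2_ip (u k) s)\<^sup>2 \<le> (L2_norm s * sqrt (\<delta> k))\<^sup>2" .
    then show ?thesis using power2_le_imp_le[of "\<bar>L2_ip (u k) s\<bar>" "L2_norm s * sqrt (\<delta> k)"] L2_norm_nonneg[of s] \<delta>[of k] by simp
  qed
  \<comment> \<open>The difference of two members of the sequence lies in the span, so it may be
    tested against itself.\<close>
  have cau: "L2_norm (\<lambda>x. u k x - u j x) \<le> sqrt (\<delta> k) + sqrt (\<delta> j)" for k j
  proof -
    let ?s = "\<lambda>x. u k x - u j x"
    have eq: "?s = (\<lambda>x. H j x - H k x)" by (simp add: u_def)
    have s: "?s \<in> ?V" unfolding eq by (intro Vdiff H)
    have "(L2_norm ?s)\<^sup>2 = L2_ip (u k) ?s - L2_ip (u j) ?s"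
      using L2_ip_self[OF V2[OF s]] L2_ip_diff[OF u2 u2 V2[OF s], of k j] by simp
    also have "\<dots> \<le> L2_norm ?s * (sqrt (\<delta> k) + sqrt (\<delta> j))"
      using orth[OF s, of k] orth[OF s, of j] by (simp add: algebra_simps abs_le_iff)
    finally have *: "L2_norm ?s * L2_norm ?s \<le> L2_norm ?s * (sqrt (\<delta> k) + sqrt (\<delta> j))" by (simp add: power2_eq_square)
    show ?thesis
    proof (cases "L2_norm ?s = 0")
      case True then show ?thesis using \<delta>[of k] \<delta>[of j] by simp
    next
      case False
      then have "L2_norm ?s > 0" using L2_norm_nonneg[of ?s] by linarith
      then show ?thesis using * by (simp only: mult_le_cancel_left_pos)
    qed
  qed
  have \<delta>lim: "(\<lambda>k. sqrt (\<delta> k)) \<longlonglongrightarrow> 0"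
    using tendsto_real_sqrt[OF LIMSEQ_Suc[OF lim_1_over_n]] by (simp add: \<delta>_def)
  have conv: "convergent (\<lambda>k. L2_ip v (u k))" if v: "v \<in> L2" for v
  proof (rule Cauchy_convergent, rule metric_CauchyI)
    fix e :: real assume e: "e > 0"
    have nv: "L2_norm v + 1 > 0" using L2_norm_nonneg[of v] by simp
    then have "e / (2 * (L2_norm v + 1)) > 0" using e by simp
    from order_tendstoD(2)[OF \<delta>lim this] obtain M where M: "\<And>k. k \<ge> M \<Longrightarrow> sqrt (\<delta> k) < e / (2 * (L2_norm v + 1))"
      unfolding eventually_sequentially by blast
    have "dist (L2_ip v (u k)) (L2_ip v (u j)) < e" if "k \<ge> M" "j \<ge> M" for k j
    proof -
      have "L2_ip v (u k) - L2_ip v (u j) = L2_ip v (\<lambda>x. u k x - u j x)"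
        unfolding L2_ip_commute[of v] by (rule L2_ip_diff[OF u2 u2 v, symmetric])
      then have "dist (L2_ip v (u k)) (L2_ip v (u j)) \<le> L2_norm v * L2_norm (\<lambda>x. u k x - u j x)"
        using L2_Cauchy_Schwarz[OF v L2_diff[OF u2 u2], of k j] by (simp add: dist_real_def)
      also have "\<dots> \<le> (L2_norm v + 1) * (sqrt (\<delta> k) + sqrt (\<delta> j))"
        using L2_norm_nonneg[of v] \<delta> by (intro mult_mono cau) (auto simp: L2_norm_nonneg)
      also have "\<dots> < (L2_norm v + 1) * (e / (2 * (L2_norm v + 1)) + e / (2 * (L2_norm v + 1)))"
        using M[OF that(1)] M[OF that(2)] nv by (intro mult_strict_left_mono add_strict_mono) auto
      also have "\<dots> = e"
      proof -
        have "a * (e / (2 * a) + e / (2 * a)) = e" if "a > 0" for a :: real using that by (simp add: field_simps)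
        from this[OF nv] show ?thesis .
      qed
      finally show ?thesis .
    qed
    then show "\<exists>M. \<forall>m\<ge>M. \<forall>n\<ge>M. dist (L2_ip v (u m)) (L2_ip v (u n)) < e" by blast
  qed
  define \<phi> where "\<phi> = (\<lambda>v. lim (\<lambda>k. L2_ip v (u k)))"
  have \<phi>: "(\<lambda>k. L2_ip v (u k)) \<longlonglongrightarrow> \<phi> v" if "v \<in> L2" for v
    unfolding \<phi>_def using conv[OF that] by (simp add: convergent_LIMSEQ_iff)
  have \<phi>add: "\<phi> (\<lambda>x. v x + w x) = \<phi> v + \<phi> w" if "v \<in> L2" "w \<in> L2" for v w
  proof (rule LIMSEQ_unique[OF \<phi>[OF L2_add[OF that]]])
    show "(\<lambda>k. L2_ip (\<lambda>x. v x + w x) (u k)) \<longlonglongrightarrow> \<phi> v + \<phi> w"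
      unfolding L2_ip_add[OF that u2] by (intro tendsto_add \<phi> that)
  qed
  have \<phi>sc: "\<phi> (\<lambda>x. t *\<^sub>R v x) = t * \<phi> v" if "v \<in> L2" for t v
  proof (rule LIMSEQ_unique[OF \<phi>])
    show "(\<lambda>x. t *\<^sub>R v x) \<in> L2" by (rule L2_bounded_linear[OF that bounded_linear_scaleR_right])
    show "(\<lambda>k. L2_ip (\<lambda>x. t *\<^sub>R v x) (u k)) \<longlonglongrightarrow> t * \<phi> v"
      unfolding L2_ip_scaleR by (intro tendsto_mult_left \<phi> that)
  qed
  have nu: "L2_norm (u k) \<le> sqrt (d + 1)" for k
    using Nu[of k] H(2)[of k] \<delta>[of k] by (intro real_le_rsqrt) auto
  have \<phi>bd: "\<bar>\<phi> v\<bar> \<le> sqrt (d + 1) * L2_norm v" if v: "v \<in> L2" for v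
  proof (rule tendsto_upperbound[OF tendsto_rabs[OF \<phi>[OF v]]])
    show "\<forall>\<^sub>F k in sequentially. \<bar>L2_ip v (u k)\<bar> \<le> sqrt (d + 1) * L2_norm v"
    proof (rule always_eventually, rule allI)
      fix k
      have "\<bar>L2_ip v (u k)\<bar> \<le> L2_norm v * L2_norm (u k)" by (rule L2_Cauchy_Schwarz[OF v u2])
      also have "\<dots> \<le> L2_norm v * sqrt (d + 1)" by (intro mult_left_mono nu L2_norm_nonneg)
      finally show "\<bar>L2_ip v (u k)\<bar> \<le> sqrt (d + 1) * L2_norm v" by (simp add: mult.commute)
    qed
  qed simp
  have \<phi>V: "\<phi> s = 0" if s: "s \<in> ?V" for s
  proof (rule LIMSEQ_unique[OF \<phi>[OF V2[OF s]]])
    have "(\<lambda>k. L2_norm s * sqrt (\<delta> k)) \<longlonglongrightarrow> L2_norm s * 0" by (intro tendsto_mult_left \<delta>lim)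
    then have "(\<lambda>k. L2_norm s * sqrt (\<delta> k)) \<longlonglongrightarrow> 0" by simp
    then show "(\<lambda>k. L2_ip s (u k)) \<longlonglongrightarrow> 0"
      by (rule Lim_null_comparison[rotated]) (use orth[OF s] in \<open>auto intro!: always_eventually simp: L2_ip_commute[of s]\<close>)
  qed
  \<comment> \<open>Here y = u k + H k. The first summand contributes at least \<open>d\<close>; the
    second is almost orthogonal to \<open>u k\<close>, uniformly in k because the norms of
    \<open>H k\<close> are bounded.\<close>
  have \<phi>y: "\<phi> y \<ge> d"
  proof -
    let ?B = "L2_norm y + sqrt (d + 1)"
    have hb: "L2_norm (H k) \<le> ?B" for k
    proof -
      have "L2_norm (\<lambda>x. (y x - u k x)) \<le> L2_norm y + L2_norm (\<lambda>x. (-1) *\<^sub>R u k x)"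
        using L2_norm_triangle[OF y(1) L2_bounded_linear[OF u2 bounded_linear_scaleR_right], of "-1" k] by simp
      moreover have "L2_norm (\<lambda>x. (-1) *\<^sub>R u k x) = L2_norm (u k)" by (simp add: L2_norm_def)
      ultimately show ?thesis using nu[of k] by (simp add: u_def)
    qed
    have lb: "d - ?B * sqrt (\<delta> k) \<le> L2_ip y (u k)" for k
    proof -
      have "y = (\<lambda>x. u k x + H k x)" by (simp add: u_def)
      then have "L2_ip y (u k) = L2_ip (u k) (u k) + L2_ip (H k) (u k)"
        using L2_ip_add[OF u2 V2[OF H(1)] u2, of k k k] by simp
      moreover have "L2_ip (u k) (u k) \<ge> d" using d_le[OF H(1)[of k]] by (simp add: L2_ip_self[OF u2] Nu)
      moreover have "\<bar>L2_ip (H k) (u k)\<bar> \<le> ?B * sqrt (\<delta> k)"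
        unfolding L2_ip_commute[of "H k"]
        by (rule order_trans[OF orth[OF H(1)] mult_right_mono[OF hb]]) (use \<delta>[of k] in simp)
      ultimately show ?thesis by linarith
    qed
    have "(\<lambda>k. d - ?B * sqrt (\<delta> k)) \<longlonglongrightarrow> d - ?B * 0" by (intro tendsto_intros \<delta>lim)
    then have "(\<lambda>k. d - ?B * sqrt (\<delta> k)) \<longlonglongrightarrow> d" by simp
    then show ?thesis by (rule LIMSEQ_le[OF _ \<phi>[OF y(1)]]) (use lb in blast)
  qed
  \<comment> \<open>The complex-linear functional whose real part is the real-linear \<phi>.\<close>
  define l where "l = (\<lambda>v. of_real (\<phi> v) - \<i> * of_real (\<phi> (\<lambda>x. \<i> *s v x)))"
  have lsm: "l (\<lambda>x. c *s v x) = c * l v" if v: "v \<in> L2" for c v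
  proof -
    have iv: "(\<lambda>x. \<i> *s v x) \<in> L2" by (rule L2_smult[OF v])
    have sc: "(\<lambda>x. t *\<^sub>R w x) \<in> L2" if "w \<in> L2" for t and w :: "real \<Rightarrow> complex^'n"
      by (rule L2_bounded_linear[OF that bounded_linear_scaleR_right])
    have e1: "(\<lambda>x. c *s v x) = (\<lambda>x. Re c *\<^sub>R v x + Im c *\<^sub>R (\<i> *s v x))"
      by (simp add: fun_eq_iff vec_eq_iff complex_eq_iff algebra_simps)
    have e2: "(\<lambda>x. \<i> *s (c *s v x)) = (\<lambda>x. Re c *\<^sub>R (\<i> *s v x) + (- Im c) *\<^sub>R v x)"
      by (simp add: fun_eq_iff vec_eq_iff complex_eq_iff algebra_simps)
    show ?thesis
      unfolding l_def e1[symmetric, THEN arg_cong[of _ _ \<phi>], symmetric] e2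
      using \<phi>add[OF sc[OF v] sc[OF iv], of "Re c" "Im c"] \<phi>add[OF sc[OF iv] sc[OF v], of "Re c" "- Im c"]
        \<phi>sc[OF v, of "Re c"] \<phi>sc[OF v, of "- Im c"] \<phi>sc[OF iv, of "Re c"] \<phi>sc[OF iv, of "Im c"] e1 e2
      by (simp add: complex_eq_iff algebra_simps)
  qed
  have ladd: "l (\<lambda>x. v x + w x) = l v + l w" if "v \<in> L2" "w \<in> L2" for v w
    using \<phi>add[OF that] \<phi>add[OF L2_smult[OF that(1), of \<i>] L2_smult[OF that(2), of \<i>]]
    by (simp add: l_def vec.scale_right_distrib algebra_simps)
  have lbd: "norm (l v) \<le> (2 * sqrt (d + 1)) * L2_norm v" if v: "v \<in> L2" for v
  proof -
    have "norm (l v) \<le> \<bar>\<phi> v\<bar> + \<bar>\<phi> (\<lambda>x. \<i> *s v x)\<bar>"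
      unfolding l_def using norm_triangle_ineq4[of "of_real (\<phi> v)" "\<i> * of_real (\<phi> (\<lambda>x. \<i> *s v x))"] by (simp add: norm_mult)
    moreover have "L2_norm (\<lambda>x. \<i> *s v x) = L2_norm v"
      by (simp add: L2_norm_def norm_vec_def norm_mult)
    ultimately show ?thesis using \<phi>bd[OF v] \<phi>bd[OF L2_smult[OF v, of \<i>]] by simp
  qed
  have "L2_functional l" unfolding L2_functional_def using lsm ladd lbd by blast
  moreover have "l s = 0" if "s \<in> X" for s
    using \<phi>V[OF cfun.span_base[OF that]] \<phi>V[OF Vsm[OF cfun.span_base[OF that]], of \<i>] by (simp add: l_def)
  moreover have "Re (l y) = \<phi> y" by (simp add: l_def)
  then have "l y \<noteq> 0" using \<phi>y d by auto
  ultimately show ?thesis using that by blast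
qed

text \<open>Finite-dimensional spaces are closed even under pointwise limits, where no norm is at
  hand. The coefficients \<open>c k\<close> of the last vector might be unbounded, so the pair (1, c
  k) is normalized and a convergent subsequence on the unit sphere is taken.\<close>

lemma cfun_span_pointwise_closed:
  fixes h :: "nat \<Rightarrow> real \<Rightarrow> complex^'n"
  assumes "finite A" "\<And>k. h k \<in> cfun.span A" "\<And>x. (\<lambda>k. h k x) \<longlonglongrightarrow> g x"
  shows "g \<in> cfun.span A"
  using assms
proof (induction A arbitrary: h g rule: finite_induct)
  case empty
  then have "h k = 0" for k by simp
  then have "(\<lambda>k. 0) \<longlonglongrightarrow> g x" for x using empty.prems(2)[of x] by simp
  then have "g x = 0" for x using LIMSEQ_unique tendsto_const by metis
  then have "g = 0" by (simp add: fun_eq_iff)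
  then show ?case by (simp only: cfun.span_zero)
next
  case (insert e A)
  show ?case
  proof (cases "e \<in> cfun.span A")
    case True
    then have "cfun.span (insert e A) = cfun.span A" by (rule cfun.span_redundant)
    then show ?thesis using insert.IH[of h g] insert.prems by simp
  next
    case False
    have "\<forall>k. \<exists>c. h k - (\<lambda>x. c *s e x) \<in> cfun.span A"
      using insert.prems(1) unfolding cfun.span_breakdown_eq by blast
    then obtain c where c: "\<And>k. h k - (\<lambda>x. c k *s e x) \<in> cfun.span A" by metis
    define v where "v = (\<lambda>k. sgn (1::complex, c k))"
    have "norm (v k) = 1" for k unfolding v_def by (simp add: norm_sgn zero_prod_def)
    then have "\<forall>k. v k \<in> sphere 0 1" by simp
    then obtain L r where L: "L \<in> sphere 0 1" and r: "strict_mono (r :: nat \<Rightarrow> nat)" and lim: "(v \<circ> r) \<longlonglongrightarrow> L"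
      using compact_imp_seq_compact[OF compact_sphere[of "0 :: complex \<times> complex" 1]] unfolding seq_compact_def by metis
    have vk: "snd (v k) = fst (v k) * c k" for k
      unfolding v_def sgn_prod_def by (simp add: scaleR_conv_of_real)
    let ?\<alpha> = "fst L" and ?\<beta> = "snd L"
    have "(\<lambda>x. ?\<alpha> *s g x - ?\<beta> *s e x) \<in> cfun.span A"
    proof (rule insert.IH)
      fix k
      have "(\<lambda>x. fst (v (r k)) *s (h (r k) - (\<lambda>x. c (r k) *s e x)) x) \<in> cfun.span A"
        by (rule cfun.span_scale[OF c])
      then show "(\<lambda>x. fst (v (r k)) *s h (r k) x - snd (v (r k)) *s e x) \<in> cfun.span A"
        by (simp add: vk vec.scale_right_diff_distrib vector_smult_assoc)
    next
      fix x
      have a: "(\<lambda>k. fst (v (r k))) \<longlonglongrightarrow> ?\<alpha>" and b: "(\<lambda>k. snd (v (r k))) \<longlonglongrightarrow> ?\<beta>"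
        using tendsto_fst[OF lim] tendsto_snd[OF lim] by (simp_all add: o_def)
      have hr: "(\<lambda>k. h (r k) x) \<longlonglongrightarrow> g x"
        using LIMSEQ_subseq_LIMSEQ[OF insert.prems(2)[of x] r] by (simp add: o_def)
      show "(\<lambda>k. fst (v (r k)) *s h (r k) x - snd (v (r k)) *s e x) \<longlonglongrightarrow> ?\<alpha> *s g x - ?\<beta> *s e x"
        by (intro vec_tendstoI) (auto intro!: tendsto_intros a b tendsto_vec_nth[OF hr])
    qed
    then have mem: "(\<lambda>x. ?\<alpha> *s g x) - (\<lambda>x. ?\<beta> *s e x) \<in> cfun.span A" by (simp add: fun_diff_def)
    \<comment> \<open>Otherwise the limit relation would put \<open>e\<close> into the span of
      \<open>A\<close>.\<close>
    have "?\<alpha> \<noteq> 0"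
    proof
      assume 0: "?\<alpha> = 0"
      then have "norm ?\<beta> = 1" using L by (cases L) (simp add: norm_Pair)
      then have b: "?\<beta> \<noteq> 0" by auto
      from cfun.span_scale[OF mem, of "- 1 / ?\<beta>"] have "(\<lambda>x. (- 1 / ?\<beta>) *s (((\<lambda>x. ?\<alpha> *s g x) - (\<lambda>x. ?\<beta> *s e x)) x)) \<in> cfun.span A" .
      also have "(\<lambda>x. (- 1 / ?\<beta>) *s (((\<lambda>x. ?\<alpha> *s g x) - (\<lambda>x. ?\<beta> *s e x)) x)) = e"
        using 0 b by (simp add: fun_eq_iff vec_eq_iff)
      finally show False using False by simp
    qed
    moreover have "(\<lambda>x. ?\<alpha> *s g x) \<in> cfun.span (insert e A)"
      unfolding cfun.span_breakdown_eq using mem by blast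
    from cfun.span_scale[OF this, of "1 / ?\<alpha>"] have "(\<lambda>x. (1 / ?\<alpha>) *s (?\<alpha> *s g x)) \<in> cfun.span (insert e A)" .
    ultimately show ?thesis by (simp add: vector_smult_assoc)
  qed
qed


section \<open>Root functions\<close>

lemma L2_functional_add: "L2_functional l \<Longrightarrow> u \<in> L2 \<Longrightarrow> v \<in> L2 \<Longrightarrow> l (\<lambda>x. u x + v x) = l u + l v"
  by (simp add: L2_functional_def)

lemma L2_functional_sum:
  assumes "finite A" "\<And>i. i \<in> A \<Longrightarrow> L2_functional (l i)"
  shows "L2_functional (\<lambda>u. \<Sum>i\<in>A. c i * l i u)"
  using assms
proof (induction A rule: finite_induct)
  case empty
  show ?case unfolding L2_functional_def by (auto intro!: exI[of _ 0])
next
  case (insert i A)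
  let ?s = "\<lambda>u. \<Sum>i\<in>A. c i * l i u"
  have li: "L2_functional (l i)" and ls: "L2_functional ?s" using insert by auto
  obtain K where K: "\<And>u. u \<in> L2 \<Longrightarrow> norm (l i u) \<le> K * L2_norm u" using li unfolding L2_functional_def by blast
  obtain K' where K': "\<And>u. u \<in> L2 \<Longrightarrow> norm (?s u) \<le> K' * L2_norm u" using ls unfolding L2_functional_def by blast
  have "norm (c i * l i u + ?s u) \<le> (norm (c i) * K + K') * L2_norm u" if "u \<in> L2" for u
  proof -
    have "norm (c i * l i u + ?s u) \<le> norm (c i * l i u) + norm (?s u)" by (rule norm_triangle_ineq)
    also have "\<dots> \<le> norm (c i) * (K * L2_norm u) + K' * L2_norm u"
      unfolding norm_mult by (intro add_mono mult_left_mono K K' that) auto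
    finally show ?thesis by (simp add: algebra_simps)
  qed
  moreover have "c i * l i (\<lambda>x. u x + v x) + ?s (\<lambda>x. u x + v x) = (c i * l i u + ?s u) + (c i * l i v + ?s v)" if "u \<in> L2" "v \<in> L2" for u v
  proof -
    have "l i (\<lambda>x. u x + v x) = l i u + l i v" "?s (\<lambda>x. u x + v x) = ?s u + ?s v"
      using li ls that unfolding L2_functional_def by blast+
    then show ?thesis by (simp add: algebra_simps)
  qed
  moreover have "c i * l i (\<lambda>x. d *s u x) + ?s (\<lambda>x. d *s u x) = d * (c i * l i u + ?s u)" if "u \<in> L2" for u d
  proof -
    have "l i (\<lambda>x. d *s u x) = d * l i u" "?s (\<lambda>x. d *s u x) = d * ?s u"
      using li ls that unfolding L2_functional_def by blast+
    then show ?thesis by (simp add: algebra_simps)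
  qed
  ultimately show ?case unfolding L2_functional_def using insert.hyps by (simp; blast)
qed

lemma L2_functional_continuous:
  assumes l: "L2_functional l" and f: "f \<in> L2" "\<And>k. h k \<in> L2" and lim: "(\<lambda>k. L2_norm (\<lambda>x. f x - h k x)) \<longlonglongrightarrow> 0"
  shows "(\<lambda>k. l (h k)) \<longlonglongrightarrow> l f"
proof -
  obtain K where K: "\<And>u. u \<in> L2 \<Longrightarrow> norm (l u) \<le> K * L2_norm u" using l unfolding L2_functional_def by blast
  have eq: "l f - l (h k) = l (\<lambda>x. f x - h k x)" for k
  proof -
    have "l (\<lambda>x. h k x + (f x - h k x)) = l (h k) + l (\<lambda>x. f x - h k x)"
      by (rule L2_functional_add[OF l f(2) L2_diff[OF f]])
    then show ?thesis by simp
  qed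
  have "(\<lambda>k. l f - l (h k)) \<longlonglongrightarrow> 0"
  proof (rule Lim_null_comparison)
    show "\<forall>\<^sub>F k in sequentially. norm (l f - l (h k)) \<le> K * L2_norm (\<lambda>x. f x - h k x)"
      unfolding eq by (intro always_eventually allI K L2_diff f)
    show "(\<lambda>k. K * L2_norm (\<lambda>x. f x - h k x)) \<longlonglongrightarrow> 0" using tendsto_mult_left[OF lim, of K] by simp
  qed
  from tendsto_diff[OF tendsto_const[of "l f"] this] show ?thesis by simp
qed

context dirac_system
begin

text \<open>\<open>T \<mu>\<close> maps L2 into continuous functions, with sup norm controlled by
  the L2 norm, so a functional that is only sup-norm bounded becomes L2 bounded after
  composition.\<close>

lemma L2_functional_T:
  assumes l: "bounded_functional l" shows "L2_functional (\<lambda>h. l (T \<mu> h))"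
proof -
  obtain L where L: "L \<ge> 0" "\<And>u m. u \<in> C01 \<Longrightarrow> (\<And>x. x \<in> {0..1} \<Longrightarrow> norm (u x) \<le> m) \<Longrightarrow> norm (l u) \<le> L * m"
    by (rule bounded_functional_bound[OF l]) blast
  obtain K where K: "K \<ge> 0" "\<And>u x. u \<in> L2 \<Longrightarrow> x \<in> {0..1} \<Longrightarrow> (norm (T \<mu> u x))\<^sup>2 \<le> K * integral {0..x} (\<lambda>t. (norm (u t))\<^sup>2)"
    using T_bound by blast
  have "norm (l (T \<mu> u)) \<le> (L * sqrt K) * L2_norm u" if u: "u \<in> L2" for u
  proof -
    have "norm (T \<mu> u x) \<le> sqrt K * L2_norm u" if x: "x \<in> {0..1}" for x
    proof (rule power2_le_imp_le)
      have "(norm (T \<mu> u x))\<^sup>2 \<le> K * integral {0..x} (\<lambda>t. (norm (u t))\<^sup>2)" by (rule K(2)[OF u x])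
      also have "\<dots> \<le> K * (L2_norm u)\<^sup>2"
        unfolding L2_norm_power2[OF u] using x K(1) L2_sq_integrable_on[OF u]
        by (intro mult_left_mono integral_subset_le) auto
      finally show "(norm (T \<mu> u x))\<^sup>2 \<le> (sqrt K * L2_norm u)\<^sup>2" using K(1) by (simp add: power_mult_distrib)
    qed (use K(1) L2_norm_nonneg[of u] in simp)
    from L(2)[OF T_C01[OF u] this] show ?thesis by (simp add: mult.assoc)
  qed
  moreover have "l (T \<mu> (\<lambda>x. u x + v x)) = l (T \<mu> u) + l (T \<mu> v)" if "u \<in> L2" "v \<in> L2" for u v
    using that by (simp add: T_add bounded_functional_add[OF l] T_C01)
  moreover have "l (T \<mu> (\<lambda>x. c *s u x)) = c * l (T \<mu> u)" if "u \<in> L2" for u c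
    using that by (simp add: T_smult bounded_functional_smult[OF l] T_C01)
  ultimately show ?thesis unfolding L2_functional_def by blast
qed

lemma bounded_functional_T_iter:
  assumes l: "bounded_functional l" shows "bounded_functional (\<lambda>u. l ((T \<mu> ^^ j) u))"
proof (induction j)
  case 0 then show ?case using l by simp
next
  case (Suc j)
  have "bounded_functional (\<lambda>h. (\<lambda>u. l ((T \<mu> ^^ j) u)) (T \<mu> h))"
    by (rule L2_functional_imp_bounded_functional[OF L2_functional_T[OF Suc]])
  moreover have "(T \<mu> ^^ j) (T \<mu> h) = (T \<mu> ^^ Suc j) h" for h by (simp only: funpow_Suc_right o_apply)
  ultimately show ?case by simp
qed

end

context boundary_problem
begin

text \<open>Links the graph of the operator with the integral equation. In the graph the
  differential equation holds only almost everywhere, which the integrals do not notice.\<close>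

lemma sol_iff_operator:
  assumes B: "\<And>i j. B $ i $ j = (if i = j then inverse (of_real (a i)) else 0)"
  shows "(y, g) \<in> shifted (bvp_operator B Q C D) \<mu> \<longleftrightarrow> sol \<mu> g y \<and> bd y = 0"
proof
  have Bv: "(B *v v) $ i = v $ i / of_real (a i)" for v i
    by (simp add: matrix_vector_mult_def B mult_delta_left divide_inverse_commute)
  \<comment> \<open>Solves the differential equation for the derivative at one point;
    \<open>q\<close> stands for the value of \<open>Q x *v y x\<close>.\<close>
  have diff_eq: "(- \<i>) *s (B *v d) + q = f \<longleftrightarrow> d = adiag (f - q)" for d q f :: "complex^'n"
  proof -
    have "(- \<i>) * (d $ i / of_real (a i)) + q $ i = f $ i \<longleftrightarrow> d $ i = \<i> * of_real (a i) * (f $ i - q $ i)" for i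
    proof
      assume e: "(- \<i>) * (d $ i / of_real (a i)) + q $ i = f $ i"
      have "\<i> * of_real (a i) * (f $ i - q $ i) = \<i> * of_real (a i) * ((- \<i>) * (d $ i / of_real (a i)))" using e by (simp add: algebra_simps)
      then show "d $ i = \<i> * of_real (a i) * (f $ i - q $ i)" using a_nonzero[of i] by simp
    next
      assume e: "d $ i = \<i> * of_real (a i) * (f $ i - q $ i)"
      show "(- \<i>) * (d $ i / of_real (a i)) + q $ i = f $ i" unfolding e using a_nonzero[of i] by simp
    qed
    then show ?thesis by (simp add: vec_eq_iff Bv adiag_def del: mult_minus_left)
  qed
  show "sol \<mu> g y \<and> bd y = 0" if mem: "(y, g) \<in> shifted (bvp_operator B Q C D) \<mu>"
  proof -
    obtain f where f: "g = (\<lambda>x. f x - \<mu> *s y x)" and yf: "(y, f) \<in> bvp_operator B Q C D"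
      using mem unfolding shifted_def by blast
    obtain d where f2: "f \<in> L2" and bc: "C *v y 0 + D *v y 1 = 0" and W: "W12_deriv y d"
      and ae: "AE x in lebesgue_on {0..1}. (- \<i>) *s (B *v d x) + Q x *v y x = f x"
      using yf unfolding bvp_operator_def by blast
    have d2: "d \<in> L2" and y0: "\<And>x. x \<notin> {0..1} \<Longrightarrow> y x = 0"
      and yL: "\<And>x. x \<in> {0..1} \<Longrightarrow> y x = y 0 + integral\<^sup>L (lebesgue_on {0..x}) d"
      using W unfolding W12_deriv_def by blast+
    have int: "integrable (lebesgue_on {0..x}) u" if "u \<in> L2" "x \<in> {0..1}" for u :: "real \<Rightarrow> complex^'n" and x
    proof -
      have "u absolutely_integrable_on {0..x}"
        by (rule set_integrable_subset[OF L2_absolutely_integrable[OF that(1)]]) (use that in auto)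
      then show ?thesis by (simp add: integrable_lebesgue_on_iff)
    qed
    have "continuous_on {0..1} y \<longleftrightarrow> continuous_on {0..1} (\<lambda>x. y 0 + integral {0..x} d)"
    proof (rule continuous_on_cong[OF refl])
      fix x :: real assume x: "x \<in> {0..1}"
      have "integral\<^sup>L (lebesgue_on {0..x}) d = integral {0..x} d"
        by (rule lebesgue_integral_eq_integral[OF int[OF d2 x]]) simp
      then show "y x = y 0 + integral {0..x} d" using yL[OF x] by (simp only:)
    qed
    then have yc: "y \<in> C01" using y0 by (auto simp: C01_def intro!: continuous_intros L2_continuous_on_integral d2)
    have g2: "g \<in> L2" unfolding f by (intro L2_diff f2 L2_smult[OF C01_L2[OF yc]])
    have v2: "vfield \<mu> g y \<in> L2" by (rule vfield_L2[OF g2 yc])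
    have dv: "AE x in lebesgue_on {0..1}. d x = vfield \<mu> g y x"
      using ae by (rule AE_mp, intro AE_I2 impI, simp only: diff_eq) (simp add: vfield_adiag f)
    have "y x = y 0 + integral {0..x} (vfield \<mu> g y)" if x: "x \<in> {0..1}" for x
    proof -
      have "AE t in lebesgue_on {0..x}. d t = vfield \<mu> g y t"
        using dv x by (auto simp: AE_restrict_space_iff elim!: AE_mp)
      then have "integral\<^sup>L (lebesgue_on {0..x}) d = integral\<^sup>L (lebesgue_on {0..x}) (vfield \<mu> g y)"
        by (intro integral_cong_AE borel_measurable_integrable int d2 v2 x)
      also have "\<dots> = integral {0..x} (vfield \<mu> g y)"
        by (rule lebesgue_integral_eq_integral[OF int[OF v2 x]]) simp
      finally show ?thesis using yL[OF x] by simp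
    qed
    then show ?thesis using g2 yc bc unfolding sol_def bd_def by blast
  qed
  show "(y, g) \<in> shifted (bvp_operator B Q C D) \<mu>" if "sol \<mu> g y \<and> bd y = 0"
  proof -
    have s: "sol \<mu> g y" and b: "bd y = 0" using that by auto
    note g2 = sol_L2[OF s] and yc = sol_C01[OF s]
    define f where "f = (\<lambda>x. g x + \<mu> *s y x)"
    have f2: "f \<in> L2" unfolding f_def by (intro L2_add g2 L2_smult[OF C01_L2[OF yc]])
    have v2: "vfield \<mu> g y \<in> L2" by (rule vfield_L2[OF g2 yc])
    have "W12_deriv y (vfield \<mu> g y)"
      unfolding W12_deriv_def
    proof (intro conjI ballI allI impI)
      fix x :: real assume x: "x \<in> {0..1}"
      have "vfield \<mu> g y absolutely_integrable_on {0..x}"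
        by (rule set_integrable_subset[OF L2_absolutely_integrable[OF v2]]) (use x in auto)
      then have "integral\<^sup>L (lebesgue_on {0..x}) (vfield \<mu> g y) = integral {0..x} (vfield \<mu> g y)"
        by (intro lebesgue_integral_eq_integral) (simp_all add: integrable_lebesgue_on_iff)
      then show "y x = y 0 + integral\<^sup>L (lebesgue_on {0..x}) (vfield \<mu> g y)" using sol_eq[OF s x] by simp
    qed (use v2 yc in \<open>auto simp: C01_def\<close>)
    moreover have "(- \<i>) *s (B *v vfield \<mu> g y x) + Q x *v y x = f x" for x
      unfolding diff_eq by (simp add: vfield_adiag f_def)
    ultimately have "(y, f) \<in> bvp_operator B Q C D"
      using f2 b unfolding bvp_operator_def bd_def by auto
    moreover have "g = (\<lambda>x. f x - \<mu> *s y x)" by (simp add: f_def)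
    ultimately show ?thesis unfolding shifted_def by blast
  qed
qed

lemma R_add: "\<Delta> \<zeta> \<noteq> 0 \<Longrightarrow> g \<in> L2 \<Longrightarrow> h \<in> L2 \<Longrightarrow> R \<zeta> (\<lambda>x. g x + h x) = (\<lambda>x. R \<zeta> g x + R \<zeta> h x)"
proof (rule R_unique[symmetric])
  assume nz: "\<Delta> \<zeta> \<noteq> 0" and "g \<in> L2" "h \<in> L2"
  then show "sol \<zeta> (\<lambda>x. g x + h x) (\<lambda>x. R \<zeta> g x + R \<zeta> h x)" by (intro sol_add R_sol)
  have "bd (\<lambda>x. R \<zeta> g x + R \<zeta> h x) = bd (R \<zeta> g) + bd (R \<zeta> h)"
    by (simp add: bd_def matrix_vector_right_distrib)
  then show "bd (\<lambda>x. R \<zeta> g x + R \<zeta> h x) = 0" using nz \<open>g \<in> L2\<close> \<open>h \<in> L2\<close> by (simp add: R_bd)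
qed

lemma R_smult: "\<Delta> \<zeta> \<noteq> 0 \<Longrightarrow> h \<in> L2 \<Longrightarrow> R \<zeta> (\<lambda>x. c *s h x) = (\<lambda>x. c *s R \<zeta> h x)"
proof (rule R_unique[symmetric])
  assume nz: "\<Delta> \<zeta> \<noteq> 0" and "h \<in> L2"
  then show "sol \<zeta> (\<lambda>x. c *s h x) (\<lambda>x. c *s R \<zeta> h x)" by (intro sol_smult R_sol)
  have "bd (\<lambda>x. c *s R \<zeta> h x) = c *s bd (R \<zeta> h)"
    by (simp add: bd_def vector_scalar_commute vec.scale_right_distrib)
  then show "bd (\<lambda>x. c *s R \<zeta> h x) = 0" using nz \<open>h \<in> L2\<close> by (simp add: R_bd)
qed

text \<open>From (L - \<mu>) y = z follows (L - \<zeta>) y = z - (\<zeta> - \<mu>) y. Applying the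
  resolvent gives a recursion along chains of root functions.\<close>

lemma resolvent_of_chain_step:
  assumes "sol \<mu> z y" "bd y = 0" and nz: "\<Delta> \<zeta> \<noteq> 0"
  shows "y x = R \<zeta> z x - (\<zeta> - \<mu>) *s R \<zeta> y x"
proof -
  note z2 = sol_L2[OF assms(1)] and yc = sol_C01[OF assms(1)]
  note y2 = C01_L2[OF yc]
  have "sol \<zeta> (\<lambda>x. z x + (\<mu> - \<zeta>) *s y x) y" using sol_shift[OF yc] assms(1) by blast
  then have "y = R \<zeta> (\<lambda>x. z x + (\<mu> - \<zeta>) *s y x)" by (rule R_unique[OF nz _ assms(2)])
  also have "\<dots> = (\<lambda>x. R \<zeta> z x + (\<mu> - \<zeta>) *s R \<zeta> y x)"
    by (simp only: R_add[OF nz z2 L2_smult[OF y2]] R_smult[OF nz y2])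
  finally have "y x = R \<zeta> z x + (\<mu> - \<zeta>) *s R \<zeta> y x" by (rule fun_cong)
  then show ?thesis by (simp add: vec_eq_iff algebra_simps)
qed

text \<open>The function h enters only through the weights, which are finite combinations of
  boundary values of iterates of \<open>T \<mu>\<close> and therefore bounded on L2.\<close>

lemma residual_functional:
  assumes l: "bounded_functional l"
  shows "L2_functional (\<lambda>h. l (residual \<mu> h p))"
proof -
  have w: "L2_functional (\<lambda>h. fps_nth (weight \<mu> h k) q)" for k q
  proof -
    have "L2_functional (\<lambda>h. \<Sum>ji\<in>(UNIV::'n set) \<times> {..q}. fps_nth (adj_coeff \<mu> k (fst ji)) (snd ji) *
        (bd ((T \<mu> ^^ (q - snd ji)) (T \<mu> h)) $ fst ji))"
      by (rule L2_functional_sum) (auto intro!: L2_functional_T[OF bounded_functional_T_iter[OF bounded_functional_bd]])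
    moreover have "(\<Sum>ji\<in>(UNIV::'n set) \<times> {..q}. fps_nth (adj_coeff \<mu> k (fst ji)) (snd ji) *
        (bd ((T \<mu> ^^ (q - snd ji)) (T \<mu> h)) $ fst ji)) = fps_nth (weight \<mu> h k) q" for h
      by (simp add: weight_def fps_sum_nth fps_mult_nth atLeast0AtMost sum.cartesian_product')
    ultimately show ?thesis by simp
  qed
  have "L2_functional (\<lambda>h. \<Sum>ks\<in>(UNIV::'n set) \<times> {..p}. (- l ((T \<mu> ^^ snd ks) (Phi \<mu> (fst ks)))) * fps_nth (weight \<mu> h (fst ks)) (p - snd ks))"
    by (rule L2_functional_sum) (auto intro: w)
  moreover have "(\<Sum>ks\<in>(UNIV::'n set) \<times> {..p}. (- l ((T \<mu> ^^ snd ks) (Phi \<mu> (fst ks)))) * fps_nth (weight \<mu> h (fst ks)) (p - snd ks))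
      = l (residual \<mu> h p)" for h
    by (simp add: functional_residual[OF l] sum.cartesian_product' sum_negf mult.commute)
  ultimately show ?thesis by simp
qed

end

section \<open>Riesz projectors\<close>

context regular_problem
begin

text \<open>The residue of the resolvent at \<mu>, that is, minus the Riesz projector: the index
  \<open>pole_order \<mu> - 1\<close> belongs to the order -1. The case distinction guards against
  the truncated subtraction at 0.\<close>

definition riesz :: "complex \<Rightarrow> (real \<Rightarrow> complex^'n) \<Rightarrow> real \<Rightarrow> complex^'n" where
  "riesz \<mu> h = (if pole_order \<mu> = 0 then (\<lambda>x. 0) else residual \<mu> h (pole_order \<mu> - 1))"

lemma riesz_outside: "x \<notin> {0..1} \<Longrightarrow> riesz \<mu> h x = 0"
  using residual_C01[of \<mu> h "pole_order \<mu> - 1"] by (auto simp: riesz_def C01_def)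

lemma L2_functional_riesz: "x \<in> {0..1} \<Longrightarrow> L2_functional (\<lambda>h. riesz \<mu> h x $ i)"
  unfolding riesz_def using residual_functional[OF bounded_functional_eval[of x i], of \<mu> "pole_order \<mu> - 1"]
  by (cases "pole_order \<mu> = 0") (auto simp: L2_functional_def intro!: exI[of _ 0])

lemma riesz_add: assumes "g \<in> L2" "h \<in> L2" shows "riesz \<mu> (\<lambda>x. g x + h x) = (\<lambda>x. riesz \<mu> g x + riesz \<mu> h x)"
proof
  fix x
  show "riesz \<mu> (\<lambda>x. g x + h x) x = riesz \<mu> g x + riesz \<mu> h x"
  proof (cases "x \<in> {0..1}")
    case True
    then have "riesz \<mu> (\<lambda>x. g x + h x) x $ i = riesz \<mu> g x $ i + riesz \<mu> h x $ i" for i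
      using L2_functional_riesz[OF True, of \<mu> i] assms unfolding L2_functional_def by blast
    then show ?thesis by (simp add: vec_eq_iff)
  qed (simp add: riesz_outside)
qed

lemma riesz_smult: assumes "h \<in> L2" shows "riesz \<mu> (\<lambda>x. c *s h x) = (\<lambda>x. c *s riesz \<mu> h x)"
proof
  fix x
  show "riesz \<mu> (\<lambda>x. c *s h x) x = c *s riesz \<mu> h x"
  proof (cases "x \<in> {0..1}")
    case True
    then have "riesz \<mu> (\<lambda>x. c *s h x) x $ i = c * riesz \<mu> h x $ i" for i
      using L2_functional_riesz[OF True, of \<mu> i] assms unfolding L2_functional_def by blast
    then show ?thesis by (simp add: vec_eq_iff)
  qed (simp add: riesz_outside)
qed

text \<open>The spanning set does not depend on h; this is what makes root subspaces
  finite-dimensional.\<close>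

lemma riesz_finite_rank: "riesz \<mu> h \<in> cfun.span ((\<lambda>(k, s). (T \<mu> ^^ s) (Phi \<mu> k)) ` (UNIV \<times> {..<pole_order \<mu>}))"
proof (cases "pole_order \<mu>")
  case 0
  then show ?thesis using cfun.span_zero by (simp add: riesz_def zero_fun_def)
next
  case (Suc m)
  have "(\<Sum>k\<in>UNIV. \<Sum>s\<le>m. (\<lambda>x. (- fps_nth (weight \<mu> h k) (m - s)) *s (T \<mu> ^^ s) (Phi \<mu> k) x)) \<in>
      cfun.span ((\<lambda>(k, s). (T \<mu> ^^ s) (Phi \<mu> k)) ` (UNIV \<times> {..<pole_order \<mu>}))"
    by (intro cfun.span_sum cfun.span_scale cfun.span_base) (use Suc in force)
  moreover have "(\<Sum>k\<in>UNIV. \<Sum>s\<le>m. (\<lambda>x. (- fps_nth (weight \<mu> h k) (m - s)) *s (T \<mu> ^^ s) (Phi \<mu> k) x)) = residual \<mu> h m"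
  proof -
    have sf: "(\<Sum>i\<in>A. f i) x = (\<Sum>i\<in>A. f i x)" for A and f :: "'b \<Rightarrow> real \<Rightarrow> complex^'n" and x
      by (induction A rule: infinite_finite_induct) auto
    show ?thesis by (simp add: fun_eq_iff residual_def sf)
  qed
  ultimately show ?thesis using Suc by (simp add: riesz_def)
qed

end

section \<open>Root subspaces of the operator\<close>

locale regular_operator = regular_problem a Q C D
  for a :: "'n::finite \<Rightarrow> real" and Q :: "real \<Rightarrow> complex^'n^'n" and C D :: "complex^'n^'n" +
  fixes B :: "complex^'n^'n"
  assumes B: "\<And>i j. B $ i $ j = (if i = j then inverse (of_real (a i)) else 0)"
begin

abbreviation Lop where "Lop \<equiv> bvp_operator B Q C D"

lemma op_kernel_0: "op_kernel (shifted Lop \<mu> ^^ 0) = {0}"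
  by (auto simp: op_kernel_def)

text \<open>The first application of L - \<mu> is split off, not the last as in the definition of
  relational powers, so that induction can follow a chain from its top.\<close>

lemma op_kernel_Suc: "y \<in> op_kernel (shifted Lop \<mu> ^^ Suc k) \<longleftrightarrow> (\<exists>z. sol \<mu> z y \<and> bd y = 0 \<and> z \<in> op_kernel (shifted Lop \<mu> ^^ k))"
proof -
  have "shifted Lop \<mu> ^^ Suc k = shifted Lop \<mu> O shifted Lop \<mu> ^^ k" by (simp add: relpow_commute)
  then show ?thesis by (auto simp: op_kernel_def sol_iff_operator[OF B] simp del: relpow.simps)
qed

lemma op_kernel_C01: "y \<in> op_kernel (shifted Lop \<mu> ^^ k) \<Longrightarrow> y \<in> C01"
proof (cases k)
  case 0
  then show "y \<in> op_kernel (shifted Lop \<mu> ^^ k) \<Longrightarrow> y \<in> C01"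
    by (simp add: op_kernel_0 zero_fun_def C01_zero del: relpow.simps)
next
  case (Suc n)
  then show "y \<in> op_kernel (shifted Lop \<mu> ^^ k) \<Longrightarrow> y \<in> C01"
    unfolding Suc op_kernel_Suc using sol_C01 by blast
qed

text \<open>On a chain the resolvent is a Laurent polynomial: minus the sum of (L - \<mu>)^j y
  divided by (\<zeta> - \<mu>)^(j + 1). Only the coefficient with j = 0 is identified, since only
  the residue is read off later.\<close>

lemma op_kernel_resolvent:
  assumes "y \<in> op_kernel (shifted Lop \<mu> ^^ k)"
  shows "\<exists>c. c 0 = y \<and> (\<forall>\<zeta> x. \<Delta> \<zeta> \<noteq> 0 \<longrightarrow> \<zeta> \<noteq> \<mu> \<longrightarrow>
     R \<zeta> y x = - (\<Sum>j<k. (1 / (\<zeta> - \<mu>) ^ Suc j) *s c j x))"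
  using assms
proof (induction k arbitrary: y)
  case 0
  then have y: "y = (\<lambda>x. 0)" by (simp add: op_kernel_0 zero_fun_def del: relpow.simps)
  have "R \<zeta> y x = 0" if "\<Delta> \<zeta> \<noteq> 0" for \<zeta> x
    using fun_cong[OF R_smult[OF that L2_zero_fun, of 0], of x] by (simp add: y)
  then show ?case by (intro exI[of _ "\<lambda>j. y"]) simp
next
  case (Suc k)
  then obtain z where z: "sol \<mu> z y" "bd y = 0" "z \<in> op_kernel (shifted Lop \<mu> ^^ k)"
    unfolding op_kernel_Suc by blast
  from Suc.IH[OF z(3)] obtain c where c: "c 0 = z"
    "\<And>\<zeta> x. \<Delta> \<zeta> \<noteq> 0 \<Longrightarrow> \<zeta> \<noteq> \<mu> \<Longrightarrow> R \<zeta> z x = - (\<Sum>j<k. (1 / (\<zeta> - \<mu>) ^ Suc j) *s c j x)" by blast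
  \<comment> \<open>One step up the chain puts \<open>y\<close> in front and shifts the coefficients
    of \<open>z\<close>.\<close>
  define e where "e = (\<lambda>j. case j of 0 \<Rightarrow> y | Suc i \<Rightarrow> c i)"
  have "R \<zeta> y x = - (\<Sum>j<Suc k. (1 / (\<zeta> - \<mu>) ^ Suc j) *s e j x)" if nz: "\<Delta> \<zeta> \<noteq> 0" "\<zeta> \<noteq> \<mu>" for \<zeta> x
  proof -
    have d: "\<zeta> - \<mu> \<noteq> 0" using nz by simp
    have "(\<zeta> - \<mu>) *s R \<zeta> y x = R \<zeta> z x - y x"
      using resolvent_of_chain_step[OF z(1,2) nz(1), of x] by simp
    then have "(1 / (\<zeta> - \<mu>)) *s ((\<zeta> - \<mu>) *s R \<zeta> y x) = (1 / (\<zeta> - \<mu>)) *s (R \<zeta> z x - y x)" by (rule arg_cong)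
    moreover have "(1 / (\<zeta> - \<mu>)) *s ((\<zeta> - \<mu>) *s v) = v" for v :: "complex^'n"
      using d unfolding vector_smult_assoc by simp
    ultimately have "R \<zeta> y x = (1 / (\<zeta> - \<mu>)) *s (R \<zeta> z x - y x)" by (simp only:)
    also have "\<dots> = - ((1 / (\<zeta> - \<mu>)) *s y x + (\<Sum>j<k. (1 / (\<zeta> - \<mu>) ^ Suc (Suc j)) *s c j x))"
      unfolding c(2)[OF nz] by (simp add: vec_eq_iff sum_component algebra_simps sum_divide_distrib)
    also have "\<dots> = - (\<Sum>j<Suc k. (1 / (\<zeta> - \<mu>) ^ Suc j) *s e j x)"
      unfolding sum.lessThan_Suc_shift by (simp add: e_def)
    finally show ?thesis .
  qed
  then show ?case by (intro exI[of _ e]) (simp add: e_def)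
qed

text \<open>The Laurent polynomial of a chain has residue -y. It is compared with the formal
  expansion of the resolvent after clearing all negative powers.\<close>

lemma riesz_op_kernel_same:
  assumes y: "y \<in> op_kernel (shifted Lop \<mu> ^^ k)" shows "riesz \<mu> y = (\<lambda>x. - y x)"
proof
  fix x
  note yc = op_kernel_C01[OF y]
  note y2 = C01_L2[OF yc]
  let ?m = "pole_order \<mu>"
  show "riesz \<mu> y x = - y x"
  proof (cases "x \<in> {0..1} \<and> k > 0")
    case False
    have "y x = 0 \<and> riesz \<mu> y x = 0"
    proof (cases "x \<in> {0..1}")
      case True
      then have y0: "y = (\<lambda>x. 0)" using False y by (simp add: op_kernel_0 zero_fun_def del: relpow.simps)
      show ?thesis using fun_cong[OF riesz_smult[OF L2_zero_fun, of \<mu> 0], of x] by (simp add: y0)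
    qed (use yc in \<open>simp add: riesz_outside C01_def\<close>)
    then show ?thesis by simp
  next
    case True
    then have x: "x \<in> {0..1}" and k: "k > 0" by auto
    obtain \<zeta>\<^sub>0 where nz: "\<Delta> \<zeta>\<^sub>0 \<noteq> 0" by (rule \<Delta>_nontrivial)
    have "riesz \<mu> y x $ i = - y x $ i" for i
    proof -
      let ?l = "\<lambda>u. u x $ i"
      obtain H F where H: "H has_fps_expansion F"
        "eventually (\<lambda>z. H z = z ^ ?m * R (\<mu> + z) y x $ i) (at 0)"
        "\<And>p. p < ?m \<Longrightarrow> fps_nth F p = residual \<mu> y p x $ i"
        by (rule resolvent_fps_expansion[where \<mu> = \<mu>, OF nz y2 bounded_functional_eval[OF x, of i]]) blast
      obtain c where c0: "c 0 = y" and c: "\<And>\<zeta> x. \<Delta> \<zeta> \<noteq> 0 \<Longrightarrow> \<zeta> \<noteq> \<mu> \<Longrightarrow> R \<zeta> y x = - (\<Sum>j<k. (1 / (\<zeta> - \<mu>) ^ Suc j) *s c j x)"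
        using op_kernel_resolvent[OF y] by blast
      \<comment> \<open>The factor z^k makes every exponent nonnegative: for j < k the number ?m + k
        - Suc j involves no truncation.\<close>
      have E: "(\<lambda>z. z ^ k * H z + (\<Sum>j<k. (c j x $ i) * z ^ (?m + k - Suc j))) has_fps_expansion
          fps_X ^ k * F + (\<Sum>j<k. fps_const (c j x $ i) * fps_X ^ (?m + k - Suc j))"
        by (intro has_fps_expansion_add has_fps_expansion_mult has_fps_expansion_sum has_fps_expansion_const has_fps_expansion_fps_X_power H(1))
      have "eventually (\<lambda>z. z ^ k * H z + (\<Sum>j<k. (c j x $ i) * z ^ (?m + k - Suc j)) = 0) (at 0)"
        using H(2) eventually_\<Delta>_nonzero[OF nz, of \<mu>] eventually_at_ball'[of 1 0 UNIV, OF zero_less_one]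
      proof eventually_elim
        case (elim z)
        then have z: "z \<noteq> 0" and R: "R (\<mu> + z) y x $ i = - (\<Sum>j<k. (1 / z ^ Suc j) * c j x $ i)"
          using c[of "\<mu> + z" x] by (simp_all add: sum_component)
        have "z ^ k * z ^ ?m * (1 / z ^ Suc j) = z ^ (?m + k - Suc j)" if "j < k" for j
        proof -
          have "z ^ k * z ^ ?m = z ^ (?m + k - Suc j) * z ^ Suc j"
            using that by (simp only: power_add[symmetric]) (simp add: add.commute)
          then show ?thesis using z by (simp add: field_simps)
        qed
        then have t: "z ^ k * (z ^ ?m * ((1 / z ^ Suc j) * c j x $ i)) = c j x $ i * z ^ (?m + k - Suc j)" if "j < k" for j
          using that by (simp only: mult.assoc[symmetric]) (simp add: mult.commute)
        have "z ^ k * H z = - (\<Sum>j<k. z ^ k * (z ^ ?m * ((1 / z ^ Suc j) * c j x $ i)))"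
          unfolding elim(1) R by (simp only: mult_minus_right sum_distrib_left)
        also have "\<dots> = - (\<Sum>j<k. c j x $ i * z ^ (?m + k - Suc j))"
          by (rule arg_cong[of _ _ uminus], rule sum.cong[OF refl], rule t) simp
        finally show ?case by simp
      qed
      from has_fps_expansion_eventually_zero[OF E this]
      \<comment> \<open>This order singles out j = 0 in the sum and the coefficient of order ?m - 1
        in \<open>F\<close>, which is the residue. If ?m = 0 the latter is absent and
        \<open>riesz\<close> is zero by definition.\<close>
      have "fps_nth (fps_X ^ k * F + (\<Sum>j<k. fps_const (c j x $ i) * fps_X ^ (?m + k - Suc j))) (?m + k - 1) = 0" by simp
      moreover have "fps_nth (\<Sum>j<k. fps_const (c j x $ i) * fps_X ^ (?m + k - Suc j)) (?m + k - 1) = y x $ i"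
      proof -
        have "fps_nth (\<Sum>j<k. fps_const (c j x $ i) * fps_X ^ (?m + k - Suc j)) (?m + k - 1) = (\<Sum>j<k. if j = 0 then c j x $ i else 0)"
          unfolding fps_sum_nth by (rule sum.cong) (auto simp: fps_X_power_iff)
        also have "\<dots> = y x $ i" using k c0 by simp
        finally show ?thesis .
      qed
      moreover have "fps_nth (fps_X ^ k * F) (?m + k - 1) = riesz \<mu> y x $ i"
        using k H(3)[of "?m - 1"] by (cases "?m = 0") (auto simp: riesz_def fps_X_power_mult_nth)
      ultimately have "riesz \<mu> y x $ i + y x $ i = 0" by simp
      then show ?thesis by (simp add: add_eq_0_iff2)
    qed
    then show ?thesis by (simp add: vec_eq_iff)
  qed
qed

text \<open>The Laurent polynomial of the chain has its only pole at \<nu> and is analytic at \<mu>,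
  so the resolvent applied to y has no principal part at \<mu>.\<close>

lemma riesz_op_kernel_other:
  assumes y: "y \<in> op_kernel (shifted Lop \<nu> ^^ k)" and ne: "\<nu> \<noteq> \<mu>" shows "riesz \<mu> y = (\<lambda>x. 0)"
proof
  fix x
  note y2 = C01_L2[OF op_kernel_C01[OF y]]
  let ?m = "pole_order \<mu>"
  show "riesz \<mu> y x = 0"
  proof (cases "x \<in> {0..1} \<and> ?m > 0")
    case False
    then show ?thesis
    proof (cases "x \<in> {0..1}")
      case True
      then show ?thesis using False by (simp add: riesz_def)
    qed (rule riesz_outside)
  next
    case True
    then have x: "x \<in> {0..1}" and m: "?m > 0" by auto
    obtain \<zeta>\<^sub>0 where nz: "\<Delta> \<zeta>\<^sub>0 \<noteq> 0" by (rule \<Delta>_nontrivial)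
    have "riesz \<mu> y x $ i = 0" for i
    proof -
      obtain H F where H: "H has_fps_expansion F"
        "eventually (\<lambda>z. H z = z ^ ?m * R (\<mu> + z) y x $ i) (at 0)"
        "\<And>p. p < ?m \<Longrightarrow> fps_nth F p = residual \<mu> y p x $ i"
        by (rule resolvent_fps_expansion[where \<mu> = \<mu>, OF nz y2 bounded_functional_eval[OF x, of i]]) blast
      obtain c where c: "\<And>\<zeta> x. \<Delta> \<zeta> \<noteq> 0 \<Longrightarrow> \<zeta> \<noteq> \<nu> \<Longrightarrow> R \<zeta> y x = - (\<Sum>j<k. (1 / (\<zeta> - \<nu>) ^ Suc j) *s c j x)"
        using op_kernel_resolvent[OF y] by blast
      define v where "v = (\<lambda>\<zeta>. \<Sum>j<k. (1 / (\<zeta> - \<nu>) ^ Suc j) * c j x $ i)"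
      have "v analytic_on {\<mu>}" unfolding v_def using ne by (intro analytic_intros) auto
      then have v: "(\<lambda>z. v (\<mu> + z)) has_fps_expansion fps_expansion v \<mu>" by (rule analytic_at_imp_has_fps_expansion)
      have E: "(\<lambda>z. H z + z ^ ?m * v (\<mu> + z)) has_fps_expansion F + fps_X ^ ?m * fps_expansion v \<mu>"
        by (intro has_fps_expansion_add has_fps_expansion_mult has_fps_expansion_fps_X_power v H(1))
      have "eventually (\<lambda>z. z \<noteq> \<nu> - \<mu>) (at 0)"
        using t1_space_nhds[of 0 "\<nu> - \<mu>"] ne by (auto simp: eventually_nhds_conv_at)
      with H(2) eventually_\<Delta>_nonzero[OF nz, of \<mu>] have "eventually (\<lambda>z. H z + z ^ ?m * v (\<mu> + z) = 0) (at 0)"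
      proof eventually_elim
        case (elim z)
        then have "\<mu> + z \<noteq> \<nu>" by auto
        then show ?case using c[of "\<mu> + z" x] elim by (simp add: v_def sum_component)
      qed
      from has_fps_expansion_eventually_zero[OF E this]
      have "fps_nth (F + fps_X ^ ?m * fps_expansion v \<mu>) (?m - 1) = 0" by simp
      then have "fps_nth F (?m - 1) = 0" using m by (simp add: fps_X_power_mult_nth)
      then show ?thesis using H(3)[of "?m - 1"] m by (simp add: riesz_def)
    qed
    then show ?thesis by (simp add: vec_eq_iff)
  qed
qed

text \<open>The chain ends at index 0, where the right-hand side is zero; hence p + 1 applications
  of L - \<mu>.\<close>

lemma op_kernel_residual: "p < pole_order \<mu> \<Longrightarrow> h \<in> L2 \<Longrightarrow> residual \<mu> h p \<in> op_kernel (shifted Lop \<mu> ^^ Suc p)"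
proof (induction p)
  case 0
  obtain \<zeta>\<^sub>0 where nz: "\<Delta> \<zeta>\<^sub>0 \<noteq> 0" by (rule \<Delta>_nontrivial)
  have "sol \<mu> 0 (residual \<mu> h 0)" using residual_sol[of \<mu> 0 h] by (simp add: zero_fun_def)
  then show ?case unfolding op_kernel_Suc op_kernel_0 using residual_bd[OF nz 0(2,1)] by blast
next
  case (Suc p)
  obtain \<zeta>\<^sub>0 where nz: "\<Delta> \<zeta>\<^sub>0 \<noteq> 0" by (rule \<Delta>_nontrivial)
  have "sol \<mu> (residual \<mu> h p) (residual \<mu> h (Suc p))" using residual_sol[of \<mu> "Suc p" h] by simp
  moreover have "residual \<mu> h p \<in> op_kernel (shifted Lop \<mu> ^^ Suc p)" using Suc by simp
  ultimately show ?case unfolding op_kernel_Suc[where k = "Suc p"] using residual_bd[OF nz Suc.prems(2,1)] by blast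
qed

text \<open>A zero of \<open>\<Delta>\<close> gives a null vector of \<open>M \<mu>\<close>, which
  is the initial value of an eigenfunction. So principal parts can occur only at
  eigenvalues.\<close>

lemma pole_order_pos_eigenvalue:
  assumes "pole_order \<mu> > 0" shows "\<mu> \<in> eigenvalues Lop"
proof -
  have "fps_nth (fps_expansion \<Delta> \<mu>) 0 = 0" using assms unfolding pole_order_def by (intro nth_less_subdegree_zero)
  then have "\<Delta> \<mu> = 0" by (simp add: fps_expansion_def)
  then have "\<not> invertible (M \<mu>)" by (simp add: \<Delta>_def invertible_det_nz)
  then obtain c where c: "M \<mu> *v c = 0" "c \<noteq> 0"
    using matrix_left_invertible_ker[of "M \<mu>"] matrix_left_right_inverse[of _ "M \<mu>"] unfolding invertible_def by blast
  have "T \<mu> (\<lambda>x. 0) = (\<lambda>x. 0)" using T_smult[OF L2_zero_fun, of \<mu> 0] by simp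
  then have "bd (S \<mu> c (\<lambda>x. 0)) = 0" using bd_S[OF L2_zero_fun, of \<mu> c] c(1) by (simp add: bd_def)
  then have "(S \<mu> c (\<lambda>x. 0), (\<lambda>x. 0)) \<in> shifted Lop \<mu>"
    using S_sol[OF L2_zero_fun, of \<mu> c] sol_iff_operator[OF B] by blast
  then have "S \<mu> c (\<lambda>x. 0) \<in> op_kernel (shifted Lop \<mu>)" by (simp add: op_kernel_def zero_fun_def)
  moreover have "S \<mu> c (\<lambda>x. 0) \<noteq> 0" using S_init[OF L2_zero_fun, of \<mu> c] c(2) by (auto dest: fun_cong[of _ _ 0])
  ultimately show ?thesis unfolding eigenvalues_def by blast
qed

lemma root_subspace_riesz:
  assumes "y \<in> root_subspace Lop \<nu>"
  shows "y \<in> C01" "riesz \<mu> y = (if \<nu> = \<mu> then (\<lambda>x. - y x) else (\<lambda>x. 0))"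
proof -
  have "y \<in> C01 \<and> riesz \<mu> y = (if \<nu> = \<mu> then (\<lambda>x. - y x) else (\<lambda>x. 0))"
    using assms unfolding root_subspace_def
  proof (induction rule: cfun.span_induct_alt)
    case base
    have "riesz \<mu> (\<lambda>x. 0) = (\<lambda>x. 0)" using riesz_smult[OF L2_zero_fun, of \<mu> 0] by simp
    then show ?case by (simp add: zero_fun_def C01_zero)
  next
    case (step c x y)
    obtain k where k: "x \<in> op_kernel (shifted Lop \<nu> ^^ k)" using step(1) by blast
    note xc = op_kernel_C01[OF k]
    have "riesz \<mu> x = (if \<nu> = \<mu> then (\<lambda>t. - x t) else (\<lambda>x. 0))"
      using riesz_op_kernel_same[OF k] riesz_op_kernel_other[OF k, of \<mu>] by (cases "\<nu> = \<mu>") simp_all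
    moreover have "riesz \<mu> (\<lambda>t. c *s x t + y t) = (\<lambda>t. c *s riesz \<mu> x t + riesz \<mu> y t)"
      using step xc by (simp add: riesz_add L2_smult C01_L2 riesz_smult)
    ultimately have "riesz \<mu> (\<lambda>t. c *s x t + y t) = (if \<nu> = \<mu> then (\<lambda>t. - (c *s x t + y t)) else (\<lambda>x. 0))"
      using step by (auto simp: fun_eq_iff vec_eq_iff)
    moreover have "(\<lambda>t. c *s x t + y t) \<in> C01" using step xc by (intro C01_add C01_smult) auto
    ultimately show ?case by (simp add: plus_fun_def)
  qed
  then show "y \<in> C01" "riesz \<mu> y = (if \<nu> = \<mu> then (\<lambda>x. - y x) else (\<lambda>x. 0))" by auto
qed

section \<open>Completeness and minimality of the system\<close>

context
  fixes E \<Psi>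
  assumes E: "\<And>\<mu>. \<mu> \<in> eigenvalues Lop \<Longrightarrow> cfun.independent (E \<mu>) \<and> cfun.span (E \<mu>) = root_subspace Lop \<mu>"
    and \<Psi>: "\<Psi> = (\<Union>\<mu>\<in>eigenvalues Lop. E \<mu>)"
begin

lemma E_root: "\<mu> \<in> eigenvalues Lop \<Longrightarrow> e \<in> E \<mu> \<Longrightarrow> e \<in> root_subspace Lop \<mu>"
  using E cfun.span_base by metis

lemma system_L2: "\<Psi> \<subseteq> L2"
  using \<Psi> E_root root_subspace_riesz(1) C01_L2 by blast

text \<open>Every element of the domain is the resolvent, at a regular point, applied to some h. A
  functional separating it from the closed span annihilates all principal parts, hence also the
  resolvent applied to h.\<close>

lemma domain_subset_closed_span:
  assumes s: "sol \<zeta> g y" and b: "bd y = 0" shows "y \<in> closed_span \<Psi>"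
proof (rule ccontr)
  assume "y \<notin> closed_span \<Psi>"
  moreover have yc: "y \<in> C01" using s by (rule sol_C01)
  ultimately obtain l where l: "L2_functional l" "\<And>u. u \<in> \<Psi> \<Longrightarrow> l u = 0" "l y \<noteq> 0"
    using separating_functional[OF system_L2 C01_L2] by blast
  note bl = L2_functional_imp_bounded_functional[OF l(1)]
  have van: "l (residual \<mu> h p) = 0" if "p < pole_order \<mu>" "h \<in> L2" for \<mu> p h
  proof -
    have ev: "\<mu> \<in> eigenvalues Lop" using pole_order_pos_eigenvalue that by simp
    have "residual \<mu> h p \<in> root_subspace Lop \<mu>"
      unfolding root_subspace_def using op_kernel_residual[OF that] by (intro cfun.span_base) blast
    then have "residual \<mu> h p \<in> cfun.span (E \<mu>)" using E[OF ev] by simp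
    then have "residual \<mu> h p \<in> cfun.span \<Psi>" using cfun.span_mono[of "E \<mu>" \<Psi>] \<Psi> ev by blast
    then show ?thesis using L2_functional_span_zero[OF l(1) system_L2, of "residual \<mu> h p"] l(2) by blast
  qed
  \<comment> \<open>Any regular point will do; the parameter \<zeta> of the given equation need not
    be regular.\<close>
  obtain \<zeta>\<^sub>0 where nz: "\<Delta> \<zeta>\<^sub>0 \<noteq> 0" by (rule \<Delta>_nontrivial)
  define h where "h = (\<lambda>x. g x + (\<zeta> - \<zeta>\<^sub>0) *s y x)"
  have sh: "sol \<zeta>\<^sub>0 h y" unfolding h_def using sol_shift[OF yc] s by blast
  have "y = R \<zeta>\<^sub>0 h" by (rule R_unique[OF nz sh b])
  moreover have "l (R \<zeta>\<^sub>0 h) = 0"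
    using resolvent_functional_vanishes[OF sol_L2[OF sh] bl _ nz] van[OF _ sol_L2[OF sh]] by blast
  ultimately show False using l(3) by simp
qed

text \<open>A right-hand side \<open>g\<close> is read off from the equation at \<zeta> = 0, which
  places \<open>y\<close> in the domain.\<close>

lemma smooth_in_closed_span:
  assumes yc: "y \<in> C01" and y'c: "continuous_on {0..1} y'"
    and dy: "\<And>x. x \<in> {0..1} \<Longrightarrow> (y has_vector_derivative y' x) (at x within {0..1})"
    and "y 0 = 0" "y 1 = 0"
  shows "y \<in> closed_span \<Psi>"
proof (rule domain_subset_closed_span)
  define g where "g = (\<lambda>x. (\<chi> i. y' x $ i / (\<i> * of_real (a i))) + Q x *v y x)"
  have "continuous_on {0..1} (\<lambda>x. \<chi> i. y' x $ i / (\<i> * of_real (a i)))"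
    using a_nonzero by (intro continuous_intros y'c) auto
  then have g2: "g \<in> L2" unfolding g_def by (intro L2_add continuous_on_imp_L2 potential_L2 yc)
  have v: "vfield 0 g y = y'" using a_nonzero by (simp add: fun_eq_iff vec_eq_iff vfield_def g_def)
  have "y x = y 0 + integral {0..x} (vfield 0 g y)" if x: "x \<in> {0..1}" for x
  proof -
    have "(y' has_integral y x - y 0) {0..x}"
    proof (rule fundamental_theorem_of_calculus)
      show "(y has_vector_derivative y' t) (at t within {0..x})" if "t \<in> {0..x}" for t
        by (rule has_vector_derivative_within_subset[OF dy]) (use that x in auto)
    qed (use x in simp)
    then show ?thesis unfolding v by (simp add: integral_unique)
  qed
  then show "sol 0 g y" unfolding sol_def using g2 yc by blast
  show "bd y = 0" using assms(4,5) by (simp add: bd_def)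
qed

lemma system_complete: "complete_system \<Psi>"
proof -
  have "f \<in> closed_span \<Psi>" if f: "f \<in> L2" for f
    unfolding closed_span_def
  proof (intro CollectI conjI f allI impI)
    fix \<epsilon> :: real assume \<epsilon>: "\<epsilon> > 0"
    then have e2: "\<epsilon> / 2 > 0" by simp
    obtain y y' where y: "y \<in> C01" "continuous_on {0..1} y'"
      "\<And>x. x \<in> {0..1} \<Longrightarrow> (y has_vector_derivative y' x) (at x within {0..1})"
      "y 0 = 0" "y 1 = 0" "L2_norm (\<lambda>x. f x - y x) < \<epsilon> / 2"
      by (rule L2_smooth_dense[OF f e2]) blast
    have "y \<in> closed_span \<Psi>" by (rule smooth_in_closed_span[OF y(1-5)])
    then obtain h where h: "h \<in> cfun.span \<Psi>" "L2_norm (y - h) < \<epsilon> / 2"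
      unfolding closed_span_def using e2 by blast
    have "L2_norm (f - h) \<le> L2_norm (\<lambda>x. f x - y x) + L2_norm (y - h)"
      using L2_norm_triangle_diff[OF f C01_L2[OF y(1)] cfun_span_L2[OF system_L2 h(1)]] by (simp add: fun_diff_def)
    then have "L2_norm (f - h) < \<epsilon>" using y(6) h(2) by simp
    then show "\<exists>h\<in>cfun.span \<Psi>. L2_norm (f - h) < \<epsilon>" using h(1) by blast
  qed
  then have "closed_span \<Psi> = L2" unfolding closed_span_def by blast
  then show ?thesis unfolding complete_system_def using system_L2 by blast
qed

text \<open>Suppose that f is approximated from the span of the other functions. The Riesz map sends
  the approximants into the span of \<open>E \<mu> - {f}\<close>, since it is minus the identity on
  that span and kills the other root subspaces. This span is closed under pointwise limits, so it
  would contain f, against independence.\<close>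

lemma system_minimal: "minimal_system \<Psi>"
  unfolding minimal_system_def
proof (intro conjI system_L2 ballI notI)
  fix f assume f: "f \<in> \<Psi>" and cl: "f \<in> closed_span (\<Psi> - {f})"
  obtain \<mu> where \<mu>: "\<mu> \<in> eigenvalues Lop" "f \<in> E \<mu>" using f \<Psi> by blast
  note ind = E[OF \<mu>(1), THEN conjunct1]
  have fr: "f \<in> root_subspace Lop \<mu>" by (rule E_root[OF \<mu>])
  have f2: "f \<in> L2" using system_L2 f by blast
  \<comment> \<open>Up to sign \<open>riesz \<mu>\<close> reproduces every element of
    \<open>E \<mu>\<close>, so this independent set lies in the span of finitely many
    functions.\<close>
  have "finite (E \<mu>)"
  proof -
    let ?U = "(\<lambda>(k, s). (T \<mu> ^^ s) (Phi \<mu> k)) ` (UNIV \<times> {..<pole_order \<mu>})"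
    have "E \<mu> \<subseteq> cfun.span ?U"
    proof
      fix e assume "e \<in> E \<mu>"
      then have "riesz \<mu> e = (\<lambda>x. - e x)" using root_subspace_riesz(2)[OF E_root[OF \<mu>(1)], of e \<mu>] by simp
      then have "(\<lambda>x. (-1) *s riesz \<mu> e x) = e" by simp
      then show "e \<in> cfun.span ?U" using cfun.span_scale[OF riesz_finite_rank, of "-1" \<mu> e] by simp
    qed
    then show ?thesis using cfun.independent_span_bound[of ?U "E \<mu>"] ind by simp
  qed
  then have fin: "finite (E \<mu> - {f})" by simp
  have sub: "\<Psi> - {f} \<subseteq> L2" using system_L2 by blast
  have P: "h \<in> L2 \<and> riesz \<mu> h \<in> cfun.span (E \<mu> - {f})" if "h \<in> cfun.span (\<Psi> - {f})" for h
    using that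
  proof (induction rule: cfun.span_induct_alt)
    case base
    have "riesz \<mu> (\<lambda>x. 0) = (\<lambda>x. 0)" using riesz_smult[OF L2_zero_fun, of \<mu> 0] by simp
    moreover have "0 \<in> cfun.span (E \<mu> - {f})" by (rule cfun.span_zero)
    ultimately show ?case using L2_zero_fun by (simp add: zero_fun_def)
  next
    case (step c x y)
    obtain \<nu> where \<nu>: "\<nu> \<in> eigenvalues Lop" "x \<in> E \<nu>" using step(1) \<Psi> by blast
    have xr: "riesz \<mu> x = (if \<nu> = \<mu> then (\<lambda>t. - x t) else (\<lambda>x. 0))"
      by (rule root_subspace_riesz(2)[OF E_root[OF \<nu>]])
    have "riesz \<mu> x \<in> cfun.span (E \<mu> - {f})"
    proof (cases "\<nu> = \<mu>")
      case True
      then have "x \<in> cfun.span (E \<mu> - {f})" using \<nu> step(1) by (intro cfun.span_base) auto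
      from cfun.span_scale[OF this, of "-1"] show ?thesis using xr True by simp
    next
      case False
      then show ?thesis using xr cfun.span_zero by (simp add: zero_fun_def)
    qed
    moreover have x2: "x \<in> L2" using step(1) sub by blast
    then have "riesz \<mu> (\<lambda>t. c *s x t + y t) = (\<lambda>t. c *s riesz \<mu> x t + riesz \<mu> y t)"
      using step by (simp add: riesz_add L2_smult riesz_smult)
    ultimately have "riesz \<mu> (\<lambda>t. c *s x t + y t) \<in> cfun.span (E \<mu> - {f})"
      using cfun.span_add[OF cfun.span_scale, of "riesz \<mu> x" _ "riesz \<mu> y" c] step by (simp add: plus_fun_def)
    moreover have "(\<lambda>t. c *s x t + y t) \<in> L2" using x2 step by (intro L2_add L2_smult) auto
    ultimately show ?case by (simp add: plus_fun_def)
  qed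
  have "\<exists>h. h \<in> cfun.span (\<Psi> - {f}) \<and> L2_norm (f - h) < 1 / real (Suc k)" for k
  proof -
    have "1 / real (Suc k) > 0" by simp
    then show ?thesis using cl unfolding closed_span_def by blast
  qed
  then obtain h where h: "\<And>k. h k \<in> cfun.span (\<Psi> - {f})" "\<And>k::nat. L2_norm (f - h k) < 1 / real (Suc k)" by metis
  have lim0: "(\<lambda>k. L2_norm (\<lambda>x. f x - h k x)) \<longlonglongrightarrow> 0"
  proof (rule tendsto_sandwich[OF _ _ tendsto_const])
    show "(\<lambda>k. 1 / real (Suc k)) \<longlonglongrightarrow> 0" by (rule LIMSEQ_Suc[OF lim_1_over_n])
    show "\<forall>\<^sub>F k in sequentially. L2_norm (\<lambda>x. f x - h k x) \<le> 1 / real (Suc k)"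
      using h(2) unfolding fun_diff_def by (intro always_eventually allI less_imp_le) blast
  qed (simp add: L2_norm_nonneg)
  \<comment> \<open>Convergence in L2 becomes pointwise after applying \<open>riesz \<mu>\<close>,
    because each component of its values is an L2 functional.\<close>
  have lim: "(\<lambda>k. riesz \<mu> (h k) x) \<longlonglongrightarrow> riesz \<mu> f x" for x
  proof (cases "x \<in> {0..1}")
    case True
    show ?thesis
      by (intro vec_tendstoI L2_functional_continuous[OF L2_functional_riesz[OF True] f2 _ lim0]) (use P h in blast)
  qed (simp add: riesz_outside)
  have "riesz \<mu> f \<in> cfun.span (E \<mu> - {f})"
    by (rule cfun_span_pointwise_closed[OF fin _ lim]) (use P h in blast)
  from cfun.span_scale[OF this, of "-1"] have "f \<in> cfun.span (E \<mu> - {f})"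
    using root_subspace_riesz(2)[OF fr, of \<mu>] by simp
  then show False using ind \<mu>(2) unfolding cfun.dependent_def by blast
qed

end

end

theorem corollary1p3:
  fixes p :: "'n::finite \<Rightarrow> 'r::finite"
    and b :: "'r \<Rightarrow> complex"
    and B C D :: "complex^'n^'n"
    and Q :: "real \<Rightarrow> complex^'n^'n"
    and \<Psi> :: "(real \<Rightarrow> complex^'n) set"
  assumes "surj p" and "inj b" and "\<And>j. b j \<noteq> 0"
    and "B = block_diag p b"
    and "hermitian B"
    and "rank (hconcat C D) = CARD('n)"
    and "Q \<in> L2"
    and "det (C ** pos_projector B + D ** neg_projector B) \<noteq> 0"
    and "det (C ** neg_projector B + D ** pos_projector B) \<noteq> 0"
    and "root_function_system (bvp_operator B Q C D) \<Psi>"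
  shows "complete_system \<Psi> \<and> minimal_system \<Psi>"
proof -
  \<comment> \<open>Hermitian symmetry makes every \<open>b (p i)\<close> real, so the real part
    loses nothing.\<close>
  define a where "a = (\<lambda>i. Re (b (p i)))"
  have "cnj (B $ i $ i) = B $ i $ i" for i
    using arg_cong[OF assms(5)[unfolded hermitian_def], of "\<lambda>A. A $ i $ i"]
    by (simp add: map_matrix_def transpose_def)
  then have "cnj (inverse (b (p i))) = inverse (b (p i))" for i
    by (simp add: assms(4) block_diag_def)
  then have "cnj (b (p i)) = b (p i)" for i
    by (metis complex_cnj_inverse inverse_inverse_eq)
  then have ba: "b (p i) = of_real (a i)" for i
    unfolding a_def by (metis Reals_cnj_iff of_real_Re)
  have anz: "a i \<noteq> 0" for i using assms(3)[of "p i"] ba[of i] by auto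
  have Bd: "B = (\<chi> i j. if i = j then inverse (of_real (a i)) else 0)"
    unfolding assms(4) block_diag_def ba ..
  \<comment> \<open>Since 1 / a i and a i have the same sign, the spectral projectors of
    \<open>B\<close> are the coordinate projectors for a i > 0 and a i < 0.\<close>
  have inv: "inverse (complex_of_real (a i)) = complex_of_real (inverse (a i))" for i by simp
  have pos: "pos_projector B = proj {i. a i > 0}"
    unfolding pos_projector_def Bd spectral_projector_diag proj_def inv
    by (auto simp: vec_eq_iff of_real_eq_iff simp del: of_real_inverse)
  have neg: "neg_projector B = proj {i. a i < 0}"
    unfolding neg_projector_def Bd spectral_projector_diag proj_def inv
    by (auto simp: vec_eq_iff of_real_eq_iff simp del: of_real_inverse)
  interpret regular_operator a Q C D B
    by unfold_locales (use anz assms(7) assms(8,9)[unfolded pos neg] in \<open>auto simp: Bd\<close>)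
  obtain E where E: "\<And>\<mu>. \<mu> \<in> eigenvalues Lop \<Longrightarrow> cfun.independent (E \<mu>) \<and> cfun.span (E \<mu>) = root_subspace Lop \<mu>"
    and \<Psi>: "\<Psi> = (\<Union>\<mu>\<in>eigenvalues Lop. E \<mu>)"
    using assms(10) unfolding root_function_system_def by blast
  show ?thesis using system_complete[OF E \<Psi>] system_minimal[OF E \<Psi>] by blast
qed


end
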